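(* Let $(\mathcal{K},\varphi)\xrightarrow{T}(\mathcal{L},\psi)$ be a morphism of OCP maps on a $C^*$-algebra $\mathcal{A}$ and let $(\mathcal{L},\mathcal{I},\rho,W)$ be any Stinespring representation of $\psi$. Then there exists a unique morphism $(\mathcal{K},\mathcal{H}_\varphi,\pi_\varphi,V_\varphi)\xrightarrow{\mathcal{T}}(\mathcal{L},\mathcal{I},\rho,W)$ of anchored representations such that $\mathbf{rest}_{\mathcal{A}}(\mathcal{T})=T$. Furthermore, if $T$ is a morphism of operator states, then $\mathcal{T}$ is a morphism of preserving anchored representations.
   Context: All $C^*$-algebras and $^*$-homomorphisms (in particular all representations) are unital. CP means completely positive; $\mathcal{B}(\mathcal{K})$ denotes the bounded operators on a Hilbert space $\mathcal{K}$; inner products are linear in the right variable. An OCP map on $\mathcal{A}$ is a pair $(\mathcal{K},\varphi)$ with $\mathcal{K}$ a Hilbert space and $\varphi:\mathcal{A}\to\mathcal{B}(\mathcal{K})$ a CP linear map; it is an operator state if $\varphi$ is unital. A morphism $T:(\mathcal{K},\varphi)\to(\mathcal{L},\psi)$ of OCP maps is a bounded linear map $T:\mathcal{K}\to\mathcal{L}$ with $T\varphi(a)=\psi(a)T$ for all $a\in\mathcal{A}$; a morphism of operator states is such a $T$ between operator states that is an isometry. An anchored representation of $\mathcal{A}$ is a quadruple $(\mathcal{K},\mathcal{H},\pi,V)$ with $\mathcal{K},\mathcal{H}$ Hilbert spaces, $\pi:\mathcal{A}\to\mathcal{B}(\mathcal{H})$ a $^*$-homomorphism, and $V:\mathcal{K}\to\mathcal{H}$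 bounded linear; it is preserving if $V$ is an isometry. A morphism $(T,L):(\mathcal{K},\mathcal{H},\pi,V)\to(\mathcal{L},\mathcal{I},\rho,W)$ consists of bounded linear maps $T:\mathcal{K}\to\mathcal{L}$, $L:\mathcal{H}\to\mathcal{I}$ with $L\pi(a)=\rho(a)L$ for all $a\in\mathcal{A}$, $LV=WT$, and $TV^*=W^*L$; a morphism of preserving anchored representations is such a pair with $V,W,T,L$ isometries. The functor $\mathbf{rest}_{\mathcal{A}}$ sends $(\mathcal{K},\mathcal{H},\pi,V)$ to the OCP map $(\mathcal{K},V^*\pi(\cdot)V)$ and $(T,L)$ to $T$. A Stinespring representation of an OCP map $(\mathcal{K},\varphi)$ is an anchored representation $(\mathcal{K},\mathcal{H},\pi,V)$ with $\varphi(a)=V^*\pi(a)V$ for all $a\in\mathcal{A}$. $(\mathcal{K},\mathcal{H}_\varphi,\pi_\varphi,V_\varphi)=\mathbf{Stine}_{\mathcal{A}}(\mathcal{K},\varphi)$ is Stinespring's construction: on the algebraic tensor product $\mathcal{A}\otimes\mathcal{K}$ put the sesquilinear form $\langle\!\langle\sum_i a_i\otimes v_i,\sum_j b_j\otimes w_j\rangle\!\rangle_\varphi=\sum_{i,j}\langle v_i,\varphi(a_i^*b_j)w_j\rangle_{\mathcal{K}}$, let $\mathcal{N}_\varphi=\{\zeta:\langle\!\langle\zeta,\zeta\rangle\!\rangle_\varphi=0\}$, let $\mathcal{H}_\varphi$ be the Hilbert space completion of $(\mathcal{A}\otimes\mathcal{K})/\mathcal{N}_\varphi$, let $\pi_\varphi(a)$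 be the bounded operator determined by $[\sum_i a_i\otimes v_i]\mapsto[\sum_i aa_i\otimes v_i]$, and let $V_\varphi(w)=[1_{\mathcal{A}}\otimes w]$. *)

theory Defs
  imports
    "HOL-Analysis.Analysis"
    "HOL-Algebra.Module"
    "HOL-Algebra.AbelCoset"
    "HOL-Library.Poly_Mapping"
begin

text \<open>
  Hilbert spaces and C*-algebras are records with an explicit carrier, since the Stinespring space
  depends on the given map and so is not the universe of a type.  Maps between carriers
  (operators, CP maps, representations) are extensional functions, so that HOL equality of maps is
  equality on the carrier.
\<close>

definition complex_ring :: "complex ring"
  where "complex_ring =
    \<lparr>carrier = UNIV, monoid.mult = (*), one = 1, ring.zero = 0, add = (+)\<rparr>"


section \<open>Hilbert spaces\<close>

text \<open>The ring fields \<open>mult\<close> and \<open>one\<close> inherited from \<open>module\<close> play no role for a vector space.\<close>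

record 'h inner_space = "(complex, 'h) module" +
  inprod :: "'h \<Rightarrow> 'h \<Rightarrow> complex"

definition hnorm :: "('h, 'm) inner_space_scheme \<Rightarrow> 'h \<Rightarrow> real"
  where "hnorm H x = sqrt (Re (inprod H x x))"

text \<open>Distances are set to \<open>0\<close> off the carrier because \<open>Metric_space\<close> demands symmetry
  on the whole type.\<close>

definition hdist :: "('h, 'm) inner_space_scheme \<Rightarrow> 'h \<Rightarrow> 'h \<Rightarrow> real"
  where "hdist H x y =
    (if x \<in> carrier H \<and> y \<in> carrier H then hnorm H (x \<ominus>\<^bsub>H\<^esub> y) else 0)"

locale inner_product_space = Module.module complex_ring H
  for H :: "('h, 'm) inner_space_scheme" (structure) +
  assumes inprod_add_right: "\<lbrakk>x \<in> carrier H; y \<in> carrier H; z \<in> carrier H\<rbrakk> \<Longrightarrow>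
      inprod H x (y \<oplus> z) = inprod H x y + inprod H x z"
    and inprod_smult_right: "\<lbrakk>x \<in> carrier H; y \<in> carrier H\<rbrakk> \<Longrightarrow>
      inprod H x (c \<odot>\<^bsub>H\<^esub> y) = c * inprod H x y"
    and inprod_cnj: "\<lbrakk>x \<in> carrier H; y \<in> carrier H\<rbrakk> \<Longrightarrow>
      inprod H y x = cnj (inprod H x y)"
    and inprod_nonneg: "x \<in> carrier H \<Longrightarrow> 0 \<le> Re (inprod H x x)"
    and inprod_definite: "\<lbrakk>x \<in> carrier H; inprod H x x = 0\<rbrakk> \<Longrightarrow> x = \<zero>"

locale hilbert_space = inner_product_space +
  assumes complete: "Metric_space.mcomplete (carrier H) (hdist H)"


section \<open>Bounded operators\<close>

definition bounded_ops ::
    "('h, 'm) inner_space_scheme \<Rightarrow> ('k, 'n) inner_space_scheme \<Rightarrow> ('h \<Rightarrow> 'k) set"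
  where "bounded_ops H K = {T \<in> carrier H \<rightarrow>\<^sub>E carrier K.
    (\<forall>x\<in>carrier H. \<forall>y\<in>carrier H. T (x \<oplus>\<^bsub>H\<^esub> y) = T x \<oplus>\<^bsub>K\<^esub> T y) \<and>
    (\<forall>c. \<forall>x\<in>carrier H. T (c \<odot>\<^bsub>H\<^esub> x) = c \<odot>\<^bsub>K\<^esub> T x) \<and>
    (\<exists>B. \<forall>x\<in>carrier H. hnorm K (T x) \<le> B * hnorm H x)}"

definition adjoint_op ::
    "('h, 'm) inner_space_scheme \<Rightarrow> ('k, 'n) inner_space_scheme \<Rightarrow> ('h \<Rightarrow> 'k) \<Rightarrow> 'k \<Rightarrow> 'h"
  where "adjoint_op H K T = (THE S. S \<in> bounded_ops K H \<and>
    (\<forall>x\<in>carrier H. \<forall>y\<in>carrier K. inprod K (T x) y = inprod H x (S y)))"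

definition is_isometry ::
    "('h, 'm) inner_space_scheme \<Rightarrow> ('k, 'n) inner_space_scheme \<Rightarrow> ('h \<Rightarrow> 'k) \<Rightarrow> bool"
  where "is_isometry H K T \<longleftrightarrow>
    T \<in> bounded_ops H K \<and> (\<forall>x\<in>carrier H. hnorm K (T x) = hnorm H x)"


section \<open>Unital C*-algebras\<close>

record 'a star_algebra = "(complex, 'a) module" +
  star :: "'a \<Rightarrow> 'a"

record 'a normed_star_algebra = "'a star_algebra" +
  algnorm :: "'a \<Rightarrow> real"

definition algdist :: "('a, 'm) normed_star_algebra_scheme \<Rightarrow> 'a \<Rightarrow> 'a \<Rightarrow> real"
  where "algdist A x y =
    (if x \<in> carrier A \<and> y \<in> carrier A then algnorm A (x \<ominus>\<^bsub>A\<^esub> y) else 0)"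

locale cstar_algebra = Ring.ring A + Module.module complex_ring A
  for A :: "('a, 'm) normed_star_algebra_scheme" (structure) +
  assumes smult_mult_left: "\<lbrakk>x \<in> carrier A; y \<in> carrier A\<rbrakk> \<Longrightarrow>
      (c \<odot>\<^bsub>A\<^esub> x) \<otimes> y = c \<odot>\<^bsub>A\<^esub> (x \<otimes> y)"
    and smult_mult_right: "\<lbrakk>x \<in> carrier A; y \<in> carrier A\<rbrakk> \<Longrightarrow>
      x \<otimes> (c \<odot>\<^bsub>A\<^esub> y) = c \<odot>\<^bsub>A\<^esub> (x \<otimes> y)"
    and star_closed: "x \<in> carrier A \<Longrightarrow> star A x \<in> carrier A"
    and star_star: "x \<in> carrier A \<Longrightarrow> star A (star A x) = x"
    and star_add: "\<lbrakk>x \<in> carrier A; y \<in> carrier A\<rbrakk> \<Longrightarrow>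
      star A (x \<oplus> y) = star A x \<oplus> star A y"
    and star_smult: "x \<in> carrier A \<Longrightarrow> star A (c \<odot>\<^bsub>A\<^esub> x) = cnj c \<odot>\<^bsub>A\<^esub> star A x"
    and star_mult: "\<lbrakk>x \<in> carrier A; y \<in> carrier A\<rbrakk> \<Longrightarrow>
      star A (x \<otimes> y) = star A y \<otimes> star A x"
    and algnorm_zero_iff: "x \<in> carrier A \<Longrightarrow> algnorm A x = 0 \<longleftrightarrow> x = \<zero>"
    and algnorm_triangle: "\<lbrakk>x \<in> carrier A; y \<in> carrier A\<rbrakk> \<Longrightarrow>
      algnorm A (x \<oplus> y) \<le> algnorm A x + algnorm A y"
    and algnorm_smult: "x \<in> carrier A \<Longrightarrow> algnorm A (c \<odot>\<^bsub>A\<^esub> x) = cmod c * algnorm A x"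
    and algnorm_mult: "\<lbrakk>x \<in> carrier A; y \<in> carrier A\<rbrakk> \<Longrightarrow>
      algnorm A (x \<otimes> y) \<le> algnorm A x * algnorm A y"
    and algnorm_star_mult: "x \<in> carrier A \<Longrightarrow> algnorm A (star A x \<otimes> x) = (algnorm A x)\<^sup>2"
    and complete: "Metric_space.mcomplete (carrier A) (algdist A)"

text \<open>The *-algebra of bounded operators on a Hilbert space; its norm is not needed below.\<close>

definition op_algebra :: "('h, 'm) inner_space_scheme \<Rightarrow> ('h \<Rightarrow> 'h) star_algebra"
  where "op_algebra H =
    \<lparr>carrier = bounded_ops H H,
     monoid.mult = compose (carrier H),
     one = (\<lambda>x\<in>carrier H. x),
     ring.zero = (\<lambda>x\<in>carrier H. \<zero>\<^bsub>H\<^esub>),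
     add = (\<lambda>S T. \<lambda>x\<in>carrier H. S x \<oplus>\<^bsub>H\<^esub> T x),
     smult = (\<lambda>c T. \<lambda>x\<in>carrier H. c \<odot>\<^bsub>H\<^esub> T x),
     star = adjoint_op H H\<rparr>"

definition star_hom ::
    "('a, 'm) star_algebra_scheme \<Rightarrow> ('b, 'n) star_algebra_scheme \<Rightarrow> ('a \<Rightarrow> 'b) \<Rightarrow> bool"
  where "star_hom A B \<pi> \<longleftrightarrow> \<pi> \<in> ring_hom A B \<and> \<pi> \<in> extensional (carrier A) \<and>
    (\<forall>c. \<forall>a\<in>carrier A. \<pi> (c \<odot>\<^bsub>A\<^esub> a) = c \<odot>\<^bsub>B\<^esub> \<pi> a) \<and>
    (\<forall>a\<in>carrier A. \<pi> (star A a) = star B (\<pi> a))"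

text \<open>\<open>mat_positive A n X\<close> says that \<open>X\<close>, of which only the entries with indices below \<open>n\<close> matter,
  is a positive element \<open>Y* Y\<close> of the C*-algebra of \<open>n \<times> n\<close> matrices over \<open>A\<close>.\<close>

definition mat_positive :: "('a, 'm) star_algebra_scheme \<Rightarrow> nat \<Rightarrow> (nat \<Rightarrow> nat \<Rightarrow> 'a) \<Rightarrow> bool"
  where "mat_positive A n X \<longleftrightarrow> (\<exists>Y. (\<forall>i<n. \<forall>j<n. Y i j \<in> carrier A) \<and>
    (\<forall>i<n. \<forall>j<n. X i j = (\<Oplus>\<^bsub>A\<^esub>k\<in>{..<n}. star A (Y k i) \<otimes>\<^bsub>A\<^esub> Y k j)))"

definition cp_map ::
    "('a, 'm) star_algebra_scheme \<Rightarrow> ('b, 'n) star_algebra_scheme \<Rightarrow> ('a \<Rightarrow> 'b) \<Rightarrow> bool"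
  where "cp_map A B \<phi> \<longleftrightarrow> \<phi> \<in> carrier A \<rightarrow>\<^sub>E carrier B \<and>
    (\<forall>x\<in>carrier A. \<forall>y\<in>carrier A. \<phi> (x \<oplus>\<^bsub>A\<^esub> y) = \<phi> x \<oplus>\<^bsub>B\<^esub> \<phi> y) \<and>
    (\<forall>c. \<forall>x\<in>carrier A. \<phi> (c \<odot>\<^bsub>A\<^esub> x) = c \<odot>\<^bsub>B\<^esub> \<phi> x) \<and>
    (\<forall>n X. mat_positive A n X \<longrightarrow> mat_positive B n (\<lambda>i j. \<phi> (X i j)))"


section \<open>OCP maps and anchored representations\<close>

type_synonym ('a, 'k) ocp = "'k inner_space \<times> ('a \<Rightarrow> 'k \<Rightarrow> 'k)"

type_synonym ('a, 'k, 'h) anchored =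
  "'k inner_space \<times> 'h inner_space \<times> ('a \<Rightarrow> 'h \<Rightarrow> 'h) \<times> ('k \<Rightarrow> 'h)"

fun ocp_map :: "('a, 'm) normed_star_algebra_scheme \<Rightarrow> ('a, 'k) ocp \<Rightarrow> bool"
  where "ocp_map A (K, \<phi>) \<longleftrightarrow> hilbert_space K \<and> cp_map A (op_algebra K) \<phi>"

fun operator_state :: "('a, 'm) normed_star_algebra_scheme \<Rightarrow> ('a, 'k) ocp \<Rightarrow> bool"
  where "operator_state A (K, \<phi>) \<longleftrightarrow>
    ocp_map A (K, \<phi>) \<and> \<phi> \<one>\<^bsub>A\<^esub> = \<one>\<^bsub>op_algebra K\<^esub>"

fun ocp_morphism ::
    "('a, 'm) normed_star_algebra_scheme \<Rightarrow> ('a, 'k) ocp \<Rightarrow> ('a, 'l) ocp \<Rightarrow> ('k \<Rightarrow> 'l) \<Rightarrow> bool"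
  where "ocp_morphism A (K, \<phi>) (L, \<psi>) T \<longleftrightarrow>
    ocp_map A (K, \<phi>) \<and> ocp_map A (L, \<psi>) \<and> T \<in> bounded_ops K L \<and>
    (\<forall>a\<in>carrier A. \<forall>v\<in>carrier K. T (\<phi> a v) = \<psi> a (T v))"

fun operator_state_morphism ::
    "('a, 'm) normed_star_algebra_scheme \<Rightarrow> ('a, 'k) ocp \<Rightarrow> ('a, 'l) ocp \<Rightarrow> ('k \<Rightarrow> 'l) \<Rightarrow> bool"
  where "operator_state_morphism A (K, \<phi>) (L, \<psi>) T \<longleftrightarrow>
    operator_state A (K, \<phi>) \<and> operator_state A (L, \<psi>) \<and>
    ocp_morphism A (K, \<phi>) (L, \<psi>) T \<and> is_isometry K L T"

fun anchored_rep :: "('a, 'm) normed_star_algebra_scheme \<Rightarrow> ('a, 'k, 'h) anchored \<Rightarrow> bool"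
  where "anchored_rep A (K, H, \<pi>, V) \<longleftrightarrow>
    hilbert_space K \<and> hilbert_space H \<and> star_hom A (op_algebra H) \<pi> \<and> V \<in> bounded_ops K H"

fun preserving_rep :: "('a, 'm) normed_star_algebra_scheme \<Rightarrow> ('a, 'k, 'h) anchored \<Rightarrow> bool"
  where "preserving_rep A (K, H, \<pi>, V) \<longleftrightarrow> anchored_rep A (K, H, \<pi>, V) \<and> is_isometry K H V"

fun anchored_morphism ::
    "('a, 'm) normed_star_algebra_scheme \<Rightarrow> ('a, 'k, 'h) anchored \<Rightarrow> ('a, 'l, 'i) anchored \<Rightarrow>
     ('k \<Rightarrow> 'l) \<times> ('h \<Rightarrow> 'i) \<Rightarrow> bool"
  where "anchored_morphism A (K, H, \<pi>, V) (L, I, \<rho>, W) (T, S) \<longleftrightarrow>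
    anchored_rep A (K, H, \<pi>, V) \<and> anchored_rep A (L, I, \<rho>, W) \<and>
    T \<in> bounded_ops K L \<and> S \<in> bounded_ops H I \<and>
    (\<forall>a\<in>carrier A. \<forall>x\<in>carrier H. S (\<pi> a x) = \<rho> a (S x)) \<and>
    (\<forall>v\<in>carrier K. S (V v) = W (T v)) \<and>
    (\<forall>x\<in>carrier H. T (adjoint_op K H V x) = adjoint_op L I W (S x))"

fun preserving_morphism ::
    "('a, 'm) normed_star_algebra_scheme \<Rightarrow> ('a, 'k, 'h) anchored \<Rightarrow> ('a, 'l, 'i) anchored \<Rightarrow>
     ('k \<Rightarrow> 'l) \<times> ('h \<Rightarrow> 'i) \<Rightarrow> bool"
  where "preserving_morphism A (K, H, \<pi>, V) (L, I, \<rho>, W) (T, S) \<longleftrightarrow>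
    preserving_rep A (K, H, \<pi>, V) \<and> preserving_rep A (L, I, \<rho>, W) \<and>
    anchored_morphism A (K, H, \<pi>, V) (L, I, \<rho>, W) (T, S) \<and>
    is_isometry K L T \<and> is_isometry H I S"

fun rest_obj :: "('a, 'm) normed_star_algebra_scheme \<Rightarrow> ('a, 'k, 'h) anchored \<Rightarrow> ('a, 'k) ocp"
  where "rest_obj A (K, H, \<pi>, V) =
    (K, \<lambda>a\<in>carrier A. \<lambda>v\<in>carrier K. adjoint_op K H V (\<pi> a (V v)))"

text \<open>The functor \<open>rest\<close> on arrows, an arrow being a triple of source, underlying map(s), target.\<close>

fun rest_arrow ::
    "('a, 'm) normed_star_algebra_scheme \<Rightarrow>
     ('a, 'k, 'h) anchored \<times> (('k \<Rightarrow> 'l) \<times> ('h \<Rightarrow> 'i)) \<times> ('a, 'l, 'i) anchored \<Rightarrow>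
     ('a, 'k) ocp \<times> ('k \<Rightarrow> 'l) \<times> ('a, 'l) ocp"
  where "rest_arrow A (X, (T, S), Y) = (rest_obj A X, T, rest_obj A Y)"

fun stinespring_rep ::
    "('a, 'm) normed_star_algebra_scheme \<Rightarrow> ('a, 'k) ocp \<Rightarrow> ('a, 'k, 'h) anchored \<Rightarrow> bool"
  where "stinespring_rep A (K, \<phi>) (K', H, \<pi>, V) \<longleftrightarrow>
    K' = K \<and> anchored_rep A (K, H, \<pi>, V) \<and>
    (\<forall>a\<in>carrier A. \<forall>v\<in>carrier K. \<phi> a v = adjoint_op K H V (\<pi> a (V v)))"


section \<open>Quotients, algebraic tensor products, completions\<close>

definition quot_space ::
    "(complex, 'x, 'm) module_scheme \<Rightarrow> 'x set \<Rightarrow> (complex, 'x set) module"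
  where "quot_space M N =
    \<lparr>carrier = a_rcosets\<^bsub>M\<^esub> N, monoid.mult = undefined, one = undefined,
     ring.zero = N, add = set_add M,
     smult = (\<lambda>c X. \<Union>x\<in>X. N +>\<^bsub>M\<^esub> (c \<odot>\<^bsub>M\<^esub> x))\<rparr>"

definition free_space :: "'x set \<Rightarrow> (complex, 'x \<Rightarrow>\<^sub>0 complex) module"
  where "free_space B =
    \<lparr>carrier = {f. Poly_Mapping.keys f \<subseteq> B}, monoid.mult = undefined, one = undefined,
     ring.zero = 0, add = (+), smult = (\<lambda>c. Poly_Mapping.map (\<lambda>z. c * z))\<rparr>"

definition bilinear_relations ::
    "(complex, 'x, 'm) module_scheme \<Rightarrow> (complex, 'y, 'n) module_scheme \<Rightarrow>
     ('x \<times> 'y \<Rightarrow>\<^sub>0 complex) set"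
  where "bilinear_relations M N =
    {Poly_Mapping.single (x \<oplus>\<^bsub>M\<^esub> x', y) 1 - Poly_Mapping.single (x, y) 1
        - Poly_Mapping.single (x', y) 1 | x x' y.
      x \<in> carrier M \<and> x' \<in> carrier M \<and> y \<in> carrier N} \<union>
    {Poly_Mapping.single (x, y \<oplus>\<^bsub>N\<^esub> y') 1 - Poly_Mapping.single (x, y) 1
        - Poly_Mapping.single (x, y') 1 | x y y'.
      x \<in> carrier M \<and> y \<in> carrier N \<and> y' \<in> carrier N} \<union>
    {Poly_Mapping.single (c \<odot>\<^bsub>M\<^esub> x, y) 1 - Poly_Mapping.single (x, y) c | c x y.
      x \<in> carrier M \<and> y \<in> carrier N} \<union>
    {Poly_Mapping.single (x, c \<odot>\<^bsub>N\<^esub> y) 1 - Poly_Mapping.single (x, y) c | c x y.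
      x \<in> carrier M \<and> y \<in> carrier N}"

definition tensor_null ::
    "(complex, 'x, 'm) module_scheme \<Rightarrow> (complex, 'y, 'n) module_scheme \<Rightarrow>
     ('x \<times> 'y \<Rightarrow>\<^sub>0 complex) set"
  where "tensor_null M N =
    \<Inter>{U. submodule U complex_ring (free_space (carrier M \<times> carrier N)) \<and>
         bilinear_relations M N \<subseteq> U}"

definition tensor ::
    "(complex, 'x, 'm) module_scheme \<Rightarrow> (complex, 'y, 'n) module_scheme \<Rightarrow>
     (complex, ('x \<times> 'y \<Rightarrow>\<^sub>0 complex) set) module"
  where "tensor M N = quot_space (free_space (carrier M \<times> carrier N)) (tensor_null M N)"

definition pure_tensor ::
    "(complex, 'x, 'm) module_scheme \<Rightarrow> (complex, 'y, 'n) module_scheme \<Rightarrow>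
     'x \<Rightarrow> 'y \<Rightarrow> ('x \<times> 'y \<Rightarrow>\<^sub>0 complex) set"
  where "pure_tensor M N x y =
    tensor_null M N +>\<^bsub>free_space (carrier M \<times> carrier N)\<^esub> Poly_Mapping.single (x, y) 1"

definition null_vectors :: "'x inner_space \<Rightarrow> 'x set"
  where "null_vectors S = {x \<in> carrier S. inprod S x x = 0}"

definition separation :: "'x inner_space \<Rightarrow> 'x set inner_space"
  where "separation S = module.extend (quot_space S (null_vectors S))
    (inner_space.fields (\<lambda>X Y. THE c. \<forall>x\<in>X. \<forall>y\<in>Y. inprod S x y = c))"

definition cauchy_seqs :: "'x inner_space \<Rightarrow> (nat \<Rightarrow> 'x) set"
  where "cauchy_seqs S = {s. Metric_space.MCauchy (carrier S) (hdist S) s}"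

definition cauchy_class :: "'x inner_space \<Rightarrow> (nat \<Rightarrow> 'x) \<Rightarrow> (nat \<Rightarrow> 'x) set"
  where "cauchy_class S s =
    {t \<in> cauchy_seqs S. (\<lambda>n. hdist S (s n) (t n)) \<longlonglongrightarrow> 0}"

definition completion :: "'x inner_space \<Rightarrow> (nat \<Rightarrow> 'x) set inner_space"
  where "completion S =
    \<lparr>carrier = cauchy_class S ` cauchy_seqs S, monoid.mult = undefined, one = undefined,
     ring.zero = cauchy_class S (\<lambda>n. \<zero>\<^bsub>S\<^esub>),
     add = (\<lambda>X Y. \<Union>s\<in>X. \<Union>t\<in>Y. cauchy_class S (\<lambda>n. s n \<oplus>\<^bsub>S\<^esub> t n)),
     smult = (\<lambda>c X. \<Union>s\<in>X. cauchy_class S (\<lambda>n. c \<odot>\<^bsub>S\<^esub> s n)),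
     inprod = (\<lambda>X Y. THE c. \<forall>s\<in>X. \<forall>t\<in>Y. (\<lambda>n. inprod S (s n) (t n)) \<longlonglongrightarrow> c)\<rparr>"


section \<open>Stinespring's construction\<close>

definition tensor_sum ::
    "('a, 'm) normed_star_algebra_scheme \<Rightarrow> 'k inner_space \<Rightarrow> nat \<Rightarrow> (nat \<Rightarrow> 'a) \<Rightarrow> (nat \<Rightarrow> 'k) \<Rightarrow>
     ('a \<times> 'k \<Rightarrow>\<^sub>0 complex) set"
  where "tensor_sum A K n a v = (\<Oplus>\<^bsub>tensor A K\<^esub>i\<in>{..<n}. pure_tensor A K (a i) (v i))"

text \<open>The form is given on arbitrary representations of its arguments as finite sums of pure tensors;
  every element of the tensor product has one, scalars being absorbed into a tensor factor.\<close>

definition stine_form ::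
    "('a, 'm) normed_star_algebra_scheme \<Rightarrow> ('a, 'k) ocp \<Rightarrow>
     ('a \<times> 'k \<Rightarrow>\<^sub>0 complex) set \<Rightarrow> ('a \<times> 'k \<Rightarrow>\<^sub>0 complex) set \<Rightarrow> complex"
  where "stine_form A = (\<lambda>(K, \<phi>) \<zeta> \<eta>. THE c. \<forall>n m a v b w.
     a \<in> {..<n} \<rightarrow> carrier A \<longrightarrow> v \<in> {..<n} \<rightarrow> carrier K \<longrightarrow>
     b \<in> {..<m} \<rightarrow> carrier A \<longrightarrow> w \<in> {..<m} \<rightarrow> carrier K \<longrightarrow>
     \<zeta> = tensor_sum A K n a v \<longrightarrow> \<eta> = tensor_sum A K m b w \<longrightarrow>
     (\<Sum>i<n. \<Sum>j<m. inprod K (v i) (\<phi> (star A (a i) \<otimes>\<^bsub>A\<^esub> b j) (w j))) = c)"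

definition stine_pre ::
    "('a, 'm) normed_star_algebra_scheme \<Rightarrow> ('a, 'k) ocp \<Rightarrow> ('a \<times> 'k \<Rightarrow>\<^sub>0 complex) set inner_space"
  where "stine_pre A X =
    module.extend (tensor A (fst X)) (inner_space.fields (stine_form A X))"

type_synonym ('a, 'k) stine_vec = "(nat \<Rightarrow> ('a \<times> 'k \<Rightarrow>\<^sub>0 complex) set set) set"

definition stine_space ::
    "('a, 'm) normed_star_algebra_scheme \<Rightarrow> ('a, 'k) ocp \<Rightarrow> ('a, 'k) stine_vec inner_space"
  where "stine_space A X = completion (separation (stine_pre A X))"

text \<open>The class \<open>[\<zeta>]\<close> of a tensor, as an element of the completion.\<close>

definition stine_class ::
    "('a, 'm) normed_star_algebra_scheme \<Rightarrow> ('a, 'k) ocp \<Rightarrow>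
     ('a \<times> 'k \<Rightarrow>\<^sub>0 complex) set \<Rightarrow> ('a, 'k) stine_vec"
  where "stine_class A X \<zeta> = cauchy_class (separation (stine_pre A X))
    (\<lambda>n. null_vectors (stine_pre A X) +>\<^bsub>stine_pre A X\<^esub> \<zeta>)"

definition stine_rep ::
    "('a, 'm) normed_star_algebra_scheme \<Rightarrow> ('a, 'k) ocp \<Rightarrow>
     'a \<Rightarrow> ('a, 'k) stine_vec \<Rightarrow> ('a, 'k) stine_vec"
  where "stine_rep A X = (\<lambda>a\<in>carrier A. THE P.
    P \<in> bounded_ops (stine_space A X) (stine_space A X) \<and>
    (\<forall>n b v. b \<in> {..<n} \<rightarrow> carrier A \<longrightarrow> v \<in> {..<n} \<rightarrow> carrier (fst X) \<longrightarrow>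
      P (stine_class A X (tensor_sum A (fst X) n b v)) =
      stine_class A X (tensor_sum A (fst X) n (\<lambda>i. a \<otimes>\<^bsub>A\<^esub> b i) v)))"

definition stine_map ::
    "('a, 'm) normed_star_algebra_scheme \<Rightarrow> ('a, 'k) ocp \<Rightarrow> 'k \<Rightarrow> ('a, 'k) stine_vec"
  where "stine_map A X =
    (\<lambda>w\<in>carrier (fst X). stine_class A X (pure_tensor A (fst X) \<one>\<^bsub>A\<^esub> w))"

definition Stine ::
    "('a, 'm) normed_star_algebra_scheme \<Rightarrow> ('a, 'k) ocp \<Rightarrow>
     ('a, 'k, ('a, 'k) stine_vec) anchored"
  where "Stine A X = (fst X, stine_space A X, stine_rep A X, stine_map A X)"

end

(*
  A morphism (T, S) with S V = W T and S pi(a) = rho(a) S must send the class of sum a_i (x) v_i to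
  sum rho(a_i) W T v_i, and these classes are dense, so S is unique.  For existence one has to bound
    |sum rho(a_i) W T v_i|^2 = sum <T v_i, psi(a_i* a_j) T v_j> = sum <v_i, phi(a_i* a_j) P v_j>
  with P = T* T, which commutes with every phi(a) because T intertwines phi and psi.  On the
  pre-Hilbert space 1 (x) P is symmetric, and iterating the Cauchy-Schwarz inequality along its powers
  bounds it by the norm of P.  If T is isometric, the same computation shows that S is isometric.
  That pi(a) is bounded rests on 1 - a* a = c* c for |a| < 1.
*)
theory Submission
  imports Defs
begin

text \<open>A class in the Stinespring space has many representations, so every map out of it is
  prescribed on representing families (n, a, v). A norm bound turns it into a map of classes,
  because families with the same class are then forced to have the same image. Hence both pi(a) and
  the lift S need an inequality before they can be defined at all. For S it reads 1 (x) P \<le> b.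
  The commutation of P with phi rests on phi and psi preserving adjoints, which is complete
  positivity for a pair of algebra elements. The bound on the k-th power of 1 (x) P carries a
  constant that depends on the chosen vector; it disappears as k runs through the powers of two. The
  remaining relation T V* = W* S is checked on the same families: V* sends the class of sum a_i (x)
  v_i to sum phi(a_i) v_i, and W* rho(a_i) W T v_i = psi(a_i) T v_i = T phi(a_i) v_i.\<close>

section \<open>Semi-inner product spaces\<close>

lemma complex_ring_simps [simp]:
  "carrier complex_ring = UNIV" "x \<otimes>\<^bsub>complex_ring\<^esub> y = x * y" "\<one>\<^bsub>complex_ring\<^esub> = 1"
  "\<zero>\<^bsub>complex_ring\<^esub> = 0" "x \<oplus>\<^bsub>complex_ring\<^esub> y = x + y"
  by (simp_all add: complex_ring_def)

lemma cring_complex_ring: "cring complex_ring"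
proof (rule cringI)
  show "abelian_group complex_ring"
    by (rule abelian_groupI) (auto intro: exI[of _ "- x" for x] ab_left_minus)
  show "Group.comm_monoid complex_ring"
    by (rule comm_monoidI) auto
qed (auto simp: algebra_simps)

lemma complex_ring_a_inv [simp]: "\<ominus>\<^bsub>complex_ring\<^esub> x = - x"
proof -
  interpret cring complex_ring by (rule cring_complex_ring)
  show ?thesis by (rule minus_equality) auto
qed

text \<open>Surjectivity onto the carrier of Q lifts every law to representatives in M, and
  compatibility of q pushes it back down. Quotients, separations and completions all obtain their
  vector space laws in this way; with q the identity it also serves for a record extension.\<close>

lemma module_image:
  fixes M :: "('r, 'x, 'm) module_scheme" and Q :: "('r, 'y, 'n) module_scheme"
  assumes M: "Module.module R M"
    and carrier: "carrier Q = q ` carrier M"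
    and zero: "\<zero>\<^bsub>Q\<^esub> = q \<zero>\<^bsub>M\<^esub>"
    and add: "\<And>x y. \<lbrakk>x \<in> carrier M; y \<in> carrier M\<rbrakk> \<Longrightarrow> q x \<oplus>\<^bsub>Q\<^esub> q y = q (x \<oplus>\<^bsub>M\<^esub> y)"
    and smult: "\<And>c x. \<lbrakk>c \<in> carrier R; x \<in> carrier M\<rbrakk> \<Longrightarrow> c \<odot>\<^bsub>Q\<^esub> q x = q (c \<odot>\<^bsub>M\<^esub> x)"
  shows "Module.module R Q"
proof -
  interpret Module.module R M by fact
  show ?thesis
  proof (rule moduleI)
    show "cring R" by (rule R.is_cring)
    show "abelian_group Q"
    proof (rule abelian_groupI)
      fix x assume "x \<in> carrier Q"
      then obtain y where y: "y \<in> carrier M" "x = q y" by (auto simp: carrier)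
      have "q (\<ominus>\<^bsub>M\<^esub> y) \<oplus>\<^bsub>Q\<^esub> x = \<zero>\<^bsub>Q\<^esub>"
        using y by (simp add: add zero M.l_neg)
      then show "\<exists>y\<in>carrier Q. y \<oplus>\<^bsub>Q\<^esub> x = \<zero>\<^bsub>Q\<^esub>"
        using y by (auto simp: carrier)
    next
      fix x y z assume "x \<in> carrier Q" "y \<in> carrier Q" "z \<in> carrier Q"
      then show "x \<oplus>\<^bsub>Q\<^esub> y \<oplus>\<^bsub>Q\<^esub> z = x \<oplus>\<^bsub>Q\<^esub> (y \<oplus>\<^bsub>Q\<^esub> z)"
        by (auto simp: carrier add M.a_assoc)
    next
      fix x y assume "x \<in> carrier Q" "y \<in> carrier Q"
      then obtain u v where "u \<in> carrier M" "v \<in> carrier M" "x = q u" "y = q v"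
        by (auto simp: carrier)
      then show "x \<oplus>\<^bsub>Q\<^esub> y = y \<oplus>\<^bsub>Q\<^esub> x"
        using M.a_comm[of u v] by (simp add: add)
    qed (auto simp: carrier add zero)
  qed (auto simp: carrier add smult smult_l_distr smult_r_distr smult_assoc1)
qed

lemma (in abelian_group) finsum_image:
  assumes "abelian_group Q"
    and closed: "\<And>x. x \<in> carrier G \<Longrightarrow> q x \<in> carrier Q"
    and zero: "q \<zero> = \<zero>\<^bsub>Q\<^esub>"
    and add: "\<And>x y. \<lbrakk>x \<in> carrier G; y \<in> carrier G\<rbrakk> \<Longrightarrow> q (x \<oplus> y) = q x \<oplus>\<^bsub>Q\<^esub> q y"
    and "finite F" "f \<in> F \<rightarrow> carrier G"
  shows "q (\<Oplus>i\<in>F. f i) = (\<Oplus>\<^bsub>Q\<^esub>i\<in>F. q (f i))"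
proof -
  interpret Q: abelian_group Q by fact
  show ?thesis using \<open>finite F\<close> \<open>f \<in> F \<rightarrow> carrier G\<close>
  proof (induction F rule: finite_induct)
    case (insert x F)
    then show ?case
      by (subst finsum_insert) (auto simp: Pi_iff add closed Q.finsum_insert)
  qed (simp add: zero)
qed

text \<open>Two forms of the construction are at first only semidefinite: the one on the tensor
  product and the limit form on Cauchy sequences. Cauchy-Schwarz is wanted for both before the null
  vectors are divided out.\<close>

locale semi_inner_space = Module.module complex_ring H
  for H :: "('h, 'm) inner_space_scheme" (structure) +
  assumes inprod_add_right: "\<lbrakk>x \<in> carrier H; y \<in> carrier H; z \<in> carrier H\<rbrakk> \<Longrightarrow>
      inprod H x (y \<oplus> z) = inprod H x y + inprod H x z"
    and inprod_smult_right: "\<lbrakk>x \<in> carrier H; y \<in> carrier H\<rbrakk> \<Longrightarrow>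
      inprod H x (c \<odot>\<^bsub>H\<^esub> y) = c * inprod H x y"
    and inprod_cnj: "\<lbrakk>x \<in> carrier H; y \<in> carrier H\<rbrakk> \<Longrightarrow>
      inprod H y x = cnj (inprod H x y)"
    and inprod_nonneg: "x \<in> carrier H \<Longrightarrow> 0 \<le> Re (inprod H x x)"
begin

lemma smult_complex_closed [simp, intro]: "x \<in> carrier H \<Longrightarrow> c \<odot>\<^bsub>H\<^esub> x \<in> carrier H"
  by simp

lemma smult_complex_one [simp]: "x \<in> carrier H \<Longrightarrow> 1 \<odot>\<^bsub>H\<^esub> x = x"
  using smult_one by simp

lemma uminus_eq_smult: "x \<in> carrier H \<Longrightarrow> \<ominus> x = (- 1) \<odot>\<^bsub>H\<^esub> x"
  using smult_l_minus[of 1 x] by simp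

lemma inprod_add_left: "\<lbrakk>x \<in> carrier H; y \<in> carrier H; z \<in> carrier H\<rbrakk> \<Longrightarrow>
    inprod H (x \<oplus> y) z = inprod H x z + inprod H y z"
  by (subst (1 2 3) inprod_cnj) (auto simp: inprod_add_right)

lemma inprod_smult_left: "\<lbrakk>x \<in> carrier H; y \<in> carrier H\<rbrakk> \<Longrightarrow>
    inprod H (c \<odot>\<^bsub>H\<^esub> x) y = cnj c * inprod H x y"
  by (subst (1 2) inprod_cnj) (auto simp: inprod_smult_right)

lemma inprod_zero_right [simp]: "x \<in> carrier H \<Longrightarrow> inprod H x \<zero> = 0"
  using inprod_add_right[of x \<zero> \<zero>] by simp

lemma inprod_zero_left [simp]: "x \<in> carrier H \<Longrightarrow> inprod H \<zero> x = 0"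
  using inprod_add_left[of \<zero> \<zero> x] by simp

lemma inprod_uminus_right: "\<lbrakk>x \<in> carrier H; y \<in> carrier H\<rbrakk> \<Longrightarrow> inprod H x (\<ominus> y) = - inprod H x y"
  by (simp add: uminus_eq_smult inprod_smult_right)

lemma inprod_uminus_left: "\<lbrakk>x \<in> carrier H; y \<in> carrier H\<rbrakk> \<Longrightarrow> inprod H (\<ominus> x) y = - inprod H x y"
  by (simp add: uminus_eq_smult inprod_smult_left)

lemma inprod_diff_right: "\<lbrakk>x \<in> carrier H; y \<in> carrier H; z \<in> carrier H\<rbrakk> \<Longrightarrow>
    inprod H x (y \<ominus> z) = inprod H x y - inprod H x z"
  by (simp add: a_minus_def inprod_add_right inprod_uminus_right)

lemma inprod_diff_left: "\<lbrakk>x \<in> carrier H; y \<in> carrier H; z \<in> carrier H\<rbrakk> \<Longrightarrow>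
    inprod H (x \<ominus> y) z = inprod H x z - inprod H y z"
  by (simp add: a_minus_def inprod_add_left inprod_uminus_left)

lemmas inprod_simps = inprod_add_left inprod_add_right inprod_smult_left inprod_smult_right
  inprod_diff_left inprod_diff_right inprod_uminus_left inprod_uminus_right

lemma inprod_finsum_right:
  "\<lbrakk>finite F; x \<in> carrier H; f \<in> F \<rightarrow> carrier H\<rbrakk> \<Longrightarrow> inprod H x (\<Oplus>i\<in>F. f i) = (\<Sum>i\<in>F. inprod H x (f i))"
proof (induction F rule: finite_induct)
  case (insert i F)
  then show ?case by (subst finsum_insert) (auto simp: Pi_iff inprod_add_right)
qed simp

lemma inprod_finsum_left:
  "\<lbrakk>finite F; x \<in> carrier H; f \<in> F \<rightarrow> carrier H\<rbrakk> \<Longrightarrow> inprod H (\<Oplus>i\<in>F. f i) x = (\<Sum>i\<in>F. inprod H (f i) x)"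
proof (induction F rule: finite_induct)
  case (insert i F)
  then show ?case by (subst finsum_insert) (auto simp: Pi_iff inprod_add_left)
qed simp

lemma hnorm_nonneg [simp]: "x \<in> carrier H \<Longrightarrow> 0 \<le> hnorm H x"
  by (simp add: hnorm_def inprod_nonneg)

lemma hnorm_power2: "x \<in> carrier H \<Longrightarrow> (hnorm H x)\<^sup>2 = Re (inprod H x x)"
  by (simp add: hnorm_def inprod_nonneg)

lemma inprod_self: "x \<in> carrier H \<Longrightarrow> inprod H x x = of_real ((hnorm H x)\<^sup>2)"
  using inprod_cnj[of x x] by (simp add: hnorm_power2 complex_eq_iff)

lemma hnorm_eq_0: "x \<in> carrier H \<Longrightarrow> hnorm H x = 0 \<longleftrightarrow> inprod H x x = 0"
  by (simp add: inprod_self)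

lemma hnorm_zero [simp]: "hnorm H \<zero> = 0"
  by (simp add: hnorm_def)

lemma hnorm_smult: "x \<in> carrier H \<Longrightarrow> hnorm H (c \<odot>\<^bsub>H\<^esub> x) = cmod c * hnorm H x"
proof -
  assume x: "x \<in> carrier H"
  have "(hnorm H (c \<odot>\<^bsub>H\<^esub> x))\<^sup>2 = (cmod c * hnorm H x)\<^sup>2"
  proof -
    have "inprod H (c \<odot>\<^bsub>H\<^esub> x) (c \<odot>\<^bsub>H\<^esub> x) = (c * cnj c) * inprod H x x"
      using x by (simp add: inprod_simps)
    also have "\<dots> = of_real ((cmod c)\<^sup>2 * (hnorm H x)\<^sup>2)"
      using x by (simp add: inprod_self flip: complex_norm_square)
    finally show ?thesis
      using x by (simp only: hnorm_power2 smult_complex_closed Re_complex_of_real power_mult_distrib)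
  qed
  then show ?thesis using x by (metis hnorm_nonneg smult_complex_closed power2_eq_iff_nonneg mult_nonneg_nonneg norm_ge_zero)
qed

lemma hnorm_uminus [simp]: "x \<in> carrier H \<Longrightarrow> hnorm H (\<ominus> x) = hnorm H x"
  by (simp add: uminus_eq_smult hnorm_smult)

lemma hnorm_add_power2: "\<lbrakk>x \<in> carrier H; y \<in> carrier H\<rbrakk> \<Longrightarrow>
    (hnorm H (x \<oplus> y))\<^sup>2 = (hnorm H x)\<^sup>2 + 2 * Re (inprod H x y) + (hnorm H y)\<^sup>2"
  by (simp add: hnorm_power2 inprod_simps) (subst inprod_cnj[of x y], auto)

lemma Cauchy_Schwarz:
  assumes x: "x \<in> carrier H" and y: "y \<in> carrier H"
  shows "cmod (inprod H x y) \<le> hnorm H x * hnorm H y"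
proof -
  define c p q where "c = inprod H x y" and "p = (hnorm H x)\<^sup>2" and "q = (hnorm H y)\<^sup>2"
  have *: "0 \<le> p - 2 * s * (cmod c)\<^sup>2 + s\<^sup>2 * (cmod c)\<^sup>2 * q" for s :: real
  proof -
    \<comment> \<open>With this scalar \<open>?t * c\<close> is real, so only a real quadratic in s
      remains.\<close>
    let ?t = "- of_real s * cnj c"
    have "0 \<le> (hnorm H (x \<oplus> ?t \<odot>\<^bsub>H\<^esub> y))\<^sup>2" by simp
    also have "\<dots> = p + 2 * Re (?t * c) + (cmod ?t)\<^sup>2 * q"
      using x y by (simp add: hnorm_add_power2 p_def q_def c_def inprod_smult_right hnorm_smult power_mult_distrib)
    also have "?t * c = of_real (- s * (cmod c)\<^sup>2)"
      by (simp only: of_real_mult of_real_minus complex_norm_square) (simp add: mult_ac)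
    also have "(cmod ?t)\<^sup>2 = s\<^sup>2 * (cmod c)\<^sup>2"
      by (simp add: norm_mult power_mult_distrib)
    finally show ?thesis by simp
  qed
  have "(cmod c)\<^sup>2 \<le> p * q"
  proof (cases "q = 0")
    case True
    have "cmod c = 0"
    proof (rule ccontr)
      assume "cmod c \<noteq> 0"
      \<comment> \<open>For q = 0 the expression is affine in s with slope -2 (cmod c)^2, and the
        chosen s gives it the value -p - 2.\<close>
      then show False
        using *[of "(p + 1) / (cmod c)\<^sup>2"] True zero_le_power2[of "hnorm H x"]
        by (simp add: p_def)
    qed
    then show ?thesis using True by simp
  next
    case False
    then have "q > 0" by (simp add: q_def)
    \<comment> \<open>The quadratic in s has its minimum at s = 1 / q.\<close>
    moreover have "0 \<le> p - (cmod c)\<^sup>2 / q"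
      using *[of "1 / q"] \<open>q > 0\<close> by (simp add: power2_eq_square)
    ultimately show ?thesis by (simp add: field_simps)
  qed
  then have "(cmod (inprod H x y))\<^sup>2 \<le> (hnorm H x * hnorm H y)\<^sup>2"
    by (simp add: c_def p_def q_def power_mult_distrib)
  then show ?thesis
    by (rule power2_le_imp_le) (simp add: x y)
qed

lemma hnorm_triangle:
  assumes x: "x \<in> carrier H" and y: "y \<in> carrier H"
  shows "hnorm H (x \<oplus> y) \<le> hnorm H x + hnorm H y"
proof (rule power2_le_imp_le)
  have "Re (inprod H x y) \<le> hnorm H x * hnorm H y"
    using Cauchy_Schwarz[OF x y] complex_Re_le_cmod order_trans by blast
  then show "(hnorm H (x \<oplus> y))\<^sup>2 \<le> (hnorm H x + hnorm H y)\<^sup>2"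
    using x y by (simp add: hnorm_add_power2 power2_sum)
qed (use x y in auto)

lemma hnorm_diff_triangle:
  "\<lbrakk>x \<in> carrier H; y \<in> carrier H; z \<in> carrier H\<rbrakk> \<Longrightarrow> hnorm H (x \<ominus> z) \<le> hnorm H (x \<ominus> y) + hnorm H (y \<ominus> z)"
proof -
  assume c: "x \<in> carrier H" "y \<in> carrier H" "z \<in> carrier H"
  have "x \<ominus> z = (x \<ominus> y) \<oplus> (y \<ominus> z)"
    using c by (simp add: a_minus_def a_assoc r_neg1 M.minus_closed M.r_neg2 l_neg M.a_ac r_neg)
  then show ?thesis using c hnorm_triangle[of "x \<ominus> y" "y \<ominus> z"] by simp
qed

lemma hnorm_diff_sym: "\<lbrakk>x \<in> carrier H; y \<in> carrier H\<rbrakk> \<Longrightarrow> hnorm H (x \<ominus> y) = hnorm H (y \<ominus> x)"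
proof -
  assume c: "x \<in> carrier H" "y \<in> carrier H"
  have "x \<ominus> y = \<ominus> (y \<ominus> x)"
    using c by (simp add: a_minus_def M.minus_add a_comm)
  then show ?thesis using c by simp
qed

lemma hnorm_triangle3: "\<lbrakk>x \<in> carrier H; y \<in> carrier H\<rbrakk> \<Longrightarrow> hnorm H x \<le> hnorm H y + hnorm H (x \<ominus> y)"
  using hnorm_triangle[of y "x \<ominus> y"] by (simp add: a_minus_def M.a_ac M.r_neg)

end

sublocale inner_product_space \<subseteq> semi_inner_space
  by unfold_locales (auto intro: inprod_add_right inprod_smult_right inprod_cnj inprod_nonneg)

context inner_product_space begin

lemma hnorm_eq_0_iff: "x \<in> carrier H \<Longrightarrow> hnorm H x = 0 \<longleftrightarrow> x = \<zero>"
  using inprod_definite by (auto simp: hnorm_eq_0)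

lemma diff_eq_zero_iff: "x \<in> carrier H \<Longrightarrow> y \<in> carrier H \<Longrightarrow> x \<ominus> y = \<zero> \<longleftrightarrow> x = y"
  using M.minus_equality[of x "\<ominus> y"] by (auto simp: a_minus_def M.r_neg)

lemma inprod_eqI:
  assumes "x \<in> carrier H" "y \<in> carrier H" "\<And>z. z \<in> carrier H \<Longrightarrow> inprod H z x = inprod H z y"
  shows "x = y"
proof -
  have "inprod H (x \<ominus> y) (x \<ominus> y) = 0"
    using assms by (simp add: inprod_diff_right)
  then show ?thesis
    using assms inprod_definite[of "x \<ominus> y"] diff_eq_zero_iff by auto
qed

lemma hdist_eq: "x \<in> carrier H \<Longrightarrow> y \<in> carrier H \<Longrightarrow> hdist H x y = hnorm H (x \<ominus> y)"
  by (simp add: hdist_def)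

lemma Metric_space: "Metric_space (carrier H) (hdist H)"
proof
  fix x y z
  assume c: "x \<in> carrier H" "y \<in> carrier H"
  show "(hdist H x y = 0) = (x = y)"
    using c by (simp add: hdist_eq hnorm_eq_0_iff diff_eq_zero_iff)
  assume "z \<in> carrier H"
  then show "hdist H x z \<le> hdist H x y + hdist H y z"
    using c by (simp add: hdist_eq hnorm_diff_triangle)
qed (auto simp: hdist_def hnorm_diff_sym)

definition Cauchy_seq :: "(nat \<Rightarrow> 'h) \<Rightarrow> bool"
  where "Cauchy_seq s \<longleftrightarrow> range s \<subseteq> carrier H \<and>
    (\<forall>e>0. \<exists>N. \<forall>m\<ge>N. \<forall>n\<ge>N. hnorm H (s m \<ominus> s n) < e)"

lemma MCauchy_iff: "Metric_space.MCauchy (carrier H) (hdist H) s \<longleftrightarrow> Cauchy_seq s"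
proof -
  have "hdist H (s m) (s n) = hnorm H (s m \<ominus> s n)" if "range s \<subseteq> carrier H" for m n
    using that by (intro hdist_eq) auto
  then show ?thesis
    unfolding Metric_space.MCauchy_def[OF Metric_space] Cauchy_seq_def by fastforce
qed

lemma mcomplete_iff: "Metric_space.mcomplete (carrier H) (hdist H) \<longleftrightarrow>
    (\<forall>s. Cauchy_seq s \<longrightarrow> (\<exists>x\<in>carrier H. (\<lambda>n. hnorm H (s n \<ominus> x)) \<longlonglongrightarrow> 0))"
proof -
  have "limitin (Metric_space.mtopology (carrier H) (hdist H)) s x sequentially \<longleftrightarrow>
      x \<in> carrier H \<and> (\<lambda>n. hnorm H (s n \<ominus> x)) \<longlonglongrightarrow> 0" if "Cauchy_seq s" for s x
  proof -
    have s: "s n \<in> carrier H" for n using that by (auto simp: Cauchy_seq_def)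
    show ?thesis
      unfolding Metric_space.limitin_metric_dist_null[OF Metric_space]
      by (auto simp: s hdist_eq)
  qed
  then show ?thesis
    unfolding Metric_space.mcomplete_def[OF Metric_space] MCauchy_iff by blast
qed

end

text \<open>The condition \<open>null\<close> supplies definiteness: all vectors of length zero fall
  into the class of zero. It is applied to cosets of null vectors and to classes of Cauchy
  sequences.\<close>

lemma inner_product_space_image:
  fixes S :: "('x, 'm) inner_space_scheme" and Q :: "('y, 'n) inner_space_scheme"
  assumes S: "semi_inner_space S"
    and Q: "Module.module complex_ring Q"
    and carrier: "carrier Q = q ` carrier S"
    and zero: "\<zero>\<^bsub>Q\<^esub> = q \<zero>\<^bsub>S\<^esub>"
    and add: "\<And>x y. \<lbrakk>x \<in> carrier S; y \<in> carrier S\<rbrakk> \<Longrightarrow> q x \<oplus>\<^bsub>Q\<^esub> q y = q (x \<oplus>\<^bsub>S\<^esub> y)"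
    and smult: "\<And>c x. x \<in> carrier S \<Longrightarrow> c \<odot>\<^bsub>Q\<^esub> q x = q (c \<odot>\<^bsub>S\<^esub> x)"
    and inprod: "\<And>x y. \<lbrakk>x \<in> carrier S; y \<in> carrier S\<rbrakk> \<Longrightarrow> inprod Q (q x) (q y) = inprod S x y"
    and null: "\<And>x. \<lbrakk>x \<in> carrier S; inprod S x x = 0\<rbrakk> \<Longrightarrow> q x = q \<zero>\<^bsub>S\<^esub>"
  shows "inner_product_space Q"
proof -
  interpret S: semi_inner_space S by fact
  interpret Q: Module.module complex_ring Q by fact
  show ?thesis
  proof unfold_locales
    fix x y assume "x \<in> carrier Q" "y \<in> carrier Q"
    then obtain u v where "u \<in> carrier S" "v \<in> carrier S" "x = q u" "y = q v"
      by (auto simp: carrier)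
    then show "inprod Q y x = cnj (inprod Q x y)"
      using S.inprod_cnj[of u v] by (simp add: inprod)
  next
    fix x assume "x \<in> carrier Q" "inprod Q x x = 0"
    then obtain u where "u \<in> carrier S" "x = q u" "inprod S u u = 0"
      by (auto simp: carrier inprod)
    then show "x = \<zero>\<^bsub>Q\<^esub>"
      using null[of u] by (simp only: zero)
  qed (auto simp: carrier add smult inprod S.inprod_simps S.inprod_nonneg)
qed

section \<open>Quotients and separation\<close>

text \<open>Operations on classes are encoded as unions over all representatives. Such a union is
  the intended class once every representative yields the same set, so only independence of the
  choice has to be shown.\<close>

lemma UN_eq_constI: "x \<in> A \<Longrightarrow> (\<And>y. y \<in> A \<Longrightarrow> f y = c) \<Longrightarrow> (\<Union>y\<in>A. f y) = c"
  by auto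

locale module_quotient = Module.module complex_ring M + submodule N complex_ring M
  for M :: "(complex, 'x, 'm) module_scheme" and N
begin

lemma abelian_subgroup_N: "abelian_subgroup N M"
  by (rule abelian_subgroupI3) (unfold_locales)

lemma quot_carrier: "carrier (quot_space M N) = (\<lambda>x. N +>\<^bsub>M\<^esub> x) ` carrier M"
  by (auto simp: quot_space_def A_RCOSETS_def')

lemma quot_zero: "\<zero>\<^bsub>quot_space M N\<^esub> = N +>\<^bsub>M\<^esub> \<zero>\<^bsub>M\<^esub>"
  using abelian_subgroup.a_rcos_const[OF abelian_subgroup_N, of "\<zero>\<^bsub>M\<^esub>"] one_closed
  by (simp add: quot_space_def)

lemma quot_add: "x \<in> carrier M \<Longrightarrow> y \<in> carrier M \<Longrightarrow>
    (N +>\<^bsub>M\<^esub> x) \<oplus>\<^bsub>quot_space M N\<^esub> (N +>\<^bsub>M\<^esub> y) = N +>\<^bsub>M\<^esub> (x \<oplus>\<^bsub>M\<^esub> y)"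
  by (simp add: quot_space_def abelian_subgroup.a_rcos_sum[OF abelian_subgroup_N])

lemma quot_mem_iff: "x \<in> carrier M \<Longrightarrow> y \<in> N +>\<^bsub>M\<^esub> x \<longleftrightarrow> y \<in> carrier M \<and> y \<ominus>\<^bsub>M\<^esub> x \<in> N"
  using abelian_subgroup.a_rcos_module[OF abelian_subgroup_N, of x y]
    abelian_subgroup.a_elemrcos_carrier[OF abelian_subgroup_N, of x y]
  by (auto simp: a_minus_def)

lemma quot_eq_iff: "x \<in> carrier M \<Longrightarrow> y \<in> carrier M \<Longrightarrow>
    N +>\<^bsub>M\<^esub> y = N +>\<^bsub>M\<^esub> x \<longleftrightarrow> y \<ominus>\<^bsub>M\<^esub> x \<in> N"
  using abelian_subgroup.a_repr_independence'[OF abelian_subgroup_N, of y x]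
    abelian_subgroup.a_rcos_self[OF abelian_subgroup_N, of y] quot_mem_iff[of x y] by auto

lemma quot_mem_self: "x \<in> carrier M \<Longrightarrow> x \<in> N +>\<^bsub>M\<^esub> x"
  by (rule abelian_subgroup.a_rcos_self[OF abelian_subgroup_N])

lemma quot_smult:
  assumes x: "x \<in> carrier M"
  shows "c \<odot>\<^bsub>quot_space M N\<^esub> (N +>\<^bsub>M\<^esub> x) = N +>\<^bsub>M\<^esub> (c \<odot>\<^bsub>M\<^esub> x)"
proof -
  have "N +>\<^bsub>M\<^esub> (c \<odot>\<^bsub>M\<^esub> y) = N +>\<^bsub>M\<^esub> (c \<odot>\<^bsub>M\<^esub> x)" if "y \<in> N +>\<^bsub>M\<^esub> x" for y
  proof -
    have y: "y \<in> carrier M" "y \<ominus>\<^bsub>M\<^esub> x \<in> N"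
      using that quot_mem_iff[OF x] by auto
    have "c \<odot>\<^bsub>M\<^esub> y \<ominus>\<^bsub>M\<^esub> c \<odot>\<^bsub>M\<^esub> x = c \<odot>\<^bsub>M\<^esub> (y \<ominus>\<^bsub>M\<^esub> x)"
      using x y by (simp add: a_minus_def smult_r_distr smult_r_minus)
    also have "\<dots> \<in> N" using y(2) by simp
    finally show ?thesis
      using x y by (subst quot_eq_iff) auto
  qed
  then have "(\<Union>y\<in>N +>\<^bsub>M\<^esub> x. N +>\<^bsub>M\<^esub> (c \<odot>\<^bsub>M\<^esub> y)) = N +>\<^bsub>M\<^esub> (c \<odot>\<^bsub>M\<^esub> x)"
    by (rule UN_eq_constI[OF quot_mem_self[OF x]])
  then show ?thesis by (simp add: quot_space_def)
qed

lemma quot_module: "Module.module complex_ring (quot_space M N)"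
  by (rule module_image[where M = M and q = "\<lambda>x. N +>\<^bsub>M\<^esub> x", OF module_axioms])
    (simp_all add: quot_carrier quot_zero quot_add quot_smult)

end

context semi_inner_space begin

lemma inprod_null_right: "\<lbrakk>x \<in> carrier H; y \<in> carrier H; inprod H y y = 0\<rbrakk> \<Longrightarrow> inprod H x y = 0"
  using Cauchy_Schwarz[of x y] hnorm_eq_0[of y] by simp

lemma inprod_null_left: "\<lbrakk>x \<in> carrier H; y \<in> carrier H; inprod H x x = 0\<rbrakk> \<Longrightarrow> inprod H x y = 0"
  using Cauchy_Schwarz[of x y] hnorm_eq_0[of x] by simp

end

lemma separation_sel:
  "carrier (separation S) = carrier (quot_space S (null_vectors S))"
  "\<zero>\<^bsub>separation S\<^esub> = \<zero>\<^bsub>quot_space S (null_vectors S)\<^esub>"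
  "add (separation S) = add (quot_space S (null_vectors S))"
  "smult (separation S) = smult (quot_space S (null_vectors S))"
  "inprod (separation S) = (\<lambda>X Y. THE c. \<forall>x\<in>X. \<forall>y\<in>Y. inprod S x y = c)"
  by (simp_all add: separation_def module.defs inner_space.defs)

locale pre_hilbert = semi_inner_space S for S :: "'x inner_space"
begin

abbreviation sep_class :: "'x \<Rightarrow> 'x set"
  where "sep_class x \<equiv> null_vectors S +>\<^bsub>S\<^esub> x"

lemma null_iff: "x \<in> null_vectors S \<longleftrightarrow> x \<in> carrier S \<and> inprod S x x = 0"
  by (simp add: null_vectors_def)

text \<open>Closure under addition holds because Cauchy-Schwarz makes a null vector orthogonal to
  every vector, so the cross terms vanish.\<close>

lemma submodule_null: "submodule (null_vectors S) complex_ring S"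
  by (rule submoduleI)
    (auto simp: null_vectors_def inprod_simps inprod_null_left)

sublocale null: module_quotient S "null_vectors S"
  by (intro module_quotient.intro module_axioms submodule_null)

text \<open>Two representatives of a coset differ by a null vector, which is orthogonal to
  everything; hence the \<open>THE\<close> in \<open>separation\<close> denotes a value.\<close>

lemma inprod_sep_class:
  assumes x: "x \<in> carrier S" and y: "y \<in> carrier S"
  shows "inprod (separation S) (sep_class x) (sep_class y) = inprod S x y"
proof -
  have "inprod S x' y' = inprod S x y" if "x' \<in> sep_class x" "y' \<in> sep_class y" for x' y'
  proof -
    have c: "x' \<in> carrier S" "y' \<in> carrier S" "inprod S (x' \<ominus>\<^bsub>S\<^esub> x) (x' \<ominus>\<^bsub>S\<^esub> x) = 0"
      "inprod S (y' \<ominus>\<^bsub>S\<^esub> y) (y' \<ominus>\<^bsub>S\<^esub> y) = 0"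
      using that by (simp_all add: null.quot_mem_iff[OF x] null.quot_mem_iff[OF y] null_iff)
    have "inprod S (x' \<ominus>\<^bsub>S\<^esub> x) y' = 0" "inprod S x (y' \<ominus>\<^bsub>S\<^esub> y) = 0"
      using c x y inprod_null_left[of "x' \<ominus>\<^bsub>S\<^esub> x" y'] inprod_null_right[of x "y' \<ominus>\<^bsub>S\<^esub> y"] by auto
    then show ?thesis
      using c x y by (simp add: inprod_diff_left inprod_diff_right)
  qed
  then show ?thesis
    unfolding separation_sel using null.quot_mem_self[OF x] null.quot_mem_self[OF y]
    by (intro the_equality) (blast, metis)
qed

lemma sep_carrier: "carrier (separation S) = sep_class ` carrier S"
  by (simp add: separation_sel null.quot_carrier)

lemma sep_add: "x \<in> carrier S \<Longrightarrow> y \<in> carrier S \<Longrightarrow>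
    sep_class x \<oplus>\<^bsub>separation S\<^esub> sep_class y = sep_class (x \<oplus>\<^bsub>S\<^esub> y)"
  by (simp add: separation_sel null.quot_add)

lemma sep_smult: "x \<in> carrier S \<Longrightarrow> c \<odot>\<^bsub>separation S\<^esub> sep_class x = sep_class (c \<odot>\<^bsub>S\<^esub> x)"
  by (simp add: separation_sel null.quot_smult)

lemma sep_zero: "\<zero>\<^bsub>separation S\<^esub> = sep_class \<zero>\<^bsub>S\<^esub>"
  by (simp add: separation_sel null.quot_zero)

lemma inner_product_space_separation: "inner_product_space (separation S)"
proof (rule inner_product_space_image[where S = S and q = sep_class])
  show "semi_inner_space S" by unfold_locales
  show "Module.module complex_ring (separation S)"
    by (rule module_image[where M = S and q = sep_class, OF module_axioms])
      (simp_all add: sep_carrier sep_add sep_smult sep_zero)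
  show "sep_class x = sep_class \<zero>\<^bsub>S\<^esub>" if "x \<in> carrier S" "inprod S x x = 0" for x
    using that by (simp add: null.quot_eq_iff) (simp add: null_iff inprod_diff_left inprod_diff_right)
qed (simp_all add: sep_carrier sep_add sep_smult sep_zero inprod_sep_class)

end

section \<open>Completion\<close>

text \<open>On Cauchy sequences the limit of the inner products is a semidefinite form, and the completion is its
  quotient by the null sequences, so the vector space laws are inherited through the quotient map.\<close>

definition cauchy_space :: "'x inner_space \<Rightarrow> (nat \<Rightarrow> 'x) inner_space"
  where "cauchy_space S =
    \<lparr>carrier = cauchy_seqs S, monoid.mult = undefined, one = undefined,
     ring.zero = (\<lambda>n. \<zero>\<^bsub>S\<^esub>), add = (\<lambda>s t n. s n \<oplus>\<^bsub>S\<^esub> t n), smult = (\<lambda>c s n. c \<odot>\<^bsub>S\<^esub> s n),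
     inprod = (\<lambda>s t. lim (\<lambda>n. inprod S (s n) (t n)))\<rparr>"

lemma cauchy_space_sel [simp]:
  "carrier (cauchy_space S) = cauchy_seqs S"
  "\<zero>\<^bsub>cauchy_space S\<^esub> = (\<lambda>n. \<zero>\<^bsub>S\<^esub>)"
  "s \<oplus>\<^bsub>cauchy_space S\<^esub> t = (\<lambda>n. s n \<oplus>\<^bsub>S\<^esub> t n)"
  "c \<odot>\<^bsub>cauchy_space S\<^esub> s = (\<lambda>n. c \<odot>\<^bsub>S\<^esub> s n)"
  "inprod (cauchy_space S) s t = lim (\<lambda>n. inprod S (s n) (t n))"
  by (simp_all add: cauchy_space_def)

context semi_inner_space begin

lemma diff_add_diff: "\<lbrakk>a \<in> carrier H; b \<in> carrier H; c \<in> carrier H; d \<in> carrier H\<rbrakk> \<Longrightarrow>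
    (a \<oplus> b) \<ominus> (c \<oplus> d) = (a \<ominus> c) \<oplus> (b \<ominus> d)"
  by (simp add: a_minus_def M.minus_add M.a_ac)

lemma diff_zero: "x \<in> carrier H \<Longrightarrow> x \<ominus> \<zero> = x"
  by (simp add: a_minus_def uminus_eq_smult)

lemma smult_diff: "\<lbrakk>a \<in> carrier H; b \<in> carrier H\<rbrakk> \<Longrightarrow> c \<odot>\<^bsub>H\<^esub> (a \<ominus> b) = c \<odot>\<^bsub>H\<^esub> a \<ominus> c \<odot>\<^bsub>H\<^esub> b"
  by (simp add: a_minus_def smult_r_distr smult_r_minus)

end

locale inner_space_completion = inner_product_space S for S :: "'x inner_space"
begin

lemma cauchy_seqs_iff: "s \<in> cauchy_seqs S \<longleftrightarrow> Cauchy_seq s"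
  by (simp add: cauchy_seqs_def MCauchy_iff)

lemma Cauchy_seq_closed: "Cauchy_seq s \<Longrightarrow> s n \<in> carrier S"
  by (auto simp: Cauchy_seq_def)

lemma Cauchy_seqD: "Cauchy_seq s \<Longrightarrow> e > 0 \<Longrightarrow> \<exists>N. \<forall>m\<ge>N. \<forall>n\<ge>N. hnorm S (s m \<ominus>\<^bsub>S\<^esub> s n) < e"
  by (auto simp: Cauchy_seq_def)

lemma Cauchy_seq_const: "x \<in> carrier S \<Longrightarrow> Cauchy_seq (\<lambda>n. x)"
  by (auto simp: Cauchy_seq_def a_minus_def M.r_neg)

lemma Cauchy_seq_add:
  assumes s: "Cauchy_seq s" and t: "Cauchy_seq t"
  shows "Cauchy_seq (\<lambda>n. s n \<oplus>\<^bsub>S\<^esub> t n)"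
  unfolding Cauchy_seq_def
proof (intro conjI allI impI)
  note c = Cauchy_seq_closed[OF s] Cauchy_seq_closed[OF t]
  show "range (\<lambda>n. s n \<oplus>\<^bsub>S\<^esub> t n) \<subseteq> carrier S" using c by auto
  fix e :: real assume "e > 0"
  then obtain N M where N: "\<forall>m\<ge>N. \<forall>n\<ge>N. hnorm S (s m \<ominus>\<^bsub>S\<^esub> s n) < e / 2"
    and M: "\<forall>m\<ge>M. \<forall>n\<ge>M. hnorm S (t m \<ominus>\<^bsub>S\<^esub> t n) < e / 2"
    using Cauchy_seqD[OF s, of "e/2"] Cauchy_seqD[OF t, of "e/2"] by auto
  show "\<exists>N. \<forall>m\<ge>N. \<forall>n\<ge>N. hnorm S ((s m \<oplus>\<^bsub>S\<^esub> t m) \<ominus>\<^bsub>S\<^esub> (s n \<oplus>\<^bsub>S\<^esub> t n)) < e"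
  proof (intro exI[of _ "max N M"] allI impI)
    fix m n assume "max N M \<le> m" "max N M \<le> n"
    then have "hnorm S (s m \<ominus>\<^bsub>S\<^esub> s n) < e / 2" "hnorm S (t m \<ominus>\<^bsub>S\<^esub> t n) < e / 2"
      using N M by auto
    then show "hnorm S ((s m \<oplus>\<^bsub>S\<^esub> t m) \<ominus>\<^bsub>S\<^esub> (s n \<oplus>\<^bsub>S\<^esub> t n)) < e"
      using hnorm_triangle[of "s m \<ominus>\<^bsub>S\<^esub> s n" "t m \<ominus>\<^bsub>S\<^esub> t n"] c
      by (simp add: diff_add_diff)
  qed
qed

lemma Cauchy_seq_smult:
  assumes s: "Cauchy_seq s"
  shows "Cauchy_seq (\<lambda>n. c \<odot>\<^bsub>S\<^esub> s n)"
  unfolding Cauchy_seq_def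
proof (intro conjI allI impI)
  note c = Cauchy_seq_closed[OF s]
  show "range (\<lambda>n. c \<odot>\<^bsub>S\<^esub> s n) \<subseteq> carrier S" using c by auto
  fix e :: real assume "e > 0"
  \<comment> \<open>The added 1 keeps the divisor positive when c = 0.\<close>
  then obtain N where N: "\<forall>m\<ge>N. \<forall>n\<ge>N. hnorm S (s m \<ominus>\<^bsub>S\<^esub> s n) < e / (cmod c + 1)"
    using Cauchy_seqD[OF s, of "e / (cmod c + 1)"] by (auto simp: add_nonneg_pos)
  show "\<exists>N. \<forall>m\<ge>N. \<forall>n\<ge>N. hnorm S (c \<odot>\<^bsub>S\<^esub> s m \<ominus>\<^bsub>S\<^esub> c \<odot>\<^bsub>S\<^esub> s n) < e"
  proof (intro exI[of _ N] allI impI)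
    fix m n assume "N \<le> m" "N \<le> n"
    then have "hnorm S (s m \<ominus>\<^bsub>S\<^esub> s n) < e / (cmod c + 1)" using N by auto
    moreover have "cmod c + 1 > 0" by (simp add: add_nonneg_pos)
    ultimately have "(cmod c + 1) * hnorm S (s m \<ominus>\<^bsub>S\<^esub> s n) < e"
      by (simp only: pos_less_divide_eq mult.commute)
    moreover have "hnorm S (c \<odot>\<^bsub>S\<^esub> s m \<ominus>\<^bsub>S\<^esub> c \<odot>\<^bsub>S\<^esub> s n) = cmod c * hnorm S (s m \<ominus>\<^bsub>S\<^esub> s n)"
      using c by (simp add: hnorm_smult flip: smult_diff)
    moreover have "0 \<le> hnorm S (s m \<ominus>\<^bsub>S\<^esub> s n)" using c by simp
    ultimately show "hnorm S (c \<odot>\<^bsub>S\<^esub> s m \<ominus>\<^bsub>S\<^esub> c \<odot>\<^bsub>S\<^esub> s n) < e"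
      unfolding distrib_right by linarith
  qed
qed

lemma Cauchy_seq_bounded:
  assumes s: "Cauchy_seq s"
  obtains B where "B > 0" "\<And>n. hnorm S (s n) \<le> B"
proof -
  note c = Cauchy_seq_closed[OF s]
  obtain N where N: "\<forall>m\<ge>N. \<forall>n\<ge>N. hnorm S (s m \<ominus>\<^bsub>S\<^esub> s n) < 1"
    using Cauchy_seqD[OF s, of 1] by auto
  \<comment> \<open>Beyond N the Cauchy condition with tolerance 1 applies; the sum dominates each
    of the finitely many earlier norms, also when N = 0.\<close>
  let ?B = "hnorm S (s N) + 1 + (\<Sum>i<N. hnorm S (s i))"
  have pos: "0 \<le> (\<Sum>i<N. hnorm S (s i))" using c by (intro sum_nonneg) auto
  have "hnorm S (s n) \<le> ?B" for n
  proof (cases "n < N")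
    case True
    then have "hnorm S (s n) \<le> (\<Sum>i<N. hnorm S (s i))"
      using c by (intro member_le_sum) auto
    then show ?thesis using hnorm_nonneg[OF c, of N] by linarith
  next
    case False
    then have "hnorm S (s n \<ominus>\<^bsub>S\<^esub> s N) < 1" using N by auto
    then show ?thesis using hnorm_triangle3[OF c c, of n N] pos by linarith
  qed
  then show ?thesis using that[of ?B] c pos by (metis add_nonneg_pos add_pos_nonneg hnorm_nonneg zero_less_one)
qed

lemma inprod_diff_bound:
  assumes "a \<in> carrier S" "b \<in> carrier S" "c \<in> carrier S" "d \<in> carrier S"
  shows "cmod (inprod S a b - inprod S c d) \<le> hnorm S (a \<ominus>\<^bsub>S\<^esub> c) * hnorm S b + hnorm S c * hnorm S (b \<ominus>\<^bsub>S\<^esub> d)"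
proof -
  have "inprod S a b - inprod S c d = inprod S (a \<ominus>\<^bsub>S\<^esub> c) b + inprod S c (b \<ominus>\<^bsub>S\<^esub> d)"
    using assms by (simp add: inprod_simps)
  then show ?thesis
    using Cauchy_Schwarz[of "a \<ominus>\<^bsub>S\<^esub> c" b] Cauchy_Schwarz[of c "b \<ominus>\<^bsub>S\<^esub> d"] assms
    by (metis M.minus_closed add_mono norm_triangle_le)
qed

lemma inprod_convergent:
  assumes s: "Cauchy_seq s" and t: "Cauchy_seq t"
  shows "convergent (\<lambda>n. inprod S (s n) (t n))"
proof -
  note c = Cauchy_seq_closed[OF s] Cauchy_seq_closed[OF t]
  obtain B where B: "B > 0" "\<And>n. hnorm S (s n) \<le> B" by (rule Cauchy_seq_bounded[OF s]) blast
  obtain C where C: "C > 0" "\<And>n. hnorm S (t n) \<le> C" by (rule Cauchy_seq_bounded[OF t]) blast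
  have "Cauchy (\<lambda>n. inprod S (s n) (t n))"
  proof (rule CauchyI)
    fix e :: real assume e: "e > 0"
    obtain N where N: "\<forall>m\<ge>N. \<forall>n\<ge>N. hnorm S (s m \<ominus>\<^bsub>S\<^esub> s n) < e / (2 * C)"
      using Cauchy_seqD[OF s, of "e / (2 * C)"] e C by auto
    obtain M where M: "\<forall>m\<ge>M. \<forall>n\<ge>M. hnorm S (t m \<ominus>\<^bsub>S\<^esub> t n) < e / (2 * B)"
      using Cauchy_seqD[OF t, of "e / (2 * B)"] e B by auto
    show "\<exists>N. \<forall>m\<ge>N. \<forall>n\<ge>N. norm (inprod S (s m) (t m) - inprod S (s n) (t n)) < e"
    proof (intro exI[of _ "max N M"] allI impI)
      fix m n assume "max N M \<le> m" "max N M \<le> n"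
      then have *: "hnorm S (s m \<ominus>\<^bsub>S\<^esub> s n) < e / (2 * C)" "hnorm S (t m \<ominus>\<^bsub>S\<^esub> t n) < e / (2 * B)"
        using N M by auto
      have "hnorm S (s m \<ominus>\<^bsub>S\<^esub> s n) * hnorm S (t m) \<le> hnorm S (s m \<ominus>\<^bsub>S\<^esub> s n) * C"
        using c C by (intro mult_left_mono) auto
      also have "\<dots> < e / (2 * C) * C"
        using * C by (intro mult_strict_right_mono) auto
      finally have 1: "hnorm S (s m \<ominus>\<^bsub>S\<^esub> s n) * hnorm S (t m) < e / 2"
        using C by simp
      have "hnorm S (s n) * hnorm S (t m \<ominus>\<^bsub>S\<^esub> t n) \<le> B * hnorm S (t m \<ominus>\<^bsub>S\<^esub> t n)"
        using c B by (intro mult_right_mono) auto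
      also have "\<dots> < B * (e / (2 * B))"
        using * B by (intro mult_strict_left_mono) auto
      finally have 2: "hnorm S (s n) * hnorm S (t m \<ominus>\<^bsub>S\<^esub> t n) < e / 2"
        using B by simp
      show "norm (inprod S (s m) (t m) - inprod S (s n) (t n)) < e"
        using inprod_diff_bound[of "s m" "t m" "s n" "t n"] c 1 2 by simp
    qed
  qed
  then show ?thesis by (simp add: Cauchy_convergent_iff)
qed

lemma inprod_lim: "Cauchy_seq s \<Longrightarrow> Cauchy_seq t \<Longrightarrow>
    (\<lambda>n. inprod S (s n) (t n)) \<longlonglongrightarrow> inprod (cauchy_space S) s t"
  by (simp add: inprod_convergent convergent_LIMSEQ_iff[symmetric])

lemma module_cauchy_space: "Module.module complex_ring (cauchy_space S)"
proof (rule moduleI)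
  show "abelian_group (cauchy_space S)"
  proof (rule abelian_groupI; simp add: cauchy_seqs_iff Cauchy_seq_add Cauchy_seq_const)
    fix x y z assume "Cauchy_seq x" "Cauchy_seq y" "Cauchy_seq z"
    then show "(\<lambda>n. x n \<oplus>\<^bsub>S\<^esub> y n \<oplus>\<^bsub>S\<^esub> z n) = (\<lambda>n. x n \<oplus>\<^bsub>S\<^esub> (y n \<oplus>\<^bsub>S\<^esub> z n))"
      by (simp add: Cauchy_seq_closed M.a_assoc)
  next
    fix x y assume "Cauchy_seq x" "Cauchy_seq y"
    then show "(\<lambda>n. x n \<oplus>\<^bsub>S\<^esub> y n) = (\<lambda>n. y n \<oplus>\<^bsub>S\<^esub> x n)"
      by (auto simp: Cauchy_seq_closed intro!: ext M.a_comm)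
  next
    fix x assume x: "Cauchy_seq x"
    then have "(\<lambda>n. (- 1) \<odot>\<^bsub>S\<^esub> x n \<oplus>\<^bsub>S\<^esub> x n) = (\<lambda>n. \<zero>\<^bsub>S\<^esub>)"
      by (auto simp: Cauchy_seq_closed M.l_neg simp flip: uminus_eq_smult)
    then show "\<exists>y\<in>cauchy_seqs S. (\<lambda>n. y n \<oplus>\<^bsub>S\<^esub> x n) = (\<lambda>n. \<zero>\<^bsub>S\<^esub>)"
      using Cauchy_seq_smult[OF x, of "- 1"]
      by (intro bexI[of _ "\<lambda>n. (- 1) \<odot>\<^bsub>S\<^esub> x n"]) (simp_all add: cauchy_seqs_iff)
  qed (simp add: Cauchy_seq_closed)
qed (insert smult_l_distr smult_r_distr smult_assoc1,
    auto simp: cauchy_seqs_iff Cauchy_seq_closed Cauchy_seq_smult cring_complex_ring)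

lemma semi_inner_space_cauchy_space: "semi_inner_space (cauchy_space S)"
proof (intro semi_inner_space.intro semi_inner_space_axioms.intro module_cauchy_space)
  fix x y z :: "nat \<Rightarrow> 'x" and c
  assume x: "x \<in> carrier (cauchy_space S)"
  then have cx: "Cauchy_seq x" by (simp add: cauchy_seqs_iff)
  have "0 \<le> Re (inprod S (x n) (x n))" for n
    using Cauchy_seq_closed[OF cx] by (intro inprod_nonneg)
  then show "0 \<le> Re (inprod (cauchy_space S) x x)"
    by (intro LIMSEQ_le_const[OF tendsto_Re[OF inprod_lim[OF cx cx]]]) auto
  assume y: "y \<in> carrier (cauchy_space S)"
  then have cy: "Cauchy_seq y" by (simp add: cauchy_seqs_iff)
  note c = Cauchy_seq_closed[OF cx] Cauchy_seq_closed[OF cy]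
  have "(\<lambda>n. inprod S (y n) (x n)) = (\<lambda>n. cnj (inprod S (x n) (y n)))"
    using c by (intro ext inprod_cnj) auto
  then show "inprod (cauchy_space S) y x = cnj (inprod (cauchy_space S) x y)"
    using LIMSEQ_unique[OF inprod_lim[OF cy cx]] tendsto_cnj[OF inprod_lim[OF cx cy]] by simp
  have "(\<lambda>n. inprod S (x n) (c \<odot>\<^bsub>S\<^esub> y n)) = (\<lambda>n. c * inprod S (x n) (y n))"
    using c by (simp add: inprod_smult_right)
  then show "inprod (cauchy_space S) x (c \<odot>\<^bsub>cauchy_space S\<^esub> y) = c * inprod (cauchy_space S) x y"
    using LIMSEQ_unique[OF inprod_lim[OF cx Cauchy_seq_smult[OF cy, of c]]]
      tendsto_mult_left[OF inprod_lim[OF cx cy], of c] by simp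
  assume z: "z \<in> carrier (cauchy_space S)"
  then have cz: "Cauchy_seq z" by (simp add: cauchy_seqs_iff)
  note c = c Cauchy_seq_closed[OF cz]
  have "(\<lambda>n. inprod S (x n) (y n \<oplus>\<^bsub>S\<^esub> z n)) = (\<lambda>n. inprod S (x n) (y n) + inprod S (x n) (z n))"
    using c by (simp add: inprod_add_right)
  then show "inprod (cauchy_space S) x (y \<oplus>\<^bsub>cauchy_space S\<^esub> z) =
      inprod (cauchy_space S) x y + inprod (cauchy_space S) x z"
    using LIMSEQ_unique[OF inprod_lim[OF cx Cauchy_seq_add[OF cy cz]]]
      tendsto_add[OF inprod_lim[OF cx cy] inprod_lim[OF cx cz]] by simp
qed

sublocale C: semi_inner_space "cauchy_space S"
  by (rule semi_inner_space_cauchy_space)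

lemma cauchy_class_iff:
  assumes s: "Cauchy_seq s"
  shows "t \<in> cauchy_class S s \<longleftrightarrow> Cauchy_seq t \<and> (\<lambda>n. hnorm S (s n \<ominus>\<^bsub>S\<^esub> t n)) \<longlonglongrightarrow> 0"
proof -
  have "hdist S (s n) (t n) = hnorm S (s n \<ominus>\<^bsub>S\<^esub> t n)" if "Cauchy_seq t" for n
    using s that by (simp add: hdist_eq Cauchy_seq_closed)
  then show ?thesis by (auto simp: cauchy_class_def cauchy_seqs_iff)
qed

lemma cauchy_class_self: "Cauchy_seq s \<Longrightarrow> s \<in> cauchy_class S s"
  by (simp add: cauchy_class_iff) (simp add: a_minus_def Cauchy_seq_closed M.r_neg)

lemma hnorm_lim0_trans:
  assumes "\<And>n. a n \<in> carrier S" "\<And>n. b n \<in> carrier S" "\<And>n. c n \<in> carrier S"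
    and "(\<lambda>n. hnorm S (a n \<ominus>\<^bsub>S\<^esub> b n)) \<longlonglongrightarrow> 0" "(\<lambda>n. hnorm S (b n \<ominus>\<^bsub>S\<^esub> c n)) \<longlonglongrightarrow> 0"
  shows "(\<lambda>n. hnorm S (a n \<ominus>\<^bsub>S\<^esub> c n)) \<longlonglongrightarrow> 0"
proof (rule tendsto_sandwich[OF _ _ tendsto_const])
  show "(\<lambda>n. hnorm S (a n \<ominus>\<^bsub>S\<^esub> b n) + hnorm S (b n \<ominus>\<^bsub>S\<^esub> c n)) \<longlonglongrightarrow> 0"
    using tendsto_add[OF assms(4,5)] by simp
qed (use assms hnorm_diff_triangle in auto)

lemma cauchy_class_eqI:
  assumes s: "Cauchy_seq s" and t: "Cauchy_seq t" and "(\<lambda>n. hnorm S (s n \<ominus>\<^bsub>S\<^esub> t n)) \<longlonglongrightarrow> 0"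
  shows "cauchy_class S s = cauchy_class S t"
proof -
  have st: "(\<lambda>n. hnorm S (t n \<ominus>\<^bsub>S\<^esub> s n)) \<longlonglongrightarrow> 0"
    using assms by (simp add: hnorm_diff_sym Cauchy_seq_closed)
  show ?thesis
    using hnorm_lim0_trans[of s t] hnorm_lim0_trans[of t s] assms st
    by (auto simp: cauchy_class_iff Cauchy_seq_closed)
qed

lemma hnorm_lim_C:
  assumes s: "Cauchy_seq s"
  shows "(\<lambda>n. hnorm S (s n)) \<longlonglongrightarrow> hnorm (cauchy_space S) s"
  unfolding hnorm_def
  by (intro tendsto_real_sqrt tendsto_Re inprod_lim s)

lemma C_minus: "Cauchy_seq s \<Longrightarrow> Cauchy_seq t \<Longrightarrow> s \<ominus>\<^bsub>cauchy_space S\<^esub> t = (\<lambda>n. s n \<ominus>\<^bsub>S\<^esub> t n)"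
proof -
  assume s: "Cauchy_seq s" and t: "Cauchy_seq t"
  then have "s \<ominus>\<^bsub>cauchy_space S\<^esub> t = s \<oplus>\<^bsub>cauchy_space S\<^esub> (- 1) \<odot>\<^bsub>cauchy_space S\<^esub> t"
    by (simp only: a_minus_def C.uminus_eq_smult cauchy_seqs_iff cauchy_space_sel)
  then show ?thesis
    using t by (simp add: a_minus_def uminus_eq_smult Cauchy_seq_closed)
qed

lemma Cauchy_seq_diff: "Cauchy_seq s \<Longrightarrow> Cauchy_seq t \<Longrightarrow> Cauchy_seq (\<lambda>n. s n \<ominus>\<^bsub>S\<^esub> t n)"
  using C.M.minus_closed[of s t] by (simp add: C_minus cauchy_seqs_iff)

lemma completion_carrier: "carrier (completion S) = cauchy_class S ` carrier (cauchy_space S)"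
  by (simp add: completion_def)

lemma completion_zero: "\<zero>\<^bsub>completion S\<^esub> = cauchy_class S \<zero>\<^bsub>cauchy_space S\<^esub>"
  by (simp add: completion_def)

lemma class_add_cong:
  assumes s: "Cauchy_seq s" and t: "Cauchy_seq t" and s': "s' \<in> cauchy_class S s" and t': "t' \<in> cauchy_class S t"
  shows "cauchy_class S (\<lambda>n. s' n \<oplus>\<^bsub>S\<^esub> t' n) = cauchy_class S (\<lambda>n. s n \<oplus>\<^bsub>S\<^esub> t n)"
proof -
  have c: "Cauchy_seq s'" "Cauchy_seq t'" and
    l: "(\<lambda>n. hnorm S (s n \<ominus>\<^bsub>S\<^esub> s' n)) \<longlonglongrightarrow> 0" "(\<lambda>n. hnorm S (t n \<ominus>\<^bsub>S\<^esub> t' n)) \<longlonglongrightarrow> 0"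
    using s' t' by (simp_all add: cauchy_class_iff s t)
  note cl = Cauchy_seq_closed[OF s] Cauchy_seq_closed[OF t] Cauchy_seq_closed[OF c(1)] Cauchy_seq_closed[OF c(2)]
  have "(\<lambda>n. hnorm S ((s n \<oplus>\<^bsub>S\<^esub> t n) \<ominus>\<^bsub>S\<^esub> (s' n \<oplus>\<^bsub>S\<^esub> t' n))) \<longlonglongrightarrow> 0"
  proof (rule tendsto_sandwich[OF _ _ tendsto_const])
    show "(\<lambda>n. hnorm S (s n \<ominus>\<^bsub>S\<^esub> s' n) + hnorm S (t n \<ominus>\<^bsub>S\<^esub> t' n)) \<longlonglongrightarrow> 0"
      using tendsto_add[OF l] by simp
  qed (use cl hnorm_triangle in \<open>auto simp: diff_add_diff\<close>)
  then show ?thesis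
    by (intro cauchy_class_eqI[symmetric] Cauchy_seq_add s t c)
qed

lemma completion_add:
  assumes s: "s \<in> carrier (cauchy_space S)" and t: "t \<in> carrier (cauchy_space S)"
  shows "cauchy_class S s \<oplus>\<^bsub>completion S\<^esub> cauchy_class S t = cauchy_class S (s \<oplus>\<^bsub>cauchy_space S\<^esub> t)"
proof -
  have c: "Cauchy_seq s" "Cauchy_seq t" using assms by (simp_all add: cauchy_seqs_iff)
  have "(\<Union>s'\<in>cauchy_class S s. \<Union>t'\<in>cauchy_class S t. cauchy_class S (\<lambda>n. s' n \<oplus>\<^bsub>S\<^esub> t' n))
      = cauchy_class S (\<lambda>n. s n \<oplus>\<^bsub>S\<^esub> t n)"
    by (intro UN_eq_constI[OF cauchy_class_self] class_add_cong c)
  then show ?thesis by (simp add: completion_def)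
qed

lemma completion_smult:
  assumes s: "s \<in> carrier (cauchy_space S)"
  shows "c \<odot>\<^bsub>completion S\<^esub> cauchy_class S s = cauchy_class S (c \<odot>\<^bsub>cauchy_space S\<^esub> s)"
proof -
  have cs: "Cauchy_seq s" using assms by (simp_all add: cauchy_seqs_iff)
  have "cauchy_class S (\<lambda>n. c \<odot>\<^bsub>S\<^esub> s' n) = cauchy_class S (\<lambda>n. c \<odot>\<^bsub>S\<^esub> s n)"
    if "s' \<in> cauchy_class S s" for s'
  proof -
    have cs': "Cauchy_seq s'" and l: "(\<lambda>n. hnorm S (s n \<ominus>\<^bsub>S\<^esub> s' n)) \<longlonglongrightarrow> 0"
      using that by (simp_all add: cauchy_class_iff cs)
    have "(\<lambda>n. hnorm S (c \<odot>\<^bsub>S\<^esub> s n \<ominus>\<^bsub>S\<^esub> c \<odot>\<^bsub>S\<^esub> s' n)) \<longlonglongrightarrow> 0"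
      using tendsto_mult_left[OF l, of "cmod c"] Cauchy_seq_closed[OF cs] Cauchy_seq_closed[OF cs']
      by (simp add: hnorm_smult flip: smult_diff)
    then show ?thesis
      by (intro cauchy_class_eqI[symmetric] Cauchy_seq_smult cs cs')
  qed
  then have "(\<Union>s'\<in>cauchy_class S s. cauchy_class S (\<lambda>n. c \<odot>\<^bsub>S\<^esub> s' n)) = cauchy_class S (\<lambda>n. c \<odot>\<^bsub>S\<^esub> s n)"
    by (intro UN_eq_constI[OF cauchy_class_self[OF cs]])
  then show ?thesis by (simp add: completion_def)
qed

text \<open>Equivalent Cauchy sequences differ by a null vector of the limit form, so Cauchy-Schwarz
  in \<open>cauchy_space\<close> allows one argument after the other to be replaced. Uniqueness of
  limits then settles the \<open>THE\<close> in \<open>completion\<close>.\<close>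

lemma completion_inprod:
  assumes "s \<in> carrier (cauchy_space S)" and "t \<in> carrier (cauchy_space S)"
  shows "inprod (completion S) (cauchy_class S s) (cauchy_class S t) = inprod (cauchy_space S) s t"
proof -
  have s: "Cauchy_seq s" and t: "Cauchy_seq t" using assms by (simp_all add: cauchy_seqs_iff)
  have "(\<lambda>n. inprod S (s' n) (t' n)) \<longlonglongrightarrow> inprod (cauchy_space S) s t"
    if "s' \<in> cauchy_class S s" "t' \<in> cauchy_class S t" for s' t'
  proof -
    have s': "Cauchy_seq s'" and t': "Cauchy_seq t'" and
      l: "(\<lambda>n. hnorm S (s n \<ominus>\<^bsub>S\<^esub> s' n)) \<longlonglongrightarrow> 0" "(\<lambda>n. hnorm S (t n \<ominus>\<^bsub>S\<^esub> t' n)) \<longlonglongrightarrow> 0"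
      using that by (simp_all add: cauchy_class_iff s t)
    have C: "s \<in> carrier (cauchy_space S)" "t \<in> carrier (cauchy_space S)"
      "s' \<in> carrier (cauchy_space S)" "t' \<in> carrier (cauchy_space S)"
      using s t s' t' by (simp_all add: cauchy_seqs_iff)
    have "hnorm (cauchy_space S) (s \<ominus>\<^bsub>cauchy_space S\<^esub> s') = 0"
      using LIMSEQ_unique[OF hnorm_lim_C[OF Cauchy_seq_diff[OF s s']] l(1)] by (simp only: C_minus s s')
    then have "inprod (cauchy_space S) (s \<ominus>\<^bsub>cauchy_space S\<^esub> s') t = 0"
      using C.Cauchy_Schwarz[OF C.M.minus_closed[OF C(1,3)] C(2)]
      by (simp only: mult_zero_left norm_le_zero_iff)
    then have 1: "inprod (cauchy_space S) s t = inprod (cauchy_space S) s' t"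
      using C.inprod_diff_left[OF C(1,3,2)] by (simp only: right_minus_eq)
    have "hnorm (cauchy_space S) (t \<ominus>\<^bsub>cauchy_space S\<^esub> t') = 0"
      using LIMSEQ_unique[OF hnorm_lim_C[OF Cauchy_seq_diff[OF t t']] l(2)] by (simp only: C_minus t t')
    then have "inprod (cauchy_space S) s' (t \<ominus>\<^bsub>cauchy_space S\<^esub> t') = 0"
      using C.Cauchy_Schwarz[OF C(3) C.M.minus_closed[OF C(2,4)]]
      by (simp only: mult_zero_right norm_le_zero_iff)
    then have 2: "inprod (cauchy_space S) s' t = inprod (cauchy_space S) s' t'"
      using C.inprod_diff_right[OF C(3,2,4)] by (simp only: right_minus_eq)
    have "inprod (cauchy_space S) s t = inprod (cauchy_space S) s' t'"
      by (simp only: 1 2)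
    then show ?thesis using inprod_lim[OF s' t'] by (simp only:)
  qed
  then have "(THE c. \<forall>s'\<in>cauchy_class S s. \<forall>t'\<in>cauchy_class S t. (\<lambda>n. inprod S (s' n) (t' n)) \<longlonglongrightarrow> c) =
      inprod (cauchy_space S) s t"
    using cauchy_class_self[OF s] cauchy_class_self[OF t]
    by (intro the_equality) (blast, metis LIMSEQ_unique)
  then show ?thesis by (simp add: completion_def)
qed

lemma inner_product_space_completion: "inner_product_space (completion S)"
proof (rule inner_product_space_image[where S = "cauchy_space S" and q = "cauchy_class S"])
  show "semi_inner_space (cauchy_space S)" by (rule semi_inner_space_cauchy_space)
  show "Module.module complex_ring (completion S)"
    by (rule module_image[where M = "cauchy_space S" and q = "cauchy_class S", OF module_cauchy_space])
      (simp_all only: completion_carrier completion_zero completion_add completion_smult)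
  fix s assume s: "s \<in> carrier (cauchy_space S)" and "inprod (cauchy_space S) s s = 0"
  then have "hnorm (cauchy_space S) s = 0" and cs: "Cauchy_seq s"
    using C.hnorm_eq_0[of s] by (simp_all add: cauchy_seqs_iff)
  then have "(\<lambda>n. hnorm S (s n)) \<longlonglongrightarrow> 0" using hnorm_lim_C[OF cs] by simp
  then have "(\<lambda>n. hnorm S (s n \<ominus>\<^bsub>S\<^esub> \<zero>\<^bsub>S\<^esub>)) \<longlonglongrightarrow> 0"
    by (simp add: diff_zero Cauchy_seq_closed[OF cs])
  then show "cauchy_class S s = cauchy_class S \<zero>\<^bsub>cauchy_space S\<^esub>"
    using cauchy_class_eqI[OF cs Cauchy_seq_const[OF M.zero_closed]] by simp
qed (simp_all only: completion_carrier completion_zero completion_add completion_smult completion_inprod)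

sublocale Q: inner_product_space "completion S"
  by (rule inner_product_space_completion)

section \<open>Density of the constant sequences and completeness\<close>

abbreviation const_class :: "'x \<Rightarrow> (nat \<Rightarrow> 'x) set"
  where "const_class x \<equiv> cauchy_class S (\<lambda>n. x)"

lemma const_class_closed: "x \<in> carrier S \<Longrightarrow> const_class x \<in> carrier (completion S)"
  by (simp add: completion_carrier cauchy_seqs_iff Cauchy_seq_const)

lemma const_class_add: "x \<in> carrier S \<Longrightarrow> y \<in> carrier S \<Longrightarrow>
    const_class x \<oplus>\<^bsub>completion S\<^esub> const_class y = const_class (x \<oplus>\<^bsub>S\<^esub> y)"
  by (subst completion_add) (simp_all add: cauchy_seqs_iff Cauchy_seq_const)

lemma const_class_smult: "x \<in> carrier S \<Longrightarrow>
    c \<odot>\<^bsub>completion S\<^esub> const_class x = const_class (c \<odot>\<^bsub>S\<^esub> x)"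
  by (subst completion_smult) (simp_all add: cauchy_seqs_iff Cauchy_seq_const)

lemma const_class_inprod: "x \<in> carrier S \<Longrightarrow> y \<in> carrier S \<Longrightarrow>
    inprod (completion S) (const_class x) (const_class y) = inprod S x y"
  by (subst completion_inprod) (simp_all add: cauchy_seqs_iff Cauchy_seq_const)

lemma completion_diff:
  assumes "Cauchy_seq s" "Cauchy_seq t"
  shows "cauchy_class S s \<ominus>\<^bsub>completion S\<^esub> cauchy_class S t = cauchy_class S (\<lambda>n. s n \<ominus>\<^bsub>S\<^esub> t n)"
proof -
  have c: "s \<in> carrier (cauchy_space S)" "t \<in> carrier (cauchy_space S)"
    using assms by (simp_all add: cauchy_seqs_iff)
  then have "cauchy_class S s \<in> carrier (completion S)" "cauchy_class S t \<in> carrier (completion S)"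
    by (auto simp: completion_carrier)
  then have "cauchy_class S s \<ominus>\<^bsub>completion S\<^esub> cauchy_class S t = cauchy_class S (s \<oplus>\<^bsub>cauchy_space S\<^esub> (- 1) \<odot>\<^bsub>cauchy_space S\<^esub> t)"
    unfolding a_minus_def using c
    by (simp only: Q.uminus_eq_smult completion_smult completion_add C.smult_complex_closed)
  then show ?thesis
    using assms(2) by (simp add: a_minus_def uminus_eq_smult Cauchy_seq_closed)
qed

lemma completion_hnorm: "Cauchy_seq s \<Longrightarrow> (\<lambda>n. hnorm S (s n)) \<longlonglongrightarrow> hnorm (completion S) (cauchy_class S s)"
  using hnorm_lim_C[of s] by (simp add: hnorm_def completion_inprod cauchy_seqs_iff)

text \<open>The distance from the class of s to the constant class at s k is the limit over n of the
  distances from s n to s k, hence at most the Cauchy tolerance once k is large.\<close>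

lemma const_class_approx:
  assumes s: "Cauchy_seq s"
  shows "(\<lambda>k. hnorm (completion S) (cauchy_class S s \<ominus>\<^bsub>completion S\<^esub> const_class (s k))) \<longlonglongrightarrow> 0"
proof (rule LIMSEQ_I)
  fix e :: real assume "e > 0"
  then obtain N where N: "\<forall>m\<ge>N. \<forall>n\<ge>N. hnorm S (s m \<ominus>\<^bsub>S\<^esub> s n) < e / 2"
    using Cauchy_seqD[OF s, of "e/2"] by auto
  note c = Cauchy_seq_closed[OF s]
  show "\<exists>N. \<forall>k\<ge>N. norm (hnorm (completion S) (cauchy_class S s \<ominus>\<^bsub>completion S\<^esub> const_class (s k)) - 0) < e"
  proof (intro exI[of _ N] allI impI)
    fix k assume "N \<le> k"
    have "hnorm (completion S) (cauchy_class S s \<ominus>\<^bsub>completion S\<^esub> const_class (s k)) \<le> e / 2"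
      unfolding completion_diff[OF s Cauchy_seq_const[OF c]]
      using N \<open>N \<le> k\<close>
      by (intro LIMSEQ_le_const2[OF completion_hnorm[OF Cauchy_seq_diff[OF s Cauchy_seq_const[OF c]]]])
        (auto intro!: exI[of _ N] less_imp_le)
    moreover have "0 \<le> hnorm (completion S) (cauchy_class S s \<ominus>\<^bsub>completion S\<^esub> const_class (s k))"
      using s c by (intro Q.hnorm_nonneg Q.M.minus_closed const_class_closed) (auto simp: completion_carrier cauchy_seqs_iff)
    ultimately show "norm (hnorm (completion S) (cauchy_class S s \<ominus>\<^bsub>completion S\<^esub> const_class (s k)) - 0) < e"
      using \<open>e > 0\<close> by simp
  qed
qed

lemma const_class_dense:
  assumes "X \<in> carrier (completion S)" "e > 0"
  obtains x where "x \<in> carrier S" "hnorm (completion S) (X \<ominus>\<^bsub>completion S\<^esub> const_class x) < e"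
proof -
  obtain s where s: "Cauchy_seq s" "X = cauchy_class S s"
    using assms(1) by (auto simp: completion_carrier cauchy_seqs_iff)
  have "\<forall>\<^sub>F k in sequentially. hnorm (completion S) (X \<ominus>\<^bsub>completion S\<^esub> const_class (s k)) < e"
    using order_tendstoD(2)[OF const_class_approx[OF s(1)] assms(2)] by (simp add: s)
  then obtain k where "hnorm (completion S) (X \<ominus>\<^bsub>completion S\<^esub> const_class (s k)) < e"
    by (auto simp: eventually_sequentially)
  then show ?thesis using that[of "s k"] Cauchy_seq_closed[OF s(1)] by blast
qed

text \<open>The k-th class of a Cauchy sequence is replaced by a constant class at distance below 1
  / (k + 1). The chosen vectors of S form a Cauchy sequence themselves, and its class is the
  limit.\<close>

lemma hilbert_space_completion: "hilbert_space (completion S)"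
proof (intro hilbert_space.intro hilbert_space_axioms.intro inner_product_space_completion)
  show "Metric_space.mcomplete (carrier (completion S)) (hdist (completion S))"
    unfolding Q.mcomplete_iff
  proof (intro allI impI)
    fix X assume X: "Q.Cauchy_seq X"
    then have Xc: "X k \<in> carrier (completion S)" for k by (auto simp: Q.Cauchy_seq_def)
    have "\<exists>s. \<forall>k. s k \<in> carrier S \<and> hnorm (completion S) (X k \<ominus>\<^bsub>completion S\<^esub> const_class (s k)) < 1 / real (Suc k)"
      by (intro choice allI) (metis Xc const_class_dense of_nat_0_less_iff zero_less_Suc zero_less_divide_1_iff)
    then obtain s where s: "\<And>k. s k \<in> carrier S"
      and sX: "\<And>k. hnorm (completion S) (X k \<ominus>\<^bsub>completion S\<^esub> const_class (s k)) < 1 / real (Suc k)"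
      by blast
    have lim: "(\<lambda>k. hnorm (completion S) (X k \<ominus>\<^bsub>completion S\<^esub> const_class (s k))) \<longlonglongrightarrow> 0"
      by (rule tendsto_sandwich[OF _ _ tendsto_const LIMSEQ_inverse_real_of_nat])
        (use sX Xc s const_class_closed in \<open>auto simp: inverse_eq_divide less_imp_le\<close>)
    have cs: "Cauchy_seq s"
      unfolding Cauchy_seq_def
    proof (intro conjI allI impI)
      fix e :: real assume e: "e > 0"
      obtain N where N: "\<forall>m\<ge>N. \<forall>n\<ge>N. hnorm (completion S) (X m \<ominus>\<^bsub>completion S\<^esub> X n) < e / 3"
        using X e unfolding Q.Cauchy_seq_def by (metis divide_pos_pos zero_less_numeral)
      obtain M where M: "\<forall>k\<ge>M. hnorm (completion S) (X k \<ominus>\<^bsub>completion S\<^esub> const_class (s k)) < e / 3"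
        using order_tendstoD(2)[OF lim, of "e / 3"] e by (auto simp: eventually_sequentially)
      show "\<exists>N. \<forall>m\<ge>N. \<forall>n\<ge>N. hnorm S (s m \<ominus>\<^bsub>S\<^esub> s n) < e"
      proof (intro exI[of _ "max N M"] allI impI)
        fix m n assume mn: "max N M \<le> m" "max N M \<le> n"
        \<comment> \<open>Constant classes embed S isometrically, so the distance is estimated in
          the completion, through X m and X n, with one third of e for each of the three
          pieces.\<close>
        have "hnorm S (s m \<ominus>\<^bsub>S\<^esub> s n) = hnorm (completion S) (const_class (s m) \<ominus>\<^bsub>completion S\<^esub> const_class (s n))"
          using s by (simp add: completion_diff Cauchy_seq_const hnorm_def const_class_inprod)
        also have "\<dots> \<le> hnorm (completion S) (const_class (s m) \<ominus>\<^bsub>completion S\<^esub> X m)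
            + hnorm (completion S) (X m \<ominus>\<^bsub>completion S\<^esub> const_class (s n))"
          using s Xc by (intro Q.hnorm_diff_triangle const_class_closed)
        also have "hnorm (completion S) (X m \<ominus>\<^bsub>completion S\<^esub> const_class (s n)) \<le>
            hnorm (completion S) (X m \<ominus>\<^bsub>completion S\<^esub> X n) + hnorm (completion S) (X n \<ominus>\<^bsub>completion S\<^esub> const_class (s n))"
          using s Xc by (intro Q.hnorm_diff_triangle const_class_closed)
        also have "hnorm (completion S) (const_class (s m) \<ominus>\<^bsub>completion S\<^esub> X m) =
            hnorm (completion S) (X m \<ominus>\<^bsub>completion S\<^esub> const_class (s m))"
          using s Xc by (intro Q.hnorm_diff_sym const_class_closed)
        finally show "hnorm S (s m \<ominus>\<^bsub>S\<^esub> s n) < e"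
          using N[rule_format, of m n] M[rule_format, of m] M[rule_format, of n] mn by simp
      qed
    qed (use s in auto)
    have cc: "cauchy_class S s \<in> carrier (completion S)"
      using cs by (auto simp: completion_carrier cauchy_seqs_iff)
    have "(\<lambda>k. hnorm (completion S) (X k \<ominus>\<^bsub>completion S\<^esub> cauchy_class S s)) \<longlonglongrightarrow> 0"
    proof (rule tendsto_sandwich[OF _ _ tendsto_const])
      show "(\<lambda>k. hnorm (completion S) (X k \<ominus>\<^bsub>completion S\<^esub> const_class (s k)) +
          hnorm (completion S) (cauchy_class S s \<ominus>\<^bsub>completion S\<^esub> const_class (s k))) \<longlonglongrightarrow> 0"
        using tendsto_add[OF lim const_class_approx[OF cs]] by simp
      show "\<forall>\<^sub>F k in sequentially. hnorm (completion S) (X k \<ominus>\<^bsub>completion S\<^esub> cauchy_class S s) \<le>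
          hnorm (completion S) (X k \<ominus>\<^bsub>completion S\<^esub> const_class (s k)) +
          hnorm (completion S) (cauchy_class S s \<ominus>\<^bsub>completion S\<^esub> const_class (s k))"
      proof (intro always_eventually allI)
        fix k
        show "hnorm (completion S) (X k \<ominus>\<^bsub>completion S\<^esub> cauchy_class S s) \<le>
          hnorm (completion S) (X k \<ominus>\<^bsub>completion S\<^esub> const_class (s k)) +
          hnorm (completion S) (cauchy_class S s \<ominus>\<^bsub>completion S\<^esub> const_class (s k))"
          using Q.hnorm_diff_triangle[OF Xc const_class_closed[OF s] cc, of k k]
            Q.hnorm_diff_sym[OF const_class_closed[OF s] cc, of k] by simp
      qed
    qed (use Xc cc in auto)
    then show "\<exists>x\<in>carrier (completion S). (\<lambda>k. hnorm (completion S) (X k \<ominus>\<^bsub>completion S\<^esub> x)) \<longlonglongrightarrow> 0"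
      using cc by blast
  qed
qed

end

section \<open>Tensor products\<close>

lemma free_space_sel [simp]:
  "carrier (free_space B) = {f. Poly_Mapping.keys f \<subseteq> B}"
  "\<zero>\<^bsub>free_space B\<^esub> = 0"
  "f \<oplus>\<^bsub>free_space B\<^esub> g = f + g"
  "c \<odot>\<^bsub>free_space B\<^esub> f = Poly_Mapping.map (\<lambda>z. c * z) f"
  by (simp_all add: free_space_def)

lemma lookup_map_times: "Poly_Mapping.lookup (Poly_Mapping.map (\<lambda>z. c * z) f) k = c * Poly_Mapping.lookup f k"
  for c :: complex
  by (simp add: Poly_Mapping.map.rep_eq when_def)

lemma keys_map_times_subset: "Poly_Mapping.keys (Poly_Mapping.map (\<lambda>z. c * z) f) \<subseteq> Poly_Mapping.keys f"
  for c :: complex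
  by (auto simp: in_keys_iff lookup_map_times)

lemma keys_minus_subset: "Poly_Mapping.keys (f - g) \<subseteq> Poly_Mapping.keys f \<union> Poly_Mapping.keys g"
  for f g :: "'x \<Rightarrow>\<^sub>0 complex"
  by (auto simp: in_keys_iff lookup_minus)

lemma module_free_space: "Module.module complex_ring (free_space B)"
proof (rule moduleI)
  show "abelian_group (free_space B)"
  proof (rule abelian_groupI)
    fix f assume "f \<in> carrier (free_space B)"
    then show "\<exists>g\<in>carrier (free_space B). g \<oplus>\<^bsub>free_space B\<^esub> f = \<zero>\<^bsub>free_space B\<^esub>"
      by (intro bexI[of _ "- f"]) (auto simp: in_keys_iff)
  qed (auto simp: add_ac dest!: subsetD[OF Poly_Mapping.keys_add])
next
  fix a b f assume "f \<in> carrier (free_space B)"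
  have "Poly_Mapping.lookup (Poly_Mapping.map (\<lambda>z. (a + b) * z) f) k =
      Poly_Mapping.lookup (Poly_Mapping.map (\<lambda>z. a * z) f + Poly_Mapping.map (\<lambda>z. b * z) f) k" for k
    by (simp only: lookup_map_times[of "a + b"] lookup_map_times[of a] lookup_map_times[of b] lookup_add)
      (simp add: distrib_right)
  then show "(a \<oplus>\<^bsub>complex_ring\<^esub> b) \<odot>\<^bsub>free_space B\<^esub> f =
      a \<odot>\<^bsub>free_space B\<^esub> f \<oplus>\<^bsub>free_space B\<^esub> b \<odot>\<^bsub>free_space B\<^esub> f"
    by (simp only: free_space_sel complex_ring_simps poly_mapping_eqI)
next
  fix a f g assume "f \<in> carrier (free_space B)" "g \<in> carrier (free_space B)"
  show "a \<odot>\<^bsub>free_space B\<^esub> (f \<oplus>\<^bsub>free_space B\<^esub> g) =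
      a \<odot>\<^bsub>free_space B\<^esub> f \<oplus>\<^bsub>free_space B\<^esub> a \<odot>\<^bsub>free_space B\<^esub> g"
    by (rule poly_mapping_eqI) (simp add: lookup_map_times lookup_add distrib_left)
next
  fix a b f assume "f \<in> carrier (free_space B)"
  have "Poly_Mapping.lookup (Poly_Mapping.map (\<lambda>z. (a * b) * z) f) k =
      Poly_Mapping.lookup (Poly_Mapping.map (\<lambda>z. a * z) (Poly_Mapping.map (\<lambda>z. b * z) f)) k" for k
    by (simp only: lookup_map_times) simp
  then show "(a \<otimes>\<^bsub>complex_ring\<^esub> b) \<odot>\<^bsub>free_space B\<^esub> f = a \<odot>\<^bsub>free_space B\<^esub> (b \<odot>\<^bsub>free_space B\<^esub> f)"
    by (simp only: free_space_sel complex_ring_simps poly_mapping_eqI)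
next
  fix f assume "f \<in> carrier (free_space B)"
  have "Poly_Mapping.lookup (Poly_Mapping.map (\<lambda>z. 1 * z) f) k = Poly_Mapping.lookup f k" for k
    by (simp only: lookup_map_times) simp
  then show "\<one>\<^bsub>complex_ring\<^esub> \<odot>\<^bsub>free_space B\<^esub> f = f"
    by (simp only: free_space_sel complex_ring_simps poly_mapping_eqI)
qed (use keys_map_times_subset cring_complex_ring in \<open>auto dest!: subsetD[OF keys_map_times_subset]\<close>)

lemma free_space_minus:
  assumes "f \<in> carrier (free_space B)" "g \<in> carrier (free_space B)"
  shows "f \<ominus>\<^bsub>free_space B\<^esub> g = f - g"
proof -
  interpret Module.module complex_ring "free_space B" by (rule module_free_space)
  have "- g \<in> carrier (free_space B)" using assms(2) by (auto simp: in_keys_iff)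
  then have "\<ominus>\<^bsub>free_space B\<^esub> g = - g"
    using assms(2) by (intro M.minus_equality) auto
  then show ?thesis by (simp add: a_minus_def)
qed

section \<open>Linear functionals on the free space\<close>

definition lin_ext :: "('x \<Rightarrow> complex) \<Rightarrow> ('x \<Rightarrow>\<^sub>0 complex) \<Rightarrow> complex"
  where "lin_ext g f = (\<Sum>p\<in>Poly_Mapping.keys f. Poly_Mapping.lookup f p * g p)"

text \<open>Coefficients can cancel in a sum, which shrinks its support. On a common finite superset
  all the sums can be compared, since the additional coefficients are zero.\<close>

lemma lin_ext_superset:
  "finite F \<Longrightarrow> Poly_Mapping.keys f \<subseteq> F \<Longrightarrow> lin_ext g f = (\<Sum>p\<in>F. Poly_Mapping.lookup f p * g p)"
  unfolding lin_ext_def by (intro sum.mono_neutral_left) (auto simp: in_keys_iff)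

lemma lin_ext_add: "lin_ext g (f + h) = lin_ext g f + lin_ext g h"
proof -
  let ?F = "Poly_Mapping.keys f \<union> Poly_Mapping.keys h"
  have "lin_ext g (f + h) = (\<Sum>p\<in>?F. Poly_Mapping.lookup (f + h) p * g p)"
    by (intro lin_ext_superset) (auto simp: Poly_Mapping.keys_add)
  also have "\<dots> = (\<Sum>p\<in>?F. Poly_Mapping.lookup f p * g p) + (\<Sum>p\<in>?F. Poly_Mapping.lookup h p * g p)"
    by (simp add: lookup_add distrib_right sum.distrib)
  also have "\<dots> = lin_ext g f + lin_ext g h"
    by (simp add: lin_ext_superset[of ?F])
  finally show ?thesis .
qed

lemma lin_ext_zero [simp]: "lin_ext g 0 = 0"
  by (simp add: lin_ext_def)

lemma lin_ext_map_times: "lin_ext g (Poly_Mapping.map (\<lambda>z. c * z) f) = c * lin_ext g f"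
  using lin_ext_superset[OF _ keys_map_times_subset[of c f], of g]
  by (simp add: lookup_map_times lin_ext_def sum_distrib_left mult.assoc)

lemma lin_ext_single [simp]: "lin_ext g (Poly_Mapping.single p c) = c * g p"
  by (simp add: lin_ext_def)

lemma lin_ext_diff: "lin_ext g (f - h) = lin_ext g f - lin_ext g h"
  using lin_ext_add[of g "f - h" h] by simp

lemma lin_ext_sum: "lin_ext g (sum h F) = (\<Sum>i\<in>F. lin_ext g (h i))"
  by (induction F rule: infinite_finite_induct) (simp_all add: lin_ext_add)

lemma poly_mapping_sum_single: "f = (\<Sum>p\<in>Poly_Mapping.keys f. Poly_Mapping.single p (Poly_Mapping.lookup f p))"
  for f :: "'x \<Rightarrow>\<^sub>0 complex"
  by (intro poly_mapping_eqI) (auto simp: lookup_sum lookup_single when_def in_keys_iff)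

lemma sum_lessThan_add: "(\<Sum>i<n + m. f i) = (\<Sum>i<n. f i) + (\<Sum>i<m. f (n + i))"
  for f :: "nat \<Rightarrow> 'x :: comm_monoid_add"
  by (induction m) (simp_all add: add.assoc)

text \<open>Concatenation of finite families that are coded as functions on all naturals with a
  separate length. It represents the sum of two tensors written as sums of pure tensors.\<close>

definition cat :: "nat \<Rightarrow> (nat \<Rightarrow> 'z) \<Rightarrow> (nat \<Rightarrow> 'z) \<Rightarrow> nat \<Rightarrow> 'z"
  where "cat n a b = (\<lambda>i. if i < n then a i else b (i - n))"

lemma cat_simps [simp]: "i < n \<Longrightarrow> cat n a b i = a i" "cat n a b (n + i) = b i"
  by (simp_all add: cat_def)

lemma cat_closed: "\<lbrakk>a \<in> {..<n} \<rightarrow> A; b \<in> {..<m} \<rightarrow> A\<rbrakk> \<Longrightarrow> cat n a b \<in> {..<n + m} \<rightarrow> A"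
  by (auto simp: cat_def Pi_iff)

locale bilinear_functional = M: Module.module complex_ring M + N: Module.module complex_ring N
  for M :: "(complex, 'x, 'm) module_scheme" and N :: "(complex, 'y, 'n) module_scheme" +
  fixes g :: "'x \<Rightarrow> 'y \<Rightarrow> complex"
  assumes g_add_left: "\<lbrakk>x \<in> carrier M; x' \<in> carrier M; y \<in> carrier N\<rbrakk> \<Longrightarrow> g (x \<oplus>\<^bsub>M\<^esub> x') y = g x y + g x' y"
    and g_add_right: "\<lbrakk>x \<in> carrier M; y \<in> carrier N; y' \<in> carrier N\<rbrakk> \<Longrightarrow> g x (y \<oplus>\<^bsub>N\<^esub> y') = g x y + g x y'"
    and g_smult_left: "\<lbrakk>x \<in> carrier M; y \<in> carrier N\<rbrakk> \<Longrightarrow> g (c \<odot>\<^bsub>M\<^esub> x) y = c * g x y"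
    and g_smult_right: "\<lbrakk>x \<in> carrier M; y \<in> carrier N\<rbrakk> \<Longrightarrow> g x (c \<odot>\<^bsub>N\<^esub> y) = c * g x y"

locale tensor_product = M: Module.module complex_ring M + N: Module.module complex_ring N
  for M :: "(complex, 'x, 'm) module_scheme" and N :: "(complex, 'y, 'n) module_scheme"
begin

abbreviation "Fr \<equiv> free_space (carrier M \<times> carrier N)"

lemma bilinear_relations_subset: "bilinear_relations M N \<subseteq> carrier Fr"
  using M.smult_closed N.smult_closed
  by (auto simp: bilinear_relations_def dest!: subsetD[OF keys_minus_subset] split: if_splits)

sublocale free: Module.module complex_ring Fr
  by (rule module_free_space)

lemma submodule_tensor_null: "submodule (tensor_null M N) complex_ring Fr"
proof (rule free.submoduleI)
  \<comment> \<open>The whole space belongs to the family that is intersected, which keeps the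
    intersection inside the carrier.\<close>
  have *: "submodule (carrier Fr) complex_ring Fr \<and> bilinear_relations M N \<subseteq> carrier Fr"
    using free.carrier_is_submodule bilinear_relations_subset by blast
  show "tensor_null M N \<subseteq> carrier Fr"
    unfolding tensor_null_def using * by blast
  show "\<zero>\<^bsub>Fr\<^esub> \<in> tensor_null M N"
    unfolding tensor_null_def using subgroup.one_closed submodule.axioms(1) by fastforce
  show "\<ominus>\<^bsub>Fr\<^esub> a \<in> tensor_null M N" if "a \<in> tensor_null M N" for a
    using that free.submoduleE(3) unfolding tensor_null_def by blast
  show "a \<oplus>\<^bsub>Fr\<^esub> b \<in> tensor_null M N" if "a \<in> tensor_null M N" "b \<in> tensor_null M N" for a b
    using that free.submoduleE(5) unfolding tensor_null_def by blast
  show "a \<odot>\<^bsub>Fr\<^esub> x \<in> tensor_null M N" if "a \<in> carrier complex_ring" "x \<in> tensor_null M N" for a x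
    using that free.submoduleE(4) unfolding tensor_null_def by blast
qed

sublocale quot: module_quotient Fr "tensor_null M N"
  by (intro module_quotient.intro free.module_axioms submodule_tensor_null)

lemma bilinear_relations_null: "bilinear_relations M N \<subseteq> tensor_null M N"
  by (auto simp: tensor_null_def)

sublocale T: Module.module complex_ring "tensor M N"
  unfolding tensor_def by (rule quot.quot_module)

abbreviation tcl :: "('x \<times> 'y \<Rightarrow>\<^sub>0 complex) \<Rightarrow> ('x \<times> 'y \<Rightarrow>\<^sub>0 complex) set"
  where "tcl f \<equiv> tensor_null M N +>\<^bsub>Fr\<^esub> f"

lemma tensor_carrier: "carrier (tensor M N) = tcl ` carrier Fr"
  unfolding tensor_def by (rule quot.quot_carrier)

lemma tensor_zero: "\<zero>\<^bsub>tensor M N\<^esub> = tcl 0"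
  unfolding tensor_def using quot.quot_zero by simp

lemma tensor_add: "f \<in> carrier Fr \<Longrightarrow> h \<in> carrier Fr \<Longrightarrow> tcl f \<oplus>\<^bsub>tensor M N\<^esub> tcl h = tcl (f + h)"
  unfolding tensor_def using quot.quot_add[of f h] by simp

lemma tensor_smult: "f \<in> carrier Fr \<Longrightarrow> c \<odot>\<^bsub>tensor M N\<^esub> tcl f = tcl (Poly_Mapping.map (\<lambda>z. c * z) f)"
  unfolding tensor_def using quot.quot_smult[of f c] by simp

lemma tcl_eqI: "f \<in> carrier Fr \<Longrightarrow> h \<in> carrier Fr \<Longrightarrow> f - h \<in> tensor_null M N \<Longrightarrow> tcl f = tcl h"
  using quot.quot_eq_iff[of h f] free_space_minus[of f _ h] by simp

lemma pure_tensor_eq: "pure_tensor M N x y = tcl (Poly_Mapping.single (x, y) 1)"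
  by (simp add: pure_tensor_def)

lemma single_closed [simp, intro]: "x \<in> carrier M \<Longrightarrow> y \<in> carrier N \<Longrightarrow> Poly_Mapping.single (x, y) c \<in> carrier Fr"
  by simp

lemma pure_tensor_closed [simp, intro]: "x \<in> carrier M \<Longrightarrow> y \<in> carrier N \<Longrightarrow> pure_tensor M N x y \<in> carrier (tensor M N)"
  by (auto simp: pure_tensor_eq tensor_carrier)

lemma single_add_closed: "f \<in> carrier Fr \<Longrightarrow> h \<in> carrier Fr \<Longrightarrow> f + h \<in> carrier Fr"
  using free.M.a_closed[of f h] by simp

lemma pure_tensor_add_right: "\<lbrakk>x \<in> carrier M; y \<in> carrier N; y' \<in> carrier N\<rbrakk> \<Longrightarrow>
    pure_tensor M N x (y \<oplus>\<^bsub>N\<^esub> y') = pure_tensor M N x y \<oplus>\<^bsub>tensor M N\<^esub> pure_tensor M N x y'"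
  unfolding pure_tensor_eq tensor_add[OF single_closed single_closed]
  by (intro tcl_eqI subsetD[OF bilinear_relations_null] single_add_closed single_closed)
    (auto simp: bilinear_relations_def diff_diff_add[symmetric])

lemma tcl_single_left: "\<lbrakk>x \<in> carrier M; y \<in> carrier N\<rbrakk> \<Longrightarrow>
    tcl (Poly_Mapping.single (x, y) c) = pure_tensor M N (c \<odot>\<^bsub>M\<^esub> x) y"
  unfolding pure_tensor_eq using M.smult_closed[of c x]
  by (intro tcl_eqI[symmetric] subsetD[OF bilinear_relations_null] single_closed)
    (auto simp: bilinear_relations_def)

lemma tcl_single_right: "\<lbrakk>x \<in> carrier M; y \<in> carrier N\<rbrakk> \<Longrightarrow>
    tcl (Poly_Mapping.single (x, y) c) = pure_tensor M N x (c \<odot>\<^bsub>N\<^esub> y)"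
  unfolding pure_tensor_eq using N.smult_closed[of c y]
  by (intro tcl_eqI[symmetric] subsetD[OF bilinear_relations_null] single_closed)
    (auto simp: bilinear_relations_def)

lemma pure_tensor_smult_left: "\<lbrakk>x \<in> carrier M; y \<in> carrier N\<rbrakk> \<Longrightarrow>
    pure_tensor M N (c \<odot>\<^bsub>M\<^esub> x) y = c \<odot>\<^bsub>tensor M N\<^esub> pure_tensor M N x y"
  unfolding pure_tensor_eq by (subst tensor_smult) (auto simp: tcl_single_left pure_tensor_eq[symmetric])

lemma pure_tensor_smult_right: "\<lbrakk>x \<in> carrier M; y \<in> carrier N\<rbrakk> \<Longrightarrow>
    pure_tensor M N x (c \<odot>\<^bsub>N\<^esub> y) = c \<odot>\<^bsub>tensor M N\<^esub> pure_tensor M N x y"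
  unfolding pure_tensor_eq by (subst tensor_smult) (auto simp: tcl_single_right pure_tensor_eq[symmetric])

section \<open>Finite sums of pure tensors\<close>

definition tsum :: "nat \<Rightarrow> (nat \<Rightarrow> 'x) \<Rightarrow> (nat \<Rightarrow> 'y) \<Rightarrow> ('x \<times> 'y \<Rightarrow>\<^sub>0 complex) set"
  where "tsum n a v = (\<Oplus>\<^bsub>tensor M N\<^esub>i\<in>{..<n}. pure_tensor M N (a i) (v i))"

lemma tsum_cong: "\<lbrakk>\<And>i. i < n \<Longrightarrow> a i = b i; \<And>i. i < n \<Longrightarrow> v i = w i; b \<in> {..<n} \<rightarrow> carrier M; w \<in> {..<n} \<rightarrow> carrier N\<rbrakk>
    \<Longrightarrow> tsum n a v = tsum n b w"
  unfolding tsum_def by (intro T.finsum_cong') auto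

lemma tsum_0 [simp]: "tsum 0 a v = \<zero>\<^bsub>tensor M N\<^esub>"
  by (simp add: tsum_def)

lemma tsum_Suc: "\<lbrakk>a \<in> {..<Suc n} \<rightarrow> carrier M; v \<in> {..<Suc n} \<rightarrow> carrier N\<rbrakk> \<Longrightarrow>
    tsum (Suc n) a v = tsum n a v \<oplus>\<^bsub>tensor M N\<^esub> pure_tensor M N (a n) (v n)"
  unfolding tsum_def lessThan_Suc
  by (subst T.finsum_insert) (auto simp: Pi_iff intro!: T.M.a_comm T.finsum_closed)

lemma tsum_closed: "\<lbrakk>a \<in> {..<n} \<rightarrow> carrier M; v \<in> {..<n} \<rightarrow> carrier N\<rbrakk> \<Longrightarrow> tsum n a v \<in> carrier (tensor M N)"
  unfolding tsum_def by (intro T.finsum_closed) (auto simp: Pi_iff)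

lemma tsum_1: "a 0 \<in> carrier M \<Longrightarrow> v 0 \<in> carrier N \<Longrightarrow> tsum 1 a v = pure_tensor M N (a 0) (v 0)"
  using tsum_Suc[of a 0 v] by simp

lemma tsum_add:
  assumes "a \<in> {..<n} \<rightarrow> carrier M" "v \<in> {..<n} \<rightarrow> carrier N" "b \<in> {..<m} \<rightarrow> carrier M" "w \<in> {..<m} \<rightarrow> carrier N"
  shows "tsum (n + m) (cat n a b) (cat n v w) = tsum n a v \<oplus>\<^bsub>tensor M N\<^esub> tsum m b w"
  using assms(3,4)
proof (induction m)
  case 0
  then show ?case using assms tsum_cong[of n "cat n a b" a "cat n v w" v] by (simp add: tsum_closed)
next
  case (Suc m)
  then have *: "b \<in> {..<m} \<rightarrow> carrier M" "w \<in> {..<m} \<rightarrow> carrier N" "b m \<in> carrier M" "w m \<in> carrier N"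
    by auto
  show ?case
    using * assms(1,2) Suc cat_closed[OF assms(1) Suc.prems(1)] cat_closed[OF assms(2) Suc.prems(2)]
    by (simp add: tsum_Suc T.M.a_assoc tsum_closed)
qed

lemma tsum_smult:
  assumes "a \<in> {..<n} \<rightarrow> carrier M" "v \<in> {..<n} \<rightarrow> carrier N"
  shows "tsum n (\<lambda>i. c \<odot>\<^bsub>M\<^esub> a i) v = c \<odot>\<^bsub>tensor M N\<^esub> tsum n a v"
  using assms
proof (induction n)
  case (Suc n)
  then have *: "a \<in> {..<n} \<rightarrow> carrier M" "v \<in> {..<n} \<rightarrow> carrier N" "a n \<in> carrier M" "v n \<in> carrier N"
    by auto
  have "(\<lambda>i. c \<odot>\<^bsub>M\<^esub> a i) \<in> {..<Suc n} \<rightarrow> carrier M"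
    using Suc by auto
  then show ?case
    using Suc * by (simp add: tsum_Suc pure_tensor_smult_left T.smult_r_distr tsum_closed)
qed simp

text \<open>A representative in the free space is a finite combination of basis pairs, and each
  coefficient is absorbed into the left factor. The induction runs over arbitrary finite sets of
  pairs with the coefficients of f held fixed.\<close>

lemma tensor_tsumE:
  assumes "z \<in> carrier (tensor M N)"
  obtains n a v where "a \<in> {..<n} \<rightarrow> carrier M" "v \<in> {..<n} \<rightarrow> carrier N" "z = tsum n a v"
proof -
  obtain f where f: "f \<in> carrier Fr" "z = tcl f" using assms by (auto simp: tensor_carrier)
  have "\<exists>n a v. a \<in> {..<n} \<rightarrow> carrier M \<and> v \<in> {..<n} \<rightarrow> carrier N \<and>
      tcl (\<Sum>p\<in>F. Poly_Mapping.single p (Poly_Mapping.lookup f p)) = tsum n a v \<and>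
      (\<Sum>p\<in>F. Poly_Mapping.single p (Poly_Mapping.lookup f p)) \<in> carrier Fr"
    if "finite F" "F \<subseteq> carrier M \<times> carrier N" for F
    using that
  proof (induction F rule: finite_induct)
    case empty
    show ?case by (rule exI[of _ 0]) (auto simp: tensor_zero)
  next
    case (insert p F)
    then obtain n a v where IH: "a \<in> {..<n} \<rightarrow> carrier M" "v \<in> {..<n} \<rightarrow> carrier N"
      "tcl (\<Sum>p\<in>F. Poly_Mapping.single p (Poly_Mapping.lookup f p)) = tsum n a v"
      "(\<Sum>p\<in>F. Poly_Mapping.single p (Poly_Mapping.lookup f p)) \<in> carrier Fr" by auto
    obtain x y where p: "p = (x, y)" "x \<in> carrier M" "y \<in> carrier N" using insert.prems by auto
    let ?c = "Poly_Mapping.lookup f p"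
    \<comment> \<open>\<open>tsum n\<close> reads only positions below n, so position n is free for
      the new summand.\<close>
    let ?a = "a(n := ?c \<odot>\<^bsub>M\<^esub> x)" and ?v = "v(n := y)"
    have cl: "?a \<in> {..<Suc n} \<rightarrow> carrier M" "?v \<in> {..<Suc n} \<rightarrow> carrier N"
      using IH(1,2) p by (auto simp: Pi_iff less_Suc_eq)
    have "tsum (Suc n) ?a ?v = tsum n a v \<oplus>\<^bsub>tensor M N\<^esub> tcl (Poly_Mapping.single p ?c)"
      unfolding tsum_Suc[OF cl] using p IH(1,2) tsum_cong[of n ?a a ?v v] by (simp add: tcl_single_left)
    also have "\<dots> = tcl (Poly_Mapping.single p ?c) \<oplus>\<^bsub>tensor M N\<^esub> tsum n a v"
      using p IH(1,2) by (intro T.M.a_comm tsum_closed) (auto simp: tensor_carrier)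
    also have "\<dots> = tcl (Poly_Mapping.single p ?c + (\<Sum>p\<in>F. Poly_Mapping.single p (Poly_Mapping.lookup f p)))"
      unfolding IH(3)[symmetric] using p IH(4) by (intro tensor_add) auto
    finally have "tcl (\<Sum>p\<in>insert p F. Poly_Mapping.single p (Poly_Mapping.lookup f p)) = tsum (Suc n) ?a ?v"
      using insert.hyps by simp
    moreover have "(\<Sum>p\<in>insert p F. Poly_Mapping.single p (Poly_Mapping.lookup f p)) \<in> carrier Fr"
      using single_add_closed[OF _ IH(4), of "Poly_Mapping.single p ?c"] insert.hyps p by simp
    ultimately show ?case using cl by blast
  qed
  from this[of "Poly_Mapping.keys f"] show ?thesis
    using f that by (auto simp flip: poly_mapping_sum_single)
qed

text \<open>Lifts sums of pure tensors to the free space, where an equality of two of them becomes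
  membership of a difference in \<open>tensor_null\<close>. Closure is carried along because the
  induction step adds cosets.\<close>

lemma tsum_tcl:
  assumes "a \<in> {..<n} \<rightarrow> carrier M" "v \<in> {..<n} \<rightarrow> carrier N"
  shows "tsum n a v = tcl (\<Sum>i<n. Poly_Mapping.single (a i, v i) 1) \<and>
    (\<Sum>i<n. Poly_Mapping.single (a i, v i) 1) \<in> carrier Fr"
  using assms
proof (induction n)
  case (Suc n)
  then have *: "a \<in> {..<n} \<rightarrow> carrier M" "v \<in> {..<n} \<rightarrow> carrier N" "a n \<in> carrier M" "v n \<in> carrier N"
    by auto
  note IH = Suc.IH[OF *(1,2)]
  have "Poly_Mapping.single (a n, v n) 1 \<in> carrier Fr" using * by simp
  then show ?case
    using IH by (simp only: tsum_Suc[OF Suc.prems] pure_tensor_eq tensor_add single_add_closed sum.lessThan_Suc)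
qed (simp add: tensor_zero)

end

section \<open>Universal property of the tensor product\<close>

context bilinear_functional begin

sublocale tensor_product M N ..

text \<open>\<open>tensor_null\<close> is the smallest submodule that contains the bilinear
  relations, and the kernel of the extended functional is one such submodule.\<close>

lemma lin_ext_null:
  assumes "f \<in> tensor_null M N"
  shows "lin_ext (\<lambda>(x, y). g x y) f = 0"
proof -
  let ?U = "{f \<in> carrier Fr. lin_ext (\<lambda>(x, y). g x y) f = 0}"
  have "submodule ?U complex_ring Fr"
  proof (rule free.submoduleI)
    fix f assume f: "f \<in> ?U"
    then have "\<ominus>\<^bsub>Fr\<^esub> f = 0 - f"
      using free_space_minus[of 0 "carrier M \<times> carrier N" f] by (simp add: a_minus_def free.M.a_inv_closed)
    then show "\<ominus>\<^bsub>Fr\<^esub> f \<in> ?U"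
      using f free.M.a_inv_closed[of f] lin_ext_diff[of _ 0 f] by simp
  next
    fix f h assume "f \<in> ?U" "h \<in> ?U"
    then show "f \<oplus>\<^bsub>Fr\<^esub> h \<in> ?U"
      using free.M.a_closed[of f h] by (simp add: lin_ext_add)
  next
    fix c f assume "f \<in> ?U"
    then show "c \<odot>\<^bsub>Fr\<^esub> f \<in> ?U"
      using free.smult_closed[of c f] by (simp add: lin_ext_map_times)
  qed auto
  moreover have "bilinear_relations M N \<subseteq> ?U"
  proof
    fix r assume r: "r \<in> bilinear_relations M N"
    then have "lin_ext (\<lambda>(x, y). g x y) r = 0"
      by (auto simp: bilinear_relations_def lin_ext_diff g_add_left g_add_right g_smult_left g_smult_right)
    then show "r \<in> ?U" using r bilinear_relations_subset by auto
  qed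
  ultimately show ?thesis using assms unfolding tensor_null_def by blast
qed

text \<open>The universal property in the form needed for well-definedness: two representations of
  one tensor have free lifts that differ by an element of \<open>tensor_null\<close>, on which the
  functional vanishes.\<close>

lemma tsum_functional:
  assumes "a \<in> {..<n} \<rightarrow> carrier M" "v \<in> {..<n} \<rightarrow> carrier N" "b \<in> {..<m} \<rightarrow> carrier M" "w \<in> {..<m} \<rightarrow> carrier N"
    and "tsum n a v = tsum m b w"
  shows "(\<Sum>i<n. g (a i) (v i)) = (\<Sum>i<m. g (b i) (w i))"
proof -
  let ?f = "\<Sum>i<n. Poly_Mapping.single (a i, v i) 1" and ?h = "\<Sum>i<m. Poly_Mapping.single (b i, w i) 1"
  have c: "?f \<in> carrier Fr" "?h \<in> carrier Fr" and "tcl ?f = tcl ?h"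
    using tsum_tcl[OF assms(1,2)] tsum_tcl[OF assms(3,4)] assms(5) by auto
  then have "?f - ?h \<in> tensor_null M N"
    using quot.quot_eq_iff[OF c(2,1)] free_space_minus[OF c] by simp
  from lin_ext_null[OF this] show ?thesis
    by (simp add: lin_ext_diff lin_ext_sum)
qed

end

section \<open>Bounded operators and adjoints\<close>

lemma bounded_opsD:
  assumes "T \<in> bounded_ops H K"
  shows bounded_ops_closed: "x \<in> carrier H \<Longrightarrow> T x \<in> carrier K"
    and bounded_ops_add: "x \<in> carrier H \<Longrightarrow> y \<in> carrier H \<Longrightarrow> T (x \<oplus>\<^bsub>H\<^esub> y) = T x \<oplus>\<^bsub>K\<^esub> T y"
    and bounded_ops_smult: "x \<in> carrier H \<Longrightarrow> T (c \<odot>\<^bsub>H\<^esub> x) = c \<odot>\<^bsub>K\<^esub> T x"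
    and bounded_ops_extensional: "T \<in> extensional (carrier H)"
  using assms by (auto simp: bounded_ops_def PiE_def)

lemma bounded_ops_bound:
  assumes "T \<in> bounded_ops H K" "semi_inner_space H"
  obtains B where "B \<ge> 0" "\<And>x. x \<in> carrier H \<Longrightarrow> hnorm K (T x) \<le> B * hnorm H x"
proof -
  interpret H: semi_inner_space H by fact
  obtain B where B: "\<And>x. x \<in> carrier H \<Longrightarrow> hnorm K (T x) \<le> B * hnorm H x"
    using assms(1) unfolding bounded_ops_def by blast
  \<comment> \<open>\<open>bounded_ops\<close> asks for some real constant, possibly negative; the
    absolute value makes it usable as a monotone factor.\<close>
  have "hnorm K (T x) \<le> \<bar>B\<bar> * hnorm H x" if "x \<in> carrier H" for x
    using B[OF that] H.hnorm_nonneg[OF that] by (meson abs_ge_self mult_right_mono order_trans)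
  then show ?thesis using that[of "\<bar>B\<bar>"] by simp
qed

lemma bounded_opsI:
  assumes "T \<in> extensional (carrier H)" "\<And>x. x \<in> carrier H \<Longrightarrow> T x \<in> carrier K"
    "\<And>x y. x \<in> carrier H \<Longrightarrow> y \<in> carrier H \<Longrightarrow> T (x \<oplus>\<^bsub>H\<^esub> y) = T x \<oplus>\<^bsub>K\<^esub> T y"
    "\<And>c x. x \<in> carrier H \<Longrightarrow> T (c \<odot>\<^bsub>H\<^esub> x) = c \<odot>\<^bsub>K\<^esub> T x"
    "\<And>x. x \<in> carrier H \<Longrightarrow> hnorm K (T x) \<le> B * hnorm H x"
  shows "T \<in> bounded_ops H K"
  using assms unfolding bounded_ops_def PiE_def by blast

lemma bounded_ops_eqI:
  assumes "S \<in> bounded_ops H K" "T \<in> bounded_ops H K" "\<And>x. x \<in> carrier H \<Longrightarrow> S x = T x"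
  shows "S = T"
  using assms bounded_ops_extensional by (metis extensionalityI)

lemma bounded_ops_compose:
  assumes T: "T \<in> bounded_ops H K" and S: "S \<in> bounded_ops K L"
    and H: "semi_inner_space H" and K: "semi_inner_space K"
  shows "compose (carrier H) S T \<in> bounded_ops H L"
proof -
  interpret H: semi_inner_space H by fact
  obtain B where B: "B \<ge> 0" "\<And>x. x \<in> carrier H \<Longrightarrow> hnorm K (T x) \<le> B * hnorm H x"
    using bounded_ops_bound[OF T H] by blast
  obtain C where C: "C \<ge> 0" "\<And>x. x \<in> carrier K \<Longrightarrow> hnorm L (S x) \<le> C * hnorm K x"
    using bounded_ops_bound[OF S K] by blast
  show ?thesis
  proof (rule bounded_opsI[of _ _ _ "C * B"])
    fix x assume x: "x \<in> carrier H"
    have "hnorm L (S (T x)) \<le> C * hnorm K (T x)"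
      using C bounded_ops_closed[OF T x] by blast
    also have "\<dots> \<le> C * (B * hnorm H x)" using B x C by (intro mult_left_mono) auto
    finally show "hnorm L (compose (carrier H) S T x) \<le> C * B * hnorm H x"
      using x by (simp add: compose_def mult.assoc)
  qed (auto simp: compose_def bounded_opsD[OF T] bounded_opsD[OF S])
qed

context semi_inner_space begin

lemma bounded_ops_zero: "T \<in> bounded_ops H K \<Longrightarrow> semi_inner_space K \<Longrightarrow> T \<zero> = \<zero>\<^bsub>K\<^esub>"
proof -
  assume T: "T \<in> bounded_ops H K" and "semi_inner_space K"
  interpret K: semi_inner_space K by fact
  show ?thesis using bounded_ops_smult[OF T M.zero_closed, of 0] bounded_ops_closed[OF T M.zero_closed]
      smult_r_null[of 0] K.smult_l_null by simp
qed

lemma bounded_ops_diff: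
  assumes T: "T \<in> bounded_ops H K" and K: "semi_inner_space K" and x: "x \<in> carrier H" and y: "y \<in> carrier H"
  shows "T (x \<ominus>\<^bsub>H\<^esub> y) = T x \<ominus>\<^bsub>K\<^esub> T y"
proof -
  interpret K: semi_inner_space K by fact
  have "T (x \<oplus>\<^bsub>H\<^esub> (- 1) \<odot>\<^bsub>H\<^esub> y) = T x \<oplus>\<^bsub>K\<^esub> (- 1) \<odot>\<^bsub>K\<^esub> T y"
    using x y by (simp add: bounded_opsD[OF T])
  then show ?thesis
    using x y by (simp add: a_minus_def uminus_eq_smult K.uminus_eq_smult bounded_ops_closed[OF T])
qed

lemma bounded_ops_finsum:
  assumes T: "T \<in> bounded_ops H K" and "semi_inner_space K" and "finite F" "f \<in> F \<rightarrow> carrier H"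
  shows "T (\<Oplus>i\<in>F. f i) = (\<Oplus>\<^bsub>K\<^esub>i\<in>F. T (f i))"
proof -
  interpret K: semi_inner_space K by fact
  show ?thesis
    by (rule finsum_image) (use assms bounded_ops_zero bounded_opsD[OF T] K.M.abelian_group_axioms in auto)
qed

end

section \<open>Limits in Hilbert space and the Riesz representation theorem\<close>

context hilbert_space begin

lemma Cauchy_seq_limit:
  assumes "Cauchy_seq s"
  obtains x where "x \<in> carrier H" "(\<lambda>n. hnorm H (s n \<ominus> x)) \<longlonglongrightarrow> 0"
  using complete assms unfolding mcomplete_iff by blast

lemma inprod_tendsto:
  assumes "\<And>n. s n \<in> carrier H" "x \<in> carrier H" "(\<lambda>n. hnorm H (s n \<ominus> x)) \<longlonglongrightarrow> 0" "w \<in> carrier H"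
  shows "(\<lambda>n. inprod H (s n) w) \<longlonglongrightarrow> inprod H x w"
proof (rule Lim_null[THEN iffD2], rule Lim_null_comparison)
  show "\<forall>\<^sub>F n in sequentially. norm (inprod H (s n) w - inprod H x w) \<le> hnorm H (s n \<ominus> x) * hnorm H w"
    using assms Cauchy_Schwarz[of "s _ \<ominus> x" w] by (auto simp: inprod_diff_left[symmetric] intro!: always_eventually Cauchy_Schwarz)
  show "(\<lambda>n. hnorm H (s n \<ominus> x) * hnorm H w) \<longlonglongrightarrow> 0"
    using tendsto_mult_right[OF assms(3), of "hnorm H w"] by simp
qed

text \<open>The functional \<open>f\<close> is represented by the minimiser of \<open>\<parallel>x\<parallel>\<^sup>2 - 2 Re (f x)\<close>; the parallelogram law makes every
  minimising sequence Cauchy.\<close>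

theorem Riesz_representation:
  fixes f :: "'a \<Rightarrow> complex"
  assumes add: "\<And>x y. x \<in> carrier H \<Longrightarrow> y \<in> carrier H \<Longrightarrow> f (x \<oplus> y) = f x + f y"
    and smult: "\<And>c x. x \<in> carrier H \<Longrightarrow> f (c \<odot>\<^bsub>H\<^esub> x) = c * f x"
    and bound: "\<And>x. x \<in> carrier H \<Longrightarrow> cmod (f x) \<le> B * hnorm H x"
  obtains z where "z \<in> carrier H" "\<And>x. x \<in> carrier H \<Longrightarrow> f x = inprod H z x"
proof -
  define F where "F x = (hnorm H x)\<^sup>2 - 2 * Re (f x)" for x
  have "- B\<^sup>2 \<le> F x" if "x \<in> carrier H" for x
  proof -
    have "Re (f x) \<le> B * hnorm H x"
      using bound[OF that] complex_Re_le_cmod[of "f x"] by linarith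
    moreover have "0 \<le> (hnorm H x - B)\<^sup>2" by simp
    ultimately show ?thesis
      by (simp add: F_def power2_diff mult.commute[of B])
  qed
  then have bdd: "bdd_below (F ` carrier H)" by (intro bdd_belowI2)
  define d where "d = Inf (F ` carrier H)"
  have d: "d \<le> F x" if "x \<in> carrier H" for x
    unfolding d_def using bdd that by (intro cInf_lower) auto
  have "\<exists>x\<in>carrier H. F x < d + e" if "e > 0" for e
    using cInf_lessD[of "F ` carrier H" "d + e"] that by (auto simp: d_def)
  then have "\<forall>n. \<exists>x. x \<in> carrier H \<and> F x < d + 1 / real (Suc n)"
    by (metis of_nat_0_less_iff zero_less_Suc zero_less_divide_1_iff)
  then obtain s where s: "\<And>n. s n \<in> carrier H" and Fs: "\<And>n. F (s n) < d + 1 / real (Suc n)"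
    by metis
  \<comment> \<open>The expansion of F along a line. The parameters 1 and 1/2 give the parallelogram
    estimate, and small parameters give the first-order condition at the minimum.\<close>
  have shift: "F (x \<oplus> t \<odot>\<^bsub>H\<^esub> w) = F x + 2 * Re (t * (inprod H x w - f w)) + (cmod t)\<^sup>2 * (hnorm H w)\<^sup>2"
    if "x \<in> carrier H" "w \<in> carrier H" for x w t
    using that by (simp add: F_def hnorm_add_power2 inprod_smult_right hnorm_smult power_mult_distrib add smult algebra_simps)
  \<comment> \<open>With w = x - y, compare F at y, at x = y + w and at the midpoint y + w/2, where
    F is still at least d.\<close>
  have par: "(hnorm H (x \<ominus> y))\<^sup>2 \<le> 2 * (F x + F y - 2 * d)" if xy: "x \<in> carrier H" "y \<in> carrier H" for x y
  proof -
    let ?w = "x \<ominus> y"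
    have x: "x = y \<oplus> 1 \<odot>\<^bsub>H\<^esub> ?w"
      using xy by (simp add: a_minus_def M.a_ac M.r_neg)
    have "F x = F y + 2 * Re (inprod H y ?w - f ?w) + (hnorm H ?w)\<^sup>2"
      by (subst x, subst shift) (use xy in auto)
    moreover have "F (y \<oplus> (1/2) \<odot>\<^bsub>H\<^esub> ?w) = F y + Re (inprod H y ?w - f ?w) + (hnorm H ?w)\<^sup>2 / 4"
      by (subst shift) (use xy in \<open>auto simp: norm_divide power_divide\<close>)
    moreover have "d \<le> F (y \<oplus> (1/2) \<odot>\<^bsub>H\<^esub> ?w)" using xy by (intro d) auto
    ultimately show ?thesis by simp
  qed
  have "Cauchy_seq s"
    unfolding Cauchy_seq_def
  proof (intro conjI allI impI)
    fix e :: real assume e: "e > 0"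
    \<comment> \<open>From N on, each value F (s n) is within e^2 / 4 of d, and \<open>par\<close>
      then bounds the squared distance by e^2.\<close>
    obtain N :: nat where N: "4 / e\<^sup>2 < N" using reals_Archimedean2 by blast
    have N': "1 / real (Suc n) < e\<^sup>2 / 4" if "n \<ge> N" for n
    proof -
      have "4 / e\<^sup>2 < real (Suc n)" using N that by linarith
      then show ?thesis using e by (simp add: field_simps)
    qed
    show "\<exists>N. \<forall>m\<ge>N. \<forall>n\<ge>N. hnorm H (s m \<ominus> s n) < e"
    proof (intro exI[of _ N] allI impI)
      fix m n assume mn: "N \<le> m" "N \<le> n"
      have "(hnorm H (s m \<ominus> s n))\<^sup>2 < e\<^sup>2"
        using par[OF s s, of m n] less_trans[OF Fs add_strict_left_mono[OF N'[OF mn(1)]]]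
          less_trans[OF Fs add_strict_left_mono[OF N'[OF mn(2)]]] by argo
      then show "hnorm H (s m \<ominus> s n) < e" using e by (simp add: power_less_imp_less_base)
    qed
  qed (use s in auto)
  then obtain z where z: "z \<in> carrier H" and lim: "(\<lambda>n. hnorm H (s n \<ominus> z)) \<longlonglongrightarrow> 0"
    by (rule Cauchy_seq_limit)
  have "f w = inprod H z w" if w: "w \<in> carrier H" for w
  proof -
    define c where "c = inprod H z w - f w"
    have *: "0 \<le> 2 * Re (t * c) + (cmod t)\<^sup>2 * (hnorm H w)\<^sup>2" for t
    proof -
      have l1: "(\<lambda>n. 2 * Re (t * (inprod H (s n) w - f w)) + (cmod t)\<^sup>2 * (hnorm H w)\<^sup>2) \<longlonglongrightarrow>
          2 * Re (t * c) + (cmod t)\<^sup>2 * (hnorm H w)\<^sup>2"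
        unfolding c_def by (intro tendsto_intros inprod_tendsto s z lim w)
      have "(\<lambda>n. - (1 / real (Suc n))) \<longlonglongrightarrow> 0"
        using tendsto_minus[OF LIMSEQ_inverse_real_of_nat] by (simp add: inverse_eq_divide)
      moreover have "- (1 / real (Suc n)) \<le> 2 * Re (t * (inprod H (s n) w - f w)) + (cmod t)\<^sup>2 * (hnorm H w)\<^sup>2" for n
        using shift[OF s w, of n t] Fs[of n] d[of "s n \<oplus> t \<odot>\<^bsub>H\<^esub> w"] s w by simp
      ultimately show ?thesis using l1 by (intro LIMSEQ_le[OF _ l1]) auto
    qed
    define q where "q = (hnorm H w)\<^sup>2"
    have q: "q \<ge> 0" by (simp add: q_def)
    \<comment> \<open>The parameter -r times the conjugate of c turns the inequality into 0 \<le> r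
      (cmod c)^2 (r q - 2). This r has r q < 1, also when q = 0, and so forces c = 0.\<close>
    define r where "r = 1 / (q + 1)"
    have r: "r > 0" "r * q < 1" using q by (auto simp: r_def field_simps)
    have t1: "(- of_real r * cnj c) * c = of_real (- r * (cmod c)\<^sup>2)"
      by (simp only: of_real_mult of_real_minus complex_norm_square) (simp add: mult_ac)
    have t2: "(cmod (- of_real r * cnj c))\<^sup>2 = r\<^sup>2 * (cmod c)\<^sup>2"
      by (simp add: norm_mult power_mult_distrib)
    have "0 \<le> 2 * (- r * (cmod c)\<^sup>2) + r\<^sup>2 * (cmod c)\<^sup>2 * q"
      using *[of "- of_real r * cnj c"] unfolding t1 t2 q_def Re_complex_of_real .
    also have "\<dots> = r * (cmod c)\<^sup>2 * (r * q - 2)" by (simp add: algebra_simps power2_eq_square)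
    finally have "c = 0" using r by (auto simp: zero_le_mult_iff mult_le_0_iff)
    then show ?thesis by (simp add: c_def)
  qed
  then show ?thesis using that z by blast
qed

end

text \<open>For fixed y the functional sending x to the inner product of y with T x is bounded, and
  Riesz represents it by the value of the adjoint at y. Since \<open>adjoint_op\<close> is a
  \<open>THE\<close>, uniqueness among extensional operators is part of the proof.\<close>

lemma adjoint_exists:
  assumes "hilbert_space H" "inner_product_space K" and T: "T \<in> bounded_ops H K"
  shows adjoint_op_bounded: "adjoint_op H K T \<in> bounded_ops K H"
    and adjoint_op_inprod: "\<lbrakk>x \<in> carrier H; y \<in> carrier K\<rbrakk> \<Longrightarrow> inprod K (T x) y = inprod H x (adjoint_op H K T y)"
proof -
  interpret H: hilbert_space H by fact
  interpret K: inner_product_space K by fact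
  obtain B where B: "B \<ge> 0" "\<And>x. x \<in> carrier H \<Longrightarrow> hnorm K (T x) \<le> B * hnorm H x"
    using bounded_ops_bound[OF T] H.semi_inner_space_axioms by blast
  note Tcl [simp] = bounded_ops_closed[OF T]
  have "\<exists>z\<in>carrier H. \<forall>x\<in>carrier H. inprod K (T x) y = inprod H x z" if y: "y \<in> carrier K" for y
  proof -
    obtain z where z: "z \<in> carrier H" "\<And>x. x \<in> carrier H \<Longrightarrow> inprod K y (T x) = inprod H z x"
    proof (rule H.Riesz_representation[of "\<lambda>x. inprod K y (T x)" "hnorm K y * B"])
      fix x assume x: "x \<in> carrier H"
      have "cmod (inprod K y (T x)) \<le> hnorm K y * hnorm K (T x)"
        using x y by (intro K.Cauchy_Schwarz) auto
      also have "\<dots> \<le> hnorm K y * (B * hnorm H x)"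
        using x y B by (intro mult_left_mono) auto
      finally show "cmod (inprod K y (T x)) \<le> hnorm K y * B * hnorm H x" by (simp add: mult.assoc)
    qed (use y in \<open>auto simp: bounded_ops_add[OF T] bounded_ops_smult[OF T] K.inprod_add_right K.inprod_smult_right\<close>)
    have "inprod K (T x) y = inprod H x z" if x: "x \<in> carrier H" for x
      using z(2)[OF x] K.inprod_cnj[OF y Tcl[OF x]] H.inprod_cnj[OF z(1) x] by simp
    then show ?thesis using z(1) by blast
  qed
  then obtain S0 where S0: "\<And>y. y \<in> carrier K \<Longrightarrow> S0 y \<in> carrier H"
    "\<And>x y. x \<in> carrier H \<Longrightarrow> y \<in> carrier K \<Longrightarrow> inprod K (T x) y = inprod H x (S0 y)"
    by metis
  define S where "S = restrict S0 (carrier K)"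
  have S [simp]: "\<And>y. y \<in> carrier K \<Longrightarrow> S y \<in> carrier H"
    and ST: "\<And>x y. x \<in> carrier H \<Longrightarrow> y \<in> carrier K \<Longrightarrow> inprod K (T x) y = inprod H x (S y)"
    using S0 by (simp_all add: S_def)
  have Sb: "S \<in> bounded_ops K H"
  proof (rule bounded_opsI[where B = B])
    fix x y assume "x \<in> carrier K" "y \<in> carrier K"
    then show "S (x \<oplus>\<^bsub>K\<^esub> y) = S x \<oplus>\<^bsub>H\<^esub> S y"
      by (intro H.inprod_eqI) (auto simp: ST[symmetric] H.inprod_add_right K.inprod_add_right)
  next
    fix c x assume "x \<in> carrier K"
    then show "S (c \<odot>\<^bsub>K\<^esub> x) = c \<odot>\<^bsub>H\<^esub> S x"
      by (intro H.inprod_eqI) (auto simp: ST[symmetric] H.inprod_smult_right K.inprod_smult_right)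
  next
    fix y assume y: "y \<in> carrier K"
    \<comment> \<open>Testing the adjoint relation at x = S y bounds the square of the norm of S y
      by B times the norms of S y and y; one factor is then cancelled unless it is zero.\<close>
    have "(hnorm H (S y))\<^sup>2 = Re (inprod K (T (S y)) y)"
      using y by (simp add: H.hnorm_power2 ST)
    also have "\<dots> \<le> hnorm K (T (S y)) * hnorm K y"
      using K.Cauchy_Schwarz[of "T (S y)" y] complex_Re_le_cmod[of "inprod K (T (S y)) y"] y by simp
    also have "\<dots> \<le> B * hnorm H (S y) * hnorm K y"
      using B y by (intro mult_right_mono) auto
    finally have "hnorm H (S y) * hnorm H (S y) \<le> hnorm H (S y) * (B * hnorm K y)"
      by (simp add: power2_eq_square mult_ac)
    then show "hnorm H (S y) \<le> B * hnorm K y"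
      using B y by (cases "hnorm H (S y) = 0")
        (simp, metis H.hnorm_nonneg S less_eq_real_def mult_le_cancel_left_pos)
  qed (auto simp: S_def S0)
  have "adjoint_op H K T = S"
    unfolding adjoint_op_def
  proof (rule the_equality)
    fix S' assume S': "S' \<in> bounded_ops K H \<and> (\<forall>x\<in>carrier H. \<forall>y\<in>carrier K. inprod K (T x) y = inprod H x (S' y))"
    show "S' = S"
    proof (rule bounded_ops_eqI)
      fix y assume y: "y \<in> carrier K"
      show "S' y = S y"
        using S' y by (intro H.inprod_eqI) (auto intro: bounded_ops_closed simp: ST[symmetric])
    qed (use S' Sb in auto)
  qed (use Sb ST in auto)
  then show "adjoint_op H K T \<in> bounded_ops K H"
    "\<lbrakk>x \<in> carrier H; y \<in> carrier K\<rbrakk> \<Longrightarrow> inprod K (T x) y = inprod H x (adjoint_op H K T y)"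
    using Sb ST by auto
qed

section \<open>The algebra of bounded operators\<close>

lemma op_algebra_sel [simp]:
  "carrier (op_algebra H) = bounded_ops H H"
  "S \<otimes>\<^bsub>op_algebra H\<^esub> T = compose (carrier H) S T"
  "\<one>\<^bsub>op_algebra H\<^esub> = (\<lambda>x\<in>carrier H. x)"
  "\<zero>\<^bsub>op_algebra H\<^esub> = (\<lambda>x\<in>carrier H. \<zero>\<^bsub>H\<^esub>)"
  "S \<oplus>\<^bsub>op_algebra H\<^esub> T = (\<lambda>x\<in>carrier H. S x \<oplus>\<^bsub>H\<^esub> T x)"
  "c \<odot>\<^bsub>op_algebra H\<^esub> T = (\<lambda>x\<in>carrier H. c \<odot>\<^bsub>H\<^esub> T x)"
  "star (op_algebra H) T = adjoint_op H H T"
  by (simp_all add: op_algebra_def)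

lemma bounded_ops_smult_closed:
  assumes "inner_product_space H" and T: "T \<in> bounded_ops H H"
  shows "(\<lambda>x\<in>carrier H. c \<odot>\<^bsub>H\<^esub> T x) \<in> bounded_ops H H"
proof -
  interpret inner_product_space H by fact
  obtain B where B: "B \<ge> 0" "\<And>x. x \<in> carrier H \<Longrightarrow> hnorm H (T x) \<le> B * hnorm H x"
    using bounded_ops_bound[OF T semi_inner_space_axioms] by blast
  note [simp] = bounded_opsD[OF T]
  show ?thesis
  proof (rule bounded_opsI[where B = "cmod c * B"])
    fix x assume x: "x \<in> carrier H"
    have "cmod c * hnorm H (T x) \<le> cmod c * (B * hnorm H x)"
      using B(2)[OF x] by (intro mult_left_mono) auto
    then show "hnorm H ((\<lambda>x\<in>carrier H. c \<odot>\<^bsub>H\<^esub> T x) x) \<le> cmod c * B * hnorm H x"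
      using x by (simp add: hnorm_smult mult.assoc)
  next
    fix d x assume "x \<in> carrier H"
    then show "(\<lambda>x\<in>carrier H. c \<odot>\<^bsub>H\<^esub> T x) (d \<odot>\<^bsub>H\<^esub> x) = d \<odot>\<^bsub>H\<^esub> (\<lambda>x\<in>carrier H. c \<odot>\<^bsub>H\<^esub> T x) x"
      using smult_assoc1[of c d "T x"] smult_assoc1[of d c "T x"] by (simp add: mult.commute)
  qed (auto simp: smult_r_distr)
qed

lemma bounded_ops_id: "(\<lambda>x\<in>carrier H. x) \<in> bounded_ops H H" if "semi_inner_space H"
proof -
  interpret semi_inner_space H by fact
  show ?thesis by (rule bounded_opsI[where B = 1]) auto
qed

text \<open>The finite sums in \<open>mat_positive\<close> over \<open>op_algebra\<close> are formed
  in this monoid, which is what allows them to be evaluated at a vector.\<close>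

lemma abelian_monoid_op_algebra:
  assumes "inner_product_space H"
  shows "abelian_monoid (op_algebra H)"
proof -
  interpret inner_product_space H by fact
  have add: "(\<lambda>x\<in>carrier H. S x \<oplus>\<^bsub>H\<^esub> T x) \<in> bounded_ops H H"
    if S: "S \<in> bounded_ops H H" and T: "T \<in> bounded_ops H H" for S T
  proof -
    note [simp] = bounded_opsD[OF S] bounded_opsD[OF T]
    obtain B C where B: "\<And>x. x \<in> carrier H \<Longrightarrow> hnorm H (S x) \<le> B * hnorm H x"
      and C: "\<And>x. x \<in> carrier H \<Longrightarrow> hnorm H (T x) \<le> C * hnorm H x"
      using bounded_ops_bound[OF S semi_inner_space_axioms] bounded_ops_bound[OF T semi_inner_space_axioms] by metis
    show ?thesis
    proof (rule bounded_opsI[where B = "B + C"])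
      fix x assume "x \<in> carrier H"
      then show "hnorm H ((\<lambda>x\<in>carrier H. S x \<oplus>\<^bsub>H\<^esub> T x) x) \<le> (B + C) * hnorm H x"
        using hnorm_triangle[of "S x" "T x"] B[of x] C[of x] by (simp add: distrib_right)
    qed (auto simp: M.a_ac smult_r_distr)
  qed
  show ?thesis
  proof (rule abelian_monoidI)
    show "\<zero>\<^bsub>op_algebra H\<^esub> \<in> carrier (op_algebra H)"
      by (auto intro!: bounded_opsI[where B = 0])
  next
    fix S T U assume "S \<in> carrier (op_algebra H)" "T \<in> carrier (op_algebra H)" "U \<in> carrier (op_algebra H)"
    then show "S \<oplus>\<^bsub>op_algebra H\<^esub> T \<oplus>\<^bsub>op_algebra H\<^esub> U = S \<oplus>\<^bsub>op_algebra H\<^esub> (T \<oplus>\<^bsub>op_algebra H\<^esub> U)"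
      by (auto simp: bounded_ops_closed M.a_assoc cong: restrict_cong)
  next
    fix S T assume "S \<in> carrier (op_algebra H)" "T \<in> carrier (op_algebra H)"
    then show "S \<oplus>\<^bsub>op_algebra H\<^esub> T = T \<oplus>\<^bsub>op_algebra H\<^esub> S"
      by (auto simp: bounded_ops_closed intro!: restrict_ext M.a_comm)
  next
    fix S assume S: "S \<in> carrier (op_algebra H)"
    then have "restrict S (carrier H) = S"
      by (intro extensional_restrict bounded_ops_extensional) simp
    then show "\<zero>\<^bsub>op_algebra H\<^esub> \<oplus>\<^bsub>op_algebra H\<^esub> S = S"
      using S by (auto simp: bounded_ops_closed cong: restrict_cong)
  qed (auto simp: add)
qed

lemma op_algebra_finsum:
  assumes H: "inner_product_space H" and "finite F" "f \<in> F \<rightarrow> bounded_ops H H" "x \<in> carrier H"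
  shows "(\<Oplus>\<^bsub>op_algebra H\<^esub>i\<in>F. f i) x = (\<Oplus>\<^bsub>H\<^esub>i\<in>F. f i x)"
proof -
  interpret inner_product_space H by fact
  interpret O: abelian_monoid "op_algebra H" by (rule abelian_monoid_op_algebra[OF H])
  show ?thesis using assms(2,3)
  proof (induction F rule: finite_induct)
    case (insert i F)
    then have "f \<in> F \<rightarrow> carrier (op_algebra H)" "f i \<in> carrier (op_algebra H)" by auto
    then have "(\<Oplus>\<^bsub>op_algebra H\<^esub>i\<in>insert i F. f i) = f i \<oplus>\<^bsub>op_algebra H\<^esub> (\<Oplus>\<^bsub>op_algebra H\<^esub>i\<in>F. f i)"
      using insert.hyps by (intro O.finsum_insert)
    moreover have "(\<Oplus>\<^bsub>H\<^esub>i\<in>insert i F. f i x) = f i x \<oplus>\<^bsub>H\<^esub> (\<Oplus>\<^bsub>H\<^esub>i\<in>F. f i x)"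
      using insert assms(4) by (intro finsum_insert) (auto simp: Pi_iff bounded_ops_closed)
    ultimately show ?case using insert assms(4) by simp
  qed (use assms(4) in simp)
qed

section \<open>Square roots in C*-algebras and Gram factorisations\<close>

context cstar_algebra begin

lemma ring_A: "Ring.ring A" ..

lemma abelian_group_A: "abelian_group A" ..

text \<open>In this list items 5 and 6 are closure of the product and of the unit, 11 is
  associativity of the product, 12 the left unit law, and 13 and 23 the distributive laws for a sum
  in the left and in the right factor.\<close>

lemmas A_simprules = Ring.ring.ring_simprules[OF ring_A]

lemma smult_complex_zero [simp]: "x \<in> carrier A \<Longrightarrow> 0 \<odot>\<^bsub>A\<^esub> x = \<zero>"
  using smult_l_null by simp

lemma minus_eq_zero_iff: "x \<in> carrier A \<Longrightarrow> y \<in> carrier A \<Longrightarrow> x \<ominus> y = \<zero> \<longleftrightarrow> x = y"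
  using abelian_group.minus_equality[OF abelian_group_A, of x "\<ominus> y"] by (auto simp: A_simprules)

lemma smult_complex_closed [simp, intro]: "x \<in> carrier A \<Longrightarrow> c \<odot>\<^bsub>A\<^esub> x \<in> carrier A"
  using smult_closed by simp

lemma smult_complex_one [simp]: "x \<in> carrier A \<Longrightarrow> 1 \<odot>\<^bsub>A\<^esub> x = x"
  using smult_one by simp

lemma uminus_smult: "x \<in> carrier A \<Longrightarrow> \<ominus> x = (- 1) \<odot>\<^bsub>A\<^esub> x"
  using smult_l_minus[of 1 x] by simp

lemma algnorm_zero [simp]: "algnorm A \<zero> = 0"
  using algnorm_zero_iff by simp

lemma algnorm_uminus [simp]: "x \<in> carrier A \<Longrightarrow> algnorm A (\<ominus> x) = algnorm A x"
  by (simp add: uminus_smult algnorm_smult)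

lemma algnorm_nonneg [simp]: "x \<in> carrier A \<Longrightarrow> 0 \<le> algnorm A x"
  using algnorm_triangle[of x "\<ominus> x"] by (simp add: A_simprules)

lemma algnorm_diff_sym: "x \<in> carrier A \<Longrightarrow> y \<in> carrier A \<Longrightarrow> algnorm A (x \<ominus> y) = algnorm A (y \<ominus> x)"
proof -
  assume c: "x \<in> carrier A" "y \<in> carrier A"
  have "x \<ominus> y = \<ominus> (y \<ominus> x)"
    using c by (simp add: a_minus_def A_simprules)
  then show ?thesis using c by simp
qed

lemma Metric_space_algdist: "Metric_space (carrier A) (algdist A)"
proof
  fix x y z
  assume c: "x \<in> carrier A" "y \<in> carrier A"
  show "(algdist A x y = 0) = (x = y)"
    using c by (simp add: algdist_def algnorm_zero_iff minus_eq_zero_iff)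
  assume z: "z \<in> carrier A"
  have "x \<ominus> z = (x \<ominus> y) \<oplus> (y \<ominus> z)"
    using c z by (simp add: a_minus_def A_simprules)
  then show "algdist A x z \<le> algdist A x y + algdist A y z"
    using c z algnorm_triangle[of "x \<ominus> y" "y \<ominus> z"] by (simp add: algdist_def)
qed (auto simp: algdist_def algnorm_diff_sym)

lemma star_zero [simp]: "star A \<zero> = \<zero>"
  using star_smult[of \<zero> 0] by (simp add: star_closed)

lemma star_one [simp]: "star A \<one> = \<one>"
  using star_mult[of "star A \<one>" \<one>] by (simp add: star_closed star_star)

lemma star_uminus: "x \<in> carrier A \<Longrightarrow> star A (\<ominus> x) = \<ominus> star A x"
  by (simp add: uminus_smult star_smult star_closed)

text \<open>On the ball of radius \<open>q = 1 - sqrt (1 - \<parallel>x\<parallel>) < 1\<close> the map \<open>y \<mapsto> (x + y\<^sup>2) / 2\<close> is a \<open>q\<close>-contraction, and its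
  fixed point satisfies \<open>(1 - y)\<^sup>2 = 1 - x\<close>.  No commutativity is needed, so no functional calculus is.\<close>

lemma sqrt_one_minus:
  assumes x: "x \<in> carrier A" "star A x = x" "algnorm A x < 1"
  obtains c where "c \<in> carrier A" "star A c = c" "c \<otimes> c = \<one> \<ominus> x"
proof -
  define r where "r = algnorm A x"
  \<comment> \<open>The smaller root of q^2 - 2 q + r = 0: a point of norm at most q is sent to one
    of norm at most (r + q^2) / 2 = q, so the ball is mapped into itself.\<close>
  define q where "q = 1 - sqrt (1 - r)"
  have r: "0 \<le> r" "r < 1" using x by (auto simp: r_def)
  have q: "0 \<le> q" "q < 1" using r by (auto simp: q_def)
  define u where "u = sqrt (1 - r)"
  have "u * u = 1 - r" using r by (simp add: u_def)
  then have qr: "(r + q * q) / 2 = q"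
    by (simp add: q_def flip: u_def) (simp add: field_simps)
  define M where "M = {y \<in> carrier A. algnorm A y \<le> q}"
  define f where "f y = (1/2) \<odot>\<^bsub>A\<^esub> (x \<oplus> y \<otimes> y)" for y
  interpret S: Metric_space "carrier A" "algdist A" by (rule Metric_space_algdist)
  have "M \<subseteq> carrier A" by (auto simp: M_def)
  then interpret M: Metric_space M "algdist A" by (rule S.subspace)
  have "M.mcomplete"
    unfolding M.mcomplete_def
  proof (intro allI impI)
    fix s assume s: "M.MCauchy s"
    then have sM: "s n \<in> M" for n by (auto simp: M.MCauchy_def)
    have "S.MCauchy s"
      unfolding S.MCauchy_def using s[unfolded M.MCauchy_def] \<open>M \<subseteq> carrier A\<close> by blast
    then obtain l where l: "limitin S.mtopology s l sequentially"
      using complete unfolding S.mcomplete_def by blast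
    then have lA: "l \<in> carrier A" and lim: "(\<lambda>n. algdist A (s n) l) \<longlonglongrightarrow> 0"
      by (auto simp: S.limitin_metric_dist_null)
    have sA: "s n \<in> carrier A" "algnorm A (s n) \<le> q" for n using sM[of n] by (auto simp: M_def)
    have "algnorm A l \<le> q + algdist A (s n) l" for n
    proof -
      have "l = s n \<oplus> (l \<ominus> s n)" using sA lA by (simp add: a_minus_def A_simprules)
      then have "algnorm A l \<le> algnorm A (s n) + algnorm A (l \<ominus> s n)"
        using algnorm_triangle[of "s n" "l \<ominus> s n"] sA lA by simp
      then show ?thesis using sA(2)[of n] sA(1) lA by (simp add: algdist_def algnorm_diff_sym)
    qed
    moreover have "(\<lambda>n. q + algdist A (s n) l) \<longlonglongrightarrow> q" using tendsto_add[OF tendsto_const lim] by simp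
    ultimately have "algnorm A l \<le> q" by (intro LIMSEQ_le_const) auto
    then have "limitin M.mtopology s l sequentially"
      unfolding M.limitin_metric_dist_null using lA lim sM by (auto simp: M_def)
    then show "\<exists>l. limitin M.mtopology s l sequentially" by blast
  qed
  moreover have "\<zero> \<in> M" using q by (simp add: M_def)
  moreover have fM: "f y \<in> M" if "y \<in> M" for y
  proof -
    have y: "y \<in> carrier A" "algnorm A y \<le> q" using that by (auto simp: M_def)
    have "algnorm A (x \<oplus> y \<otimes> y) \<le> r + algnorm A y * algnorm A y"
      unfolding r_def using y x algnorm_triangle[of x "y \<otimes> y"] algnorm_mult[of y y] by simp
    also have "\<dots> \<le> r + q * q" using y by (intro add_left_mono mult_mono) (auto simp: q)
    finally show ?thesis
      using y x qr by (simp add: f_def M_def algnorm_smult)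
  qed
  moreover have con: "algdist A (f y) (f z) \<le> q * algdist A y z" if "y \<in> M" "z \<in> M" for y z
  proof -
    have c: "y \<in> carrier A" "algnorm A y \<le> q" "z \<in> carrier A" "algnorm A z \<le> q"
      using that by (auto simp: M_def)
    have fc: "f y \<in> carrier A" "f z \<in> carrier A" using c x by (auto simp: f_def)
    have "f y \<ominus> f z = (1/2) \<odot>\<^bsub>A\<^esub> ((x \<oplus> y \<otimes> y) \<ominus> (x \<oplus> z \<otimes> z))"
      using c x by (simp add: f_def a_minus_def smult_r_distr smult_r_minus)
    \<comment> \<open>A difference of squares, factored in a way that holds for non-commuting y and
      z; each factor y or z contributes at most q and the outer 1/2 absorbs the two terms.\<close>
    also have "(x \<oplus> y \<otimes> y) \<ominus> (x \<oplus> z \<otimes> z) = y \<otimes> (y \<ominus> z) \<oplus> (y \<ominus> z) \<otimes> z"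
    proof -
      have "y \<otimes> (y \<ominus> z) \<oplus> (y \<ominus> z) \<otimes> z = (y \<otimes> y \<oplus> \<ominus> (y \<otimes> z)) \<oplus> (y \<otimes> z \<oplus> \<ominus> (z \<otimes> z))"
        using c by (simp add: a_minus_def A_simprules)
      also have "\<dots> = y \<otimes> y \<oplus> \<ominus> (z \<otimes> z)"
        using c by (simp add: A_simprules)
      also have "\<dots> = (x \<oplus> y \<otimes> y) \<ominus> (x \<oplus> z \<otimes> z)"
        using c x by (simp add: a_minus_def A_simprules)
      finally show ?thesis by simp
    qed
    finally have "algdist A (f y) (f z) = algnorm A (y \<otimes> (y \<ominus> z) \<oplus> (y \<ominus> z) \<otimes> z) / 2"
      using c fc by (simp add: algdist_def algnorm_smult)
    also have "algnorm A (y \<otimes> (y \<ominus> z) \<oplus> (y \<ominus> z) \<otimes> z) \<le>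
        algnorm A y * algnorm A (y \<ominus> z) + algnorm A (y \<ominus> z) * algnorm A z"
      using c algnorm_triangle[of "y \<otimes> (y \<ominus> z)" "(y \<ominus> z) \<otimes> z"]
        algnorm_mult[of y "y \<ominus> z"] algnorm_mult[of "y \<ominus> z" z] by simp
    also have "\<dots> \<le> q * algnorm A (y \<ominus> z) + algnorm A (y \<ominus> z) * q"
      using c by (intro add_mono mult_right_mono mult_left_mono) auto
    finally show ?thesis using c by (simp add: algdist_def mult.commute)
  qed
  ultimately obtain y where y: "y \<in> M" "f y = y"
    using M.Banach_fixedpoint_thm[of f q] q by blast
  then have yA: "y \<in> carrier A" by (simp add: M_def)
  \<comment> \<open>By the C*-identity the squared norm of star y is the norm of y times star y,
    hence at most the product of their norms. So star y lies in the ball as well, and as a second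
    fixed point it must equal y.\<close>
  have norm_star: "algnorm A (star A y) \<le> algnorm A y"
  proof -
    let ?z = "star A y"
    have z: "?z \<in> carrier A" using yA by (simp add: star_closed)
    have "algnorm A ?z * algnorm A ?z \<le> algnorm A y * algnorm A ?z"
      using algnorm_star_mult[OF z] algnorm_mult[of y ?z] yA z by (simp add: star_star power2_eq_square)
    then show ?thesis using z yA
      by (metis algnorm_nonneg linorder_not_le mult_le_cancel_right order_le_less_trans)
  qed
  have "star A y = y"
  proof (rule M.contraction_imp_unique_fixpoint[of f])
    show "f (star A y) = star A y"
      using yA x by (subst (2) y(2)[symmetric]) (simp add: f_def star_smult star_add star_mult star_closed)
    show "star A y \<in> M" using yA norm_star y(1) by (simp add: M_def star_closed)
  qed (use y con q fM in \<open>auto simp: Pi_iff\<close>)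
  have yy: "y \<oplus> y = x \<oplus> y \<otimes> y"
  proof -
    have "y \<oplus> y = f y \<oplus> f y" by (simp add: y)
    also have "\<dots> = x \<oplus> y \<otimes> y"
      using x yA smult_l_distr[of "1/2" "1/2" "x \<oplus> y \<otimes> y"] by (simp add: f_def)
    finally show ?thesis .
  qed
  have "(y \<oplus> y) \<ominus> y \<otimes> y = x"
    unfolding yy using x yA by (simp add: a_minus_def A_simprules)
  then have "\<one> \<ominus> x = \<one> \<ominus> ((y \<oplus> y) \<ominus> y \<otimes> y)" by simp
  also have "\<dots> = (\<one> \<ominus> y) \<otimes> (\<one> \<ominus> y)"
    using yA by (simp add: a_minus_def A_simprules)
  finally show ?thesis
    using that[of "\<one> \<ominus> y"] yA \<open>star A y = y\<close> by (simp add: a_minus_def star_add star_uminus)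
qed

lemma one_minus_star_mult:
  assumes a: "a \<in> carrier A" "algnorm A a < 1"
  obtains c where "c \<in> carrier A" "star A c \<otimes> c = \<one> \<ominus> star A a \<otimes> a"
proof -
  have "algnorm A (star A a \<otimes> a) < 1"
    using a by (simp add: algnorm_star_mult power_less_one_iff)
  then obtain c where "c \<in> carrier A" "star A c = c" "c \<otimes> c = \<one> \<ominus> star A a \<otimes> a"
    using sqrt_one_minus[of "star A a \<otimes> a"] a by (auto simp: star_mult star_star star_closed)
  then show ?thesis using that by simp
qed

end

text \<open>Complete positivity is applied to the matrix \<open>(a\<^sub>i\<^sup>* a\<^sub>j) = Y\<^sup>* Y\<close>, where \<open>Y\<close> has first row \<open>a\<close> and zeros elsewhere.\<close>

lemma cp_map_Gram:
  fixes A :: "('a, 'm) normed_star_algebra_scheme" and K :: "('k, 'n) inner_space_scheme" and a :: "nat \<Rightarrow> 'a"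
  assumes A: "cstar_algebra A" and K: "hilbert_space K" and cp: "cp_map A (op_algebra K) \<phi>"
    and a: "a \<in> {..<n} \<rightarrow> carrier A"
  obtains Z where "\<And>k i. k < n \<Longrightarrow> i < n \<Longrightarrow> Z k i \<in> bounded_ops K K"
    "\<And>i j v w. \<lbrakk>i < n; j < n; v \<in> carrier K; w \<in> carrier K\<rbrakk> \<Longrightarrow>
      inprod K v (\<phi> (star A (a i) \<otimes>\<^bsub>A\<^esub> a j) w) = (\<Sum>k<n. inprod K (Z k i v) (Z k j w))"
proof -
  interpret AG: abelian_group A by (rule cstar_algebra.abelian_group_A[OF A])
  interpret A: cstar_algebra A by fact
  interpret K: hilbert_space K by fact
  define Y where "Y k i = (if k = 0 then a i else \<zero>\<^bsub>A\<^esub>)" for k i :: nat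
  have Y: "Y k i \<in> carrier A" if "i < n" for k i
    using a that by (auto simp: Y_def)
  have "star A (a i) \<otimes>\<^bsub>A\<^esub> a j = (\<Oplus>\<^bsub>A\<^esub>k\<in>{..<n}. star A (Y k i) \<otimes>\<^bsub>A\<^esub> Y k j)" if ij: "i < n" "j < n" for i j
  proof -
    have c: "star A (a i) \<otimes>\<^bsub>A\<^esub> a j \<in> carrier A" using a ij by (auto intro!: A.star_closed)
    have "(\<Oplus>\<^bsub>A\<^esub>k\<in>{..<n}. star A (Y k i) \<otimes>\<^bsub>A\<^esub> Y k j) =
        (\<Oplus>\<^bsub>A\<^esub>k\<in>{..<n}. if 0 = k then star A (a i) \<otimes>\<^bsub>A\<^esub> a j else \<zero>\<^bsub>A\<^esub>)"
      using c by (intro AG.finsum_cong') (auto simp: Y_def A.star_closed)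
    also have "\<dots> = star A (a i) \<otimes>\<^bsub>A\<^esub> a j"
      using AG.finsum_singleton[of 0 "{..<n}" "\<lambda>_. star A (a i) \<otimes>\<^bsub>A\<^esub> a j"] c ij by auto
    finally show ?thesis by simp
  qed
  then have "mat_positive A n (\<lambda>i j. star A (a i) \<otimes>\<^bsub>A\<^esub> a j)"
    unfolding mat_positive_def using Y by blast
  then have "mat_positive (op_algebra K) n (\<lambda>i j. \<phi> (star A (a i) \<otimes>\<^bsub>A\<^esub> a j))"
    using cp unfolding cp_map_def by blast
  then obtain Z where Z: "\<And>k i. k < n \<Longrightarrow> i < n \<Longrightarrow> Z k i \<in> bounded_ops K K"
    and eq: "\<And>i j. i < n \<Longrightarrow> j < n \<Longrightarrow> \<phi> (star A (a i) \<otimes>\<^bsub>A\<^esub> a j) =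
      (\<Oplus>\<^bsub>op_algebra K\<^esub>k\<in>{..<n}. star (op_algebra K) (Z k i) \<otimes>\<^bsub>op_algebra K\<^esub> Z k j)"
    unfolding mat_positive_def op_algebra_sel(1) by blast
  have adj: "adjoint_op K K (Z k i) \<in> bounded_ops K K" if "k < n" "i < n" for k i
    using adjoint_op_bounded[OF K K.inner_product_space_axioms Z] that by blast
  have "inprod K v (\<phi> (star A (a i) \<otimes>\<^bsub>A\<^esub> a j) w) = (\<Sum>k<n. inprod K (Z k i v) (Z k j w))"
    if h: "i < n" "j < n" "v \<in> carrier K" "w \<in> carrier K" for i j v w
  proof -
    have "\<phi> (star A (a i) \<otimes>\<^bsub>A\<^esub> a j) w =
        (\<Oplus>\<^bsub>K\<^esub>k\<in>{..<n}. (star (op_algebra K) (Z k i) \<otimes>\<^bsub>op_algebra K\<^esub> Z k j) w)"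
      unfolding eq[OF h(1,2)] using h
      by (intro op_algebra_finsum K.inner_product_space_axioms)
        (auto intro!: bounded_ops_compose Z adj K.semi_inner_space_axioms)
    also have "inprod K v \<dots> = (\<Sum>k<n. inprod K v ((star (op_algebra K) (Z k i) \<otimes>\<^bsub>op_algebra K\<^esub> Z k j) w))"
      using h by (intro K.inprod_finsum_right) (auto simp: compose_def intro!: bounded_ops_closed[OF adj] bounded_ops_closed[OF Z])
    also have "\<dots> = (\<Sum>k<n. inprod K (Z k i v) (Z k j w))"
      using h by (intro sum.cong)
        (auto simp: compose_def adjoint_op_inprod[OF K K.inner_product_space_axioms Z] bounded_ops_closed[OF Z])
    finally show ?thesis .
  qed
  then show ?thesis using that Z by blast
qed

section \<open>Extension of operators from a dense family\<close>

text \<open>Polarisation: norms of sums determine the real part of the inner product, and replacing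
  w by \<i> times w gives the imaginary part.\<close>

lemma is_isometry_inprod:
  assumes "semi_inner_space H" "semi_inner_space K" "is_isometry H K T" and u: "u \<in> carrier H" and w: "w \<in> carrier H"
  shows "inprod K (T u) (T w) = inprod H u w"
proof -
  interpret H: semi_inner_space H by fact
  interpret K: semi_inner_space K by fact
  have T: "T \<in> bounded_ops H K" and iso: "\<And>x. x \<in> carrier H \<Longrightarrow> hnorm K (T x) = hnorm H x"
    using assms(3) by (auto simp: is_isometry_def)
  note [simp] = bounded_opsD[OF T]
  have Re_eq: "Re (inprod K (T u) (T w)) = Re (inprod H u w)" if "w \<in> carrier H" for w
    using H.hnorm_add_power2[OF u that] K.hnorm_add_power2[of "T u" "T w"] iso[of "u \<oplus>\<^bsub>H\<^esub> w"] iso[OF u] iso[OF that] u that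
    by simp
  have "Re (\<i> * inprod K (T u) (T w)) = Re (\<i> * inprod H u w)"
    using Re_eq[of "\<i> \<odot>\<^bsub>H\<^esub> w"] u w by (simp only: bounded_ops_smult[OF T] H.smult_complex_closed H.inprod_smult_right K.inprod_smult_right bounded_ops_closed[OF T])
  then show ?thesis using Re_eq[OF w] by (simp add: complex_eq_iff)
qed

text \<open>The dense set is an indexed family, so that a map can be prescribed on indices, here on
  representations of tensors, before it is known to depend only on the vector.\<close>

locale dense_family = inner_product_space H for H :: "('h, 'm) inner_space_scheme" +
  fixes X :: "'x set" and e :: "'x \<Rightarrow> 'h"
  assumes e_closed: "x \<in> X \<Longrightarrow> e x \<in> carrier H"
    and e_dense: "\<lbrakk>h \<in> carrier H; \<epsilon> > 0\<rbrakk> \<Longrightarrow> \<exists>x\<in>X. hnorm H (h \<ominus>\<^bsub>H\<^esub> e x) < \<epsilon>"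

lemma (in inner_product_space) eq_if_arbitrarily_close:
  assumes "a \<in> carrier H" "b \<in> carrier H" "C \<ge> 0" "\<And>\<epsilon>. \<epsilon> > 0 \<Longrightarrow> hnorm H (a \<ominus> b) \<le> C * \<epsilon>"
  shows "a = b"
proof (rule ccontr)
  assume "a \<noteq> b"
  then have "hnorm H (a \<ominus> b) \<noteq> 0"
    using assms hnorm_eq_0_iff[of "a \<ominus> b"] by (simp add: diff_eq_zero_iff)
  moreover have "0 \<le> hnorm H (a \<ominus> b)" using assms by simp
  ultimately have p: "hnorm H (a \<ominus> b) > 0" by simp
  \<comment> \<open>The hypothesis at the distance itself divided by C + 1 makes the distance at
    most C / (C + 1) times itself.\<close>
  have "hnorm H (a \<ominus> b) * (C + 1) \<le> C * hnorm H (a \<ominus> b)"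
    using assms(4)[of "hnorm H (a \<ominus> b) / (C + 1)"] p assms(3) by (simp add: field_simps)
  then show False using p by (simp add: distrib_left mult.commute)
qed

context dense_family begin

text \<open>The difference d is orthogonal to the family. A member closer to d than the norm of d
  would make the square of that norm smaller than itself.\<close>

lemma dense_inprod_eqI:
  assumes u: "u \<in> carrier H" and v: "v \<in> carrier H" and eq: "\<And>x. x \<in> X \<Longrightarrow> inprod H (e x) u = inprod H (e x) v"
  shows "u = v"
proof (rule ccontr)
  let ?d = "u \<ominus>\<^bsub>H\<^esub> v"
  assume "u \<noteq> v"
  then have "hnorm H ?d \<noteq> 0"
    using u v hnorm_eq_0_iff[of ?d] by (simp add: diff_eq_zero_iff)
  moreover have "0 \<le> hnorm H ?d" using u v by simp
  ultimately have p: "hnorm H ?d > 0" by simp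
  then obtain x where x: "x \<in> X" "hnorm H (?d \<ominus>\<^bsub>H\<^esub> e x) < hnorm H ?d"
    using e_dense[of ?d "hnorm H ?d"] u v by auto
  have "inprod H (e x) ?d = 0" using eq[OF x(1)] u v e_closed[OF x(1)] by (simp add: inprod_diff_right)
  then have "inprod H ?d ?d = inprod H (?d \<ominus>\<^bsub>H\<^esub> e x) ?d"
    using inprod_diff_left[OF M.minus_closed[OF u v] e_closed[OF x(1)] M.minus_closed[OF u v]]
    by (simp only: diff_0_right)
  then have "(hnorm H ?d)\<^sup>2 = Re (inprod H (?d \<ominus>\<^bsub>H\<^esub> e x) ?d)"
    using hnorm_power2[OF M.minus_closed[OF u v]] by (simp only:)
  also have "\<dots> \<le> hnorm H (?d \<ominus>\<^bsub>H\<^esub> e x) * hnorm H ?d"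
    using u v e_closed[OF x(1)] by (intro order_trans[OF complex_Re_le_cmod Cauchy_Schwarz]) auto
  finally have "(hnorm H ?d)\<^sup>2 \<le> hnorm H (?d \<ominus>\<^bsub>H\<^esub> e x) * hnorm H ?d" .
  then show False using p x(2) by (simp add: power2_eq_square)
qed

lemma dense_bounded_ops_eqI:
  assumes S: "S \<in> bounded_ops H K" and T: "T \<in> bounded_ops H K" and K: "inner_product_space K"
    and eq: "\<And>x. x \<in> X \<Longrightarrow> S (e x) = T (e x)"
  shows "S = T"
proof (rule bounded_ops_eqI[OF S T])
  interpret K: inner_product_space K by fact
  obtain B where B: "B \<ge> 0" "\<And>x. x \<in> carrier H \<Longrightarrow> hnorm K (S x) \<le> B * hnorm H x"
    using bounded_ops_bound[OF S semi_inner_space_axioms] by blast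
  obtain C where C: "C \<ge> 0" "\<And>x. x \<in> carrier H \<Longrightarrow> hnorm K (T x) \<le> C * hnorm H x"
    using bounded_ops_bound[OF T semi_inner_space_axioms] by blast
  note Scl [simp] = bounded_ops_closed[OF S] and Tcl [simp] = bounded_ops_closed[OF T]
  fix h assume h: "h \<in> carrier H"
  show "S h = T h"
  proof (rule K.eq_if_arbitrarily_close[where C = "B + C"])
    fix \<epsilon> :: real assume "\<epsilon> > 0"
    then obtain x where x: "x \<in> X" "hnorm H (h \<ominus>\<^bsub>H\<^esub> e x) < \<epsilon>"
      using e_dense[OF h] by blast
    note ex = e_closed[OF x(1)]
    have "hnorm K (S h \<ominus>\<^bsub>K\<^esub> T h) \<le> hnorm K (S h \<ominus>\<^bsub>K\<^esub> S (e x)) + hnorm K (T (e x) \<ominus>\<^bsub>K\<^esub> T h)"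
      using K.hnorm_diff_triangle[of "S h" "S (e x)" "T h"] h ex eq[OF x(1)] by simp
    also have "hnorm K (T (e x) \<ominus>\<^bsub>K\<^esub> T h) = hnorm K (T h \<ominus>\<^bsub>K\<^esub> T (e x))"
      using h ex by (simp add: K.hnorm_diff_sym)
    also have "hnorm K (S h \<ominus>\<^bsub>K\<^esub> S (e x)) + hnorm K (T h \<ominus>\<^bsub>K\<^esub> T (e x)) \<le>
        B * hnorm H (h \<ominus>\<^bsub>H\<^esub> e x) + C * hnorm H (h \<ominus>\<^bsub>H\<^esub> e x)"
      using h ex B(2)[of "h \<ominus>\<^bsub>H\<^esub> e x"] C(2)[of "h \<ominus>\<^bsub>H\<^esub> e x"]
      by (simp add: bounded_ops_diff[OF S K.semi_inner_space_axioms] bounded_ops_diff[OF T K.semi_inner_space_axioms])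
    also have "\<dots> \<le> B * \<epsilon> + C * \<epsilon>"
      using x B C by (intro add_mono mult_left_mono) auto
    finally show "hnorm K (S h \<ominus>\<^bsub>K\<^esub> T h) \<le> (B + C) * \<epsilon>" by (simp add: distrib_right)
  qed (use h B C in auto)
qed

lemma dense_isometryI:
  assumes S: "S \<in> bounded_ops H K" and K: "semi_inner_space K"
    and eq: "\<And>x. x \<in> X \<Longrightarrow> hnorm K (S (e x)) = hnorm H (e x)"
  shows "is_isometry H K S"
  unfolding is_isometry_def
proof (intro conjI ballI S)
  interpret K: semi_inner_space K by fact
  obtain B where B: "B \<ge> 0" "\<And>x. x \<in> carrier H \<Longrightarrow> hnorm K (S x) \<le> B * hnorm H x"
    using bounded_ops_bound[OF S semi_inner_space_axioms] by blast
  note Scl [simp] = bounded_ops_closed[OF S]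
  fix h assume h: "h \<in> carrier H"
  have "\<bar>hnorm K (S h) - hnorm H h\<bar> \<le> 0 + \<epsilon>" if \<epsilon>: "\<epsilon> > 0" for \<epsilon>
  proof -
    \<comment> \<open>Replacing h by e x at distance d changes the norm of the image by at most B d
      and that of the vector by at most d, so (B + 1) d has to stay below the tolerance.\<close>
    have "\<epsilon> / (B + 1) > 0" using \<epsilon> B by simp
    then obtain x where x: "x \<in> X" "hnorm H (h \<ominus>\<^bsub>H\<^esub> e x) < \<epsilon> / (B + 1)"
      using e_dense[OF h] by blast
    note ex = e_closed[OF x(1)]
    let ?d = "hnorm H (h \<ominus>\<^bsub>H\<^esub> e x)"
    have 1: "hnorm K (S h \<ominus>\<^bsub>K\<^esub> S (e x)) \<le> B * ?d"
      using h ex B(2)[of "h \<ominus>\<^bsub>H\<^esub> e x"] by (simp add: bounded_ops_diff[OF S K])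
    have 2: "hnorm K (S h) \<le> hnorm K (S (e x)) + hnorm K (S h \<ominus>\<^bsub>K\<^esub> S (e x))"
      "hnorm K (S (e x)) \<le> hnorm K (S h) + hnorm K (S h \<ominus>\<^bsub>K\<^esub> S (e x))"
      using h ex K.hnorm_triangle3[of "S h" "S (e x)"] K.hnorm_triangle3[of "S (e x)" "S h"]
        K.hnorm_diff_sym[of "S h" "S (e x)"] by auto
    have 3: "hnorm H h \<le> hnorm H (e x) + ?d" "hnorm H (e x) \<le> hnorm H h + ?d"
      using h ex hnorm_triangle3[of h "e x"] hnorm_triangle3[of "e x" h] hnorm_diff_sym[of h "e x"] by auto
    have "?d * (B + 1) < \<epsilon>" using x(2) B by (simp add: pos_less_divide_eq)
    then have "B * ?d + ?d < \<epsilon>" by (simp add: algebra_simps)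
    then show ?thesis using 1 2 3 eq[OF x(1)] by linarith
  qed
  then have "\<bar>hnorm K (S h) - hnorm H h\<bar> \<le> 0" by (rule field_le_epsilon)
  then show "hnorm K (S h) = hnorm H h" by simp
qed

text \<open>The conditions \<open>add\<close> and \<open>smult\<close> make the pairs (e x, f x) a
  linear subspace. The bound applies to differences of such pairs, so it shows at once that f
  depends only on e x and that it is Lipschitz.\<close>

theorem extend_bounded_op:
  fixes f :: "'x \<Rightarrow> 'i" and I :: "('i, 'n) inner_space_scheme"
  assumes I: "hilbert_space I"
    and f: "\<And>x. x \<in> X \<Longrightarrow> f x \<in> carrier I"
    and add: "\<And>x y. \<lbrakk>x \<in> X; y \<in> X\<rbrakk> \<Longrightarrow> \<exists>z\<in>X. e z = e x \<oplus>\<^bsub>H\<^esub> e y \<and> f z = f x \<oplus>\<^bsub>I\<^esub> f y"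
    and smult: "\<And>c x. x \<in> X \<Longrightarrow> \<exists>z\<in>X. e z = c \<odot>\<^bsub>H\<^esub> e x \<and> f z = c \<odot>\<^bsub>I\<^esub> f x"
    and bound: "\<And>x. x \<in> X \<Longrightarrow> hnorm I (f x) \<le> B * hnorm H (e x)"
    and B: "B \<ge> 0"
  obtains S where "S \<in> bounded_ops H I" "\<And>x. x \<in> X \<Longrightarrow> S (e x) = f x"
proof -
  interpret I: hilbert_space I by fact
  note [simp] = e_closed f
  \<comment> \<open>The difference of two pairs is again a pair, obtained from \<open>smult\<close>
    with -1 and \<open>add\<close>.\<close>
  have lip: "hnorm I (f x \<ominus>\<^bsub>I\<^esub> f y) \<le> B * hnorm H (e x \<ominus>\<^bsub>H\<^esub> e y)" if xy: "x \<in> X" "y \<in> X" for x y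
  proof -
    obtain y' where y': "y' \<in> X" "e y' = (- 1) \<odot>\<^bsub>H\<^esub> e y" "f y' = (- 1) \<odot>\<^bsub>I\<^esub> f y"
      using smult[OF xy(2), of "- 1"] by blast
    obtain z where z: "z \<in> X" "e z = e x \<oplus>\<^bsub>H\<^esub> e y'" "f z = f x \<oplus>\<^bsub>I\<^esub> f y'"
      using add[OF xy(1) y'(1)] by blast
    show ?thesis
      using bound[OF z(1)] xy by (simp add: z y' a_minus_def uminus_eq_smult I.uminus_eq_smult)
  qed
  \<comment> \<open>The limit is recorded through its estimate against all indices x. Agreement with
    f, linearity and the bound are then derived from this inequality alone, independently of the
    approximating sequence.\<close>
  have ex: "\<exists>l\<in>carrier I. \<forall>x\<in>X. hnorm I (l \<ominus>\<^bsub>I\<^esub> f x) \<le> B * hnorm H (h \<ominus>\<^bsub>H\<^esub> e x)" if h: "h \<in> carrier H" for h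
  proof -
    have "\<forall>n. \<exists>x. x \<in> X \<and> hnorm H (h \<ominus>\<^bsub>H\<^esub> e x) < 1 / real (Suc n)"
      using e_dense[OF h] by (metis of_nat_0_less_iff zero_less_Suc zero_less_divide_1_iff)
    then obtain s where s: "\<And>n. s n \<in> X" and sh: "\<And>n. hnorm H (h \<ominus>\<^bsub>H\<^esub> e (s n)) < 1 / real (Suc n)"
      by metis
    have lim: "(\<lambda>n. hnorm H (h \<ominus>\<^bsub>H\<^esub> e (s n))) \<longlonglongrightarrow> 0"
      by (rule tendsto_sandwich[OF _ _ tendsto_const LIMSEQ_inverse_real_of_nat])
        (use sh h s in \<open>auto simp: inverse_eq_divide less_imp_le\<close>)
    have "I.Cauchy_seq (\<lambda>n. f (s n))"
      unfolding I.Cauchy_seq_def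
    proof (intro conjI allI impI)
      fix \<epsilon> :: real assume \<epsilon>: "\<epsilon> > 0"
      then have "\<epsilon> / (2 * (B + 1)) > 0" using B by simp
      then obtain N where N: "\<forall>n\<ge>N. hnorm H (h \<ominus>\<^bsub>H\<^esub> e (s n)) < \<epsilon> / (2 * (B + 1))"
        using order_tendstoD(2)[OF lim] unfolding eventually_sequentially by blast
      show "\<exists>N. \<forall>m\<ge>N. \<forall>n\<ge>N. hnorm I (f (s m) \<ominus>\<^bsub>I\<^esub> f (s n)) < \<epsilon>"
      proof (intro exI[of _ N] allI impI)
        fix m n assume mn: "N \<le> m" "N \<le> n"
        have "hnorm H (e (s m) \<ominus>\<^bsub>H\<^esub> e (s n)) \<le> hnorm H (h \<ominus>\<^bsub>H\<^esub> e (s m)) + hnorm H (h \<ominus>\<^bsub>H\<^esub> e (s n))"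
          using hnorm_diff_triangle[of "e (s m)" h "e (s n)"] hnorm_diff_sym[of h "e (s m)"] h s by simp
        also have "\<dots> \<le> \<epsilon> / (2 * (B + 1)) + \<epsilon> / (2 * (B + 1))"
          using N mn by (intro add_mono less_imp_le) auto
        also have "\<dots> = \<epsilon> / (B + 1) / 2 + \<epsilon> / (B + 1) / 2"
          by (simp add: mult.commute)
        also have "\<dots> = \<epsilon> / (B + 1)" by (rule field_sum_of_halves)
        finally have *: "hnorm H (e (s m) \<ominus>\<^bsub>H\<^esub> e (s n)) \<le> \<epsilon> / (B + 1)" .
        have "hnorm I (f (s m) \<ominus>\<^bsub>I\<^esub> f (s n)) \<le> B * hnorm H (e (s m) \<ominus>\<^bsub>H\<^esub> e (s n))"
          using lip s by blast
        also have "\<dots> \<le> B * (\<epsilon> / (B + 1))" using * B by (rule mult_left_mono)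
        also have "\<dots> < \<epsilon>" using B \<epsilon> by (simp add: field_simps)
        finally show "hnorm I (f (s m) \<ominus>\<^bsub>I\<^esub> f (s n)) < \<epsilon>" .
      qed
    qed (use s in auto)
    then obtain l where l: "l \<in> carrier I" "(\<lambda>n. hnorm I (f (s n) \<ominus>\<^bsub>I\<^esub> l)) \<longlonglongrightarrow> 0"
      by (rule I.Cauchy_seq_limit)
    have "hnorm I (l \<ominus>\<^bsub>I\<^esub> f x) \<le> B * hnorm H (h \<ominus>\<^bsub>H\<^esub> e x)" if x: "x \<in> X" for x
    proof (rule LIMSEQ_le_const)
      show "(\<lambda>n. hnorm I (f (s n) \<ominus>\<^bsub>I\<^esub> l) + B * (hnorm H (h \<ominus>\<^bsub>H\<^esub> e (s n)) + hnorm H (h \<ominus>\<^bsub>H\<^esub> e x)))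
          \<longlonglongrightarrow> B * hnorm H (h \<ominus>\<^bsub>H\<^esub> e x)"
        using tendsto_add[OF l(2) tendsto_mult_left[OF tendsto_add[OF lim tendsto_const[of "hnorm H (h \<ominus>\<^bsub>H\<^esub> e x)"]], of B]]
        by simp
      have "hnorm I (l \<ominus>\<^bsub>I\<^esub> f x) \<le> hnorm I (f (s n) \<ominus>\<^bsub>I\<^esub> l) + B * (hnorm H (h \<ominus>\<^bsub>H\<^esub> e (s n)) + hnorm H (h \<ominus>\<^bsub>H\<^esub> e x))" for n
      proof -
        have "hnorm I (l \<ominus>\<^bsub>I\<^esub> f x) \<le> hnorm I (f (s n) \<ominus>\<^bsub>I\<^esub> l) + hnorm I (f (s n) \<ominus>\<^bsub>I\<^esub> f x)"
          using I.hnorm_diff_triangle[of l "f (s n)" "f x"] I.hnorm_diff_sym[of l "f (s n)"] l(1) s x by simp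
        also have "hnorm I (f (s n) \<ominus>\<^bsub>I\<^esub> f x) \<le> B * hnorm H (e (s n) \<ominus>\<^bsub>H\<^esub> e x)"
          using lip s x by blast
        also have "\<dots> \<le> B * (hnorm H (h \<ominus>\<^bsub>H\<^esub> e (s n)) + hnorm H (h \<ominus>\<^bsub>H\<^esub> e x))"
          using hnorm_diff_triangle[of "e (s n)" h "e x"] hnorm_diff_sym[of h "e (s n)"] h s x B
          by (intro mult_left_mono) auto
        finally show ?thesis by simp
      qed
      then show "\<exists>N. \<forall>n\<ge>N. hnorm I (l \<ominus>\<^bsub>I\<^esub> f x) \<le>
          hnorm I (f (s n) \<ominus>\<^bsub>I\<^esub> l) + B * (hnorm H (h \<ominus>\<^bsub>H\<^esub> e (s n)) + hnorm H (h \<ominus>\<^bsub>H\<^esub> e x))"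
        by blast
    qed
    then show ?thesis using l(1) by blast
  qed
  then obtain S0 where S0: "\<And>h. h \<in> carrier H \<Longrightarrow> S0 h \<in> carrier I"
    "\<And>h x. h \<in> carrier H \<Longrightarrow> x \<in> X \<Longrightarrow> hnorm I (S0 h \<ominus>\<^bsub>I\<^esub> f x) \<le> B * hnorm H (h \<ominus>\<^bsub>H\<^esub> e x)"
    by metis
  define S where "S = restrict S0 (carrier H)"
  have S [simp]: "\<And>h. h \<in> carrier H \<Longrightarrow> S h \<in> carrier I"
    and SB: "\<And>h x. h \<in> carrier H \<Longrightarrow> x \<in> X \<Longrightarrow> hnorm I (S h \<ominus>\<^bsub>I\<^esub> f x) \<le> B * hnorm H (h \<ominus>\<^bsub>H\<^esub> e x)"
    using S0 by (simp_all add: S_def)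
  have Se: "S (e x) = f x" if x: "x \<in> X" for x
  proof -
    have "e x \<ominus>\<^bsub>H\<^esub> e x = \<zero>\<^bsub>H\<^esub>" using x by (simp add: diff_eq_zero_iff)
    then have "hnorm I (S (e x) \<ominus>\<^bsub>I\<^esub> f x) \<le> 0" using SB[of "e x" x] x by simp
    then show ?thesis
      using x by (intro I.eq_if_arbitrarily_close[where C = 0]) auto
  qed
  have "S \<in> bounded_ops H I"
  proof (rule bounded_opsI[where B = B])
    fix h k assume h: "h \<in> carrier H" and k: "k \<in> carrier H"
    show "S (h \<oplus>\<^bsub>H\<^esub> k) = S h \<oplus>\<^bsub>I\<^esub> S k"
    \<comment> \<open>The passage from S (h + k) to f z and the one from f z to S h + S k each cost
      at most 2 B \<epsilon>.\<close>
    proof (rule I.eq_if_arbitrarily_close[where C = "4 * B"])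
      fix \<epsilon> :: real assume "\<epsilon> > 0"
      then obtain x y where x: "x \<in> X" "hnorm H (h \<ominus>\<^bsub>H\<^esub> e x) < \<epsilon>" and y: "y \<in> X" "hnorm H (k \<ominus>\<^bsub>H\<^esub> e y) < \<epsilon>"
        using e_dense[OF h] e_dense[OF k] by blast
      obtain z where z: "z \<in> X" "e z = e x \<oplus>\<^bsub>H\<^esub> e y" "f z = f x \<oplus>\<^bsub>I\<^esub> f y"
        using add x y by blast
      have 0: "hnorm H ((h \<oplus>\<^bsub>H\<^esub> k) \<ominus>\<^bsub>H\<^esub> e z) \<le> hnorm H (h \<ominus>\<^bsub>H\<^esub> e x) + hnorm H (k \<ominus>\<^bsub>H\<^esub> e y)"
        using h k x y hnorm_triangle[of "h \<ominus>\<^bsub>H\<^esub> e x" "k \<ominus>\<^bsub>H\<^esub> e y"] by (simp add: z diff_add_diff)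
      have 1: "hnorm I (S (h \<oplus>\<^bsub>H\<^esub> k) \<ominus>\<^bsub>I\<^esub> f z) \<le> B * (\<epsilon> + \<epsilon>)"
        using SB[of "h \<oplus>\<^bsub>H\<^esub> k" z] h k z(1) 0 x y B
        by (smt (verit, ccfv_SIG) M.a_closed mult_left_mono)
      have "hnorm I (f z \<ominus>\<^bsub>I\<^esub> (S h \<oplus>\<^bsub>I\<^esub> S k)) \<le> hnorm I (f x \<ominus>\<^bsub>I\<^esub> S h) + hnorm I (f y \<ominus>\<^bsub>I\<^esub> S k)"
        using h k x y I.hnorm_triangle[of "f x \<ominus>\<^bsub>I\<^esub> S h" "f y \<ominus>\<^bsub>I\<^esub> S k"] by (simp add: z I.diff_add_diff)
      also have "\<dots> = hnorm I (S h \<ominus>\<^bsub>I\<^esub> f x) + hnorm I (S k \<ominus>\<^bsub>I\<^esub> f y)"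
        using h k x y by (simp add: I.hnorm_diff_sym)
      also have "\<dots> \<le> B * hnorm H (h \<ominus>\<^bsub>H\<^esub> e x) + B * hnorm H (k \<ominus>\<^bsub>H\<^esub> e y)"
        using SB h k x y by (intro add_mono) auto
      also have "\<dots> \<le> B * \<epsilon> + B * \<epsilon>"
        using x y B by (intro add_mono mult_left_mono) auto
      finally have "hnorm I (f z \<ominus>\<^bsub>I\<^esub> (S h \<oplus>\<^bsub>I\<^esub> S k)) \<le> B * \<epsilon> + B * \<epsilon>" .
      then show "hnorm I (S (h \<oplus>\<^bsub>H\<^esub> k) \<ominus>\<^bsub>I\<^esub> (S h \<oplus>\<^bsub>I\<^esub> S k)) \<le> 4 * B * \<epsilon>"
        using 1 I.hnorm_diff_triangle[of "S (h \<oplus>\<^bsub>H\<^esub> k)" "f z" "S h \<oplus>\<^bsub>I\<^esub> S k"] h k z(1)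
        by (simp add: distrib_left)
    qed (use h k B in auto)
  next
    fix c h assume h: "h \<in> carrier H"
    show "S (c \<odot>\<^bsub>H\<^esub> h) = c \<odot>\<^bsub>I\<^esub> S h"
    proof (rule I.eq_if_arbitrarily_close[where C = "2 * (cmod c * B)"])
      fix \<epsilon> :: real assume "\<epsilon> > 0"
      then obtain x where x: "x \<in> X" "hnorm H (h \<ominus>\<^bsub>H\<^esub> e x) < \<epsilon>" using e_dense[OF h] by blast
      obtain z where z: "z \<in> X" "e z = c \<odot>\<^bsub>H\<^esub> e x" "f z = c \<odot>\<^bsub>I\<^esub> f x"
        using smult x by blast
      have "hnorm I (S (c \<odot>\<^bsub>H\<^esub> h) \<ominus>\<^bsub>I\<^esub> f z) \<le> B * (cmod c * hnorm H (h \<ominus>\<^bsub>H\<^esub> e x))"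
        using SB[of "c \<odot>\<^bsub>H\<^esub> h" z] h x z(1) by (simp add: z hnorm_smult flip: smult_diff)
      moreover have "hnorm I (f z \<ominus>\<^bsub>I\<^esub> c \<odot>\<^bsub>I\<^esub> S h) = cmod c * hnorm I (S h \<ominus>\<^bsub>I\<^esub> f x)"
        using h x I.hnorm_diff_sym[of "f x" "S h"] by (simp add: z I.hnorm_smult flip: I.smult_diff)
      moreover have "cmod c * hnorm I (S h \<ominus>\<^bsub>I\<^esub> f x) \<le> cmod c * (B * hnorm H (h \<ominus>\<^bsub>H\<^esub> e x))"
        using SB[OF h x(1)] by (intro mult_left_mono) auto
      moreover have "hnorm I (S (c \<odot>\<^bsub>H\<^esub> h) \<ominus>\<^bsub>I\<^esub> c \<odot>\<^bsub>I\<^esub> S h) \<le>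
          hnorm I (S (c \<odot>\<^bsub>H\<^esub> h) \<ominus>\<^bsub>I\<^esub> f z) + hnorm I (f z \<ominus>\<^bsub>I\<^esub> c \<odot>\<^bsub>I\<^esub> S h)"
        using h z(1) by (intro I.hnorm_diff_triangle) auto
      ultimately have "hnorm I (S (c \<odot>\<^bsub>H\<^esub> h) \<ominus>\<^bsub>I\<^esub> c \<odot>\<^bsub>I\<^esub> S h) \<le> 2 * (cmod c * B) * hnorm H (h \<ominus>\<^bsub>H\<^esub> e x)"
        by (simp add: mult_ac)
      also have "\<dots> \<le> 2 * (cmod c * B) * \<epsilon>" using x B by (intro mult_left_mono) auto
      finally show "hnorm I (S (c \<odot>\<^bsub>H\<^esub> h) \<ominus>\<^bsub>I\<^esub> c \<odot>\<^bsub>I\<^esub> S h) \<le> 2 * (cmod c * B) * \<epsilon>" .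
    qed (use h B in auto)
  next
    fix h assume h: "h \<in> carrier H"
    show "hnorm I (S h) \<le> B * hnorm H h"
    proof (rule field_le_epsilon)
      fix \<epsilon> :: real assume \<epsilon>: "\<epsilon> > 0"
      \<comment> \<open>An error B d arises twice, in replacing S h by f x and in replacing e x by
        h; the added 1 keeps the divisor positive.\<close>
      then have "\<epsilon> / (2 * B + 1) > 0" using B by simp
      then obtain x where x: "x \<in> X" "hnorm H (h \<ominus>\<^bsub>H\<^esub> e x) < \<epsilon> / (2 * B + 1)" using e_dense[OF h] by blast
      let ?d = "hnorm H (h \<ominus>\<^bsub>H\<^esub> e x)"
      have "?d * (2 * B + 1) < \<epsilon>" using x(2) B by (simp add: pos_less_divide_eq)
      moreover have "0 \<le> ?d" using h x(1) by simp
      ultimately have 1: "B * ?d + B * ?d \<le> \<epsilon>" by (simp add: distrib_left mult_ac)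
      have "hnorm H (e x) \<le> hnorm H h + ?d"
        using h x(1) hnorm_triangle3[of "e x" h] hnorm_diff_sym[of h "e x"] by simp
      then have "B * hnorm H (e x) \<le> B * hnorm H h + B * ?d"
        using B by (simp add: mult_left_mono flip: distrib_left)
      moreover have "hnorm I (S h) \<le> hnorm I (f x) + hnorm I (S h \<ominus>\<^bsub>I\<^esub> f x)"
        using h x(1) by (intro I.hnorm_triangle3) auto
      ultimately show "hnorm I (S h) \<le> B * hnorm H h + \<epsilon>"
        using SB[OF h x(1)] bound[OF x(1)] 1 by linarith
    qed
  qed (auto simp: S_def S0)
  then show ?thesis using that Se by blast
qed

end

section \<open>The Stinespring representation\<close>

locale stinespring_construction =
  fixes A :: "'a normed_star_algebra" and K :: "'k inner_space" and \<phi> :: "'a \<Rightarrow> 'k \<Rightarrow> 'k"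
  assumes cstar: "cstar_algebra A" and ocp: "ocp_map A (K, \<phi>)"
begin

lemma hilbert_K: "hilbert_space K" and cp: "cp_map A (op_algebra K) \<phi>"
  using ocp by auto

sublocale AG: abelian_group A
  by (rule cstar_algebra.abelian_group_A[OF cstar])

sublocale A: cstar_algebra A
  by (rule cstar)

sublocale K: hilbert_space K
  by (rule hilbert_K)

sublocale T: tensor_product A K ..

abbreviation "Hs \<equiv> stine_space A (K, \<phi>)"
abbreviation "Pre \<equiv> stine_pre A (K, \<phi>)"

lemma tensor_sum_eq: "tensor_sum A K n a v = T.tsum n a v"
  by (simp add: tensor_sum_def T.tsum_def)

lemma mult_closed [simp, intro]: "x \<in> carrier A \<Longrightarrow> y \<in> carrier A \<Longrightarrow> x \<otimes>\<^bsub>A\<^esub> y \<in> carrier A"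
  using A.A_simprules(5) .

lemma one_closed [simp, intro]: "\<one>\<^bsub>A\<^esub> \<in> carrier A"
  using A.A_simprules(6) .

lemma star_closed [simp, intro]: "x \<in> carrier A \<Longrightarrow> star A x \<in> carrier A"
  by (rule A.star_closed)

lemma phi_bounded [simp, intro]: "x \<in> carrier A \<Longrightarrow> \<phi> x \<in> bounded_ops K K"
  using cp by (auto simp: cp_map_def)

lemma phi_closed [simp, intro]: "x \<in> carrier A \<Longrightarrow> v \<in> carrier K \<Longrightarrow> \<phi> x v \<in> carrier K"
  using bounded_ops_closed[OF phi_bounded] .

lemma phi_add: "x \<in> carrier A \<Longrightarrow> y \<in> carrier A \<Longrightarrow> v \<in> carrier K \<Longrightarrow> \<phi> (x \<oplus>\<^bsub>A\<^esub> y) v = \<phi> x v \<oplus>\<^bsub>K\<^esub> \<phi> y v"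
  using cp by (auto simp: cp_map_def)

lemma phi_smult: "x \<in> carrier A \<Longrightarrow> v \<in> carrier K \<Longrightarrow> \<phi> (c \<odot>\<^bsub>A\<^esub> x) v = c \<odot>\<^bsub>K\<^esub> \<phi> x v"
  using cp by (auto simp: cp_map_def)

text \<open>Complete positivity for the pair (a, b): in a Gram factorisation of the 2 by 2 matrix
  the off-diagonal entries are visibly conjugate.\<close>

lemma phi_cnj:
  assumes a: "a \<in> carrier A" and b: "b \<in> carrier A" and v: "v \<in> carrier K" and w: "w \<in> carrier K"
  shows "inprod K w (\<phi> (star A b \<otimes>\<^bsub>A\<^esub> a) v) = cnj (inprod K v (\<phi> (star A a \<otimes>\<^bsub>A\<^esub> b) w))"
proof -
  define c where "c i = (if i = 0 then a else b)" for i :: nat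
  have c: "c \<in> {..<2} \<rightarrow> carrier A" using a b by (auto simp: c_def)
  obtain Z :: "nat \<Rightarrow> nat \<Rightarrow> 'k \<Rightarrow> 'k" where Z: "\<And>k i. k < 2 \<Longrightarrow> i < 2 \<Longrightarrow> Z k i \<in> bounded_ops K K"
    and G: "\<And>i j v w. \<lbrakk>i < 2; j < 2; v \<in> carrier K; w \<in> carrier K\<rbrakk> \<Longrightarrow>
      inprod K v (\<phi> (star A (c i) \<otimes>\<^bsub>A\<^esub> c j) w) = (\<Sum>k<2. inprod K (Z k i v) (Z k j w))"
    by (rule cp_map_Gram[OF cstar hilbert_K cp c]) blast
  have cj: "inprod K (Z k 1 w) (Z k 0 v) = cnj (inprod K (Z k 0 v) (Z k 1 w))" if "k < 2" for k
    using that v w by (intro K.inprod_cnj bounded_ops_closed[OF Z]) auto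
  have "inprod K w (\<phi> (star A b \<otimes>\<^bsub>A\<^esub> a) v) = (\<Sum>k<2. inprod K (Z k 1 w) (Z k 0 v))"
    using G[of 1 0 w v] v w by (simp add: c_def)
  also have "\<dots> = (\<Sum>k<2. cnj (inprod K (Z k 0 v) (Z k 1 w)))"
    using cj by (intro sum.cong) auto
  also have "\<dots> = cnj (inprod K v (\<phi> (star A a \<otimes>\<^bsub>A\<^esub> b) w))"
    using G[of 0 1 v w] v w by (simp add: c_def)
  finally show ?thesis .
qed

text \<open>With a = 1 in \<open>phi_cnj\<close>, phi preserves adjoints. This is what lets T* T
  commute with phi.\<close>

lemma phi_selfadjoint:
  assumes "x \<in> carrier A" "v \<in> carrier K" "w \<in> carrier K"
  shows "inprod K (\<phi> (star A x) v) w = inprod K v (\<phi> x w)"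
proof -
  have "inprod K w (\<phi> (star A x) v) = cnj (inprod K v (\<phi> x w))"
    using phi_cnj[of "\<one>\<^bsub>A\<^esub>" x v w] assms A.A_simprules by simp
  then show ?thesis
    using K.inprod_cnj[of w "\<phi> (star A x) v"] assms by simp
qed

text \<open>Stinespring's form evaluated on representing families, before it is known to depend only
  on the tensors.\<close>

definition form :: "nat \<Rightarrow> (nat \<Rightarrow> 'a) \<Rightarrow> (nat \<Rightarrow> 'k) \<Rightarrow> nat \<Rightarrow> (nat \<Rightarrow> 'a) \<Rightarrow> (nat \<Rightarrow> 'k) \<Rightarrow> complex"
  where "form n a v m b w = (\<Sum>i<n. \<Sum>j<m. inprod K (v i) (\<phi> (star A (a i) \<otimes>\<^bsub>A\<^esub> b j) (w j)))"

text \<open>For a fixed left family the double sum is a bilinear functional of the right-hand pairs,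
  so the universal property of the tensor product applies.\<close>

lemma form_right_cong:
  assumes a: "a \<in> {..<n} \<rightarrow> carrier A" and v: "v \<in> {..<n} \<rightarrow> carrier K"
    and b: "b \<in> {..<m} \<rightarrow> carrier A" and w: "w \<in> {..<m} \<rightarrow> carrier K"
    and b': "b' \<in> {..<m'} \<rightarrow> carrier A" and w': "w' \<in> {..<m'} \<rightarrow> carrier K"
    and eq: "T.tsum m b w = T.tsum m' b' w'"
  shows "form n a v m b w = form n a v m' b' w'"
proof -
  note [simp] = Pi_mem[OF a, simplified] Pi_mem[OF v, simplified]
  interpret bilinear_functional A K "\<lambda>b w. \<Sum>i<n. inprod K (v i) (\<phi> (star A (a i) \<otimes>\<^bsub>A\<^esub> b) w)"
  proof
    fix x x' y assume "x \<in> carrier A" "x' \<in> carrier A" "y \<in> carrier K"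
    then show "(\<Sum>i<n. inprod K (v i) (\<phi> (star A (a i) \<otimes>\<^bsub>A\<^esub> (x \<oplus>\<^bsub>A\<^esub> x')) y)) =
      (\<Sum>i<n. inprod K (v i) (\<phi> (star A (a i) \<otimes>\<^bsub>A\<^esub> x) y)) + (\<Sum>i<n. inprod K (v i) (\<phi> (star A (a i) \<otimes>\<^bsub>A\<^esub> x') y))"
      by (simp add: A.A_simprules(23) phi_add K.inprod_add_right sum.distrib)
  next
    fix x y y' assume "x \<in> carrier A" "y \<in> carrier K" "y' \<in> carrier K"
    then show "(\<Sum>i<n. inprod K (v i) (\<phi> (star A (a i) \<otimes>\<^bsub>A\<^esub> x) (y \<oplus>\<^bsub>K\<^esub> y'))) =
      (\<Sum>i<n. inprod K (v i) (\<phi> (star A (a i) \<otimes>\<^bsub>A\<^esub> x) y)) + (\<Sum>i<n. inprod K (v i) (\<phi> (star A (a i) \<otimes>\<^bsub>A\<^esub> x) y'))"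
      by (simp add: bounded_ops_add[OF phi_bounded] K.inprod_add_right sum.distrib)
  next
    fix c x y assume "x \<in> carrier A" "y \<in> carrier K"
    then show "(\<Sum>i<n. inprod K (v i) (\<phi> (star A (a i) \<otimes>\<^bsub>A\<^esub> (c \<odot>\<^bsub>A\<^esub> x)) y)) =
      c * (\<Sum>i<n. inprod K (v i) (\<phi> (star A (a i) \<otimes>\<^bsub>A\<^esub> x) y))"
      by (simp add: A.smult_mult_right phi_smult K.inprod_smult_right sum_distrib_left)
  next
    fix c x y assume "x \<in> carrier A" "y \<in> carrier K"
    then show "(\<Sum>i<n. inprod K (v i) (\<phi> (star A (a i) \<otimes>\<^bsub>A\<^esub> x) (c \<odot>\<^bsub>K\<^esub> y))) =
      c * (\<Sum>i<n. inprod K (v i) (\<phi> (star A (a i) \<otimes>\<^bsub>A\<^esub> x) y))"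
      by (simp add: bounded_ops_smult[OF phi_bounded] K.inprod_smult_right sum_distrib_left)
  qed
  have "form n a v m b w = (\<Sum>j<m. \<Sum>i<n. inprod K (v i) (\<phi> (star A (a i) \<otimes>\<^bsub>A\<^esub> b j) (w j)))"
    unfolding form_def by (rule sum.swap)
  also have "\<dots> = (\<Sum>j<m'. \<Sum>i<n. inprod K (v i) (\<phi> (star A (a i) \<otimes>\<^bsub>A\<^esub> b' j) (w' j)))"
    by (rule tsum_functional[OF b w b' w' eq])
  also have "\<dots> = form n a v m' b' w'"
    unfolding form_def by (rule sum.swap)
  finally show ?thesis .
qed

lemma form_cnj:
  assumes a: "a \<in> {..<n} \<rightarrow> carrier A" and v: "v \<in> {..<n} \<rightarrow> carrier K"
    and b: "b \<in> {..<m} \<rightarrow> carrier A" and w: "w \<in> {..<m} \<rightarrow> carrier K"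
  shows "form m b w n a v = cnj (form n a v m b w)"
proof -
  have "form m b w n a v = (\<Sum>j<m. \<Sum>i<n. cnj (inprod K (v i) (\<phi> (star A (a i) \<otimes>\<^bsub>A\<^esub> b j) (w j))))"
    unfolding form_def using a v b w by (intro sum.cong refl phi_cnj) auto
  also have "\<dots> = cnj (form n a v m b w)"
    unfolding form_def by (simp, rule sum.swap)
  finally show ?thesis .
qed

text \<open>The form is conjugate linear on the left, where the universal property does not apply
  directly; conjugate symmetry reduces this side to the right one.\<close>

lemma form_cong:
  assumes "a \<in> {..<n} \<rightarrow> carrier A" "v \<in> {..<n} \<rightarrow> carrier K" "a' \<in> {..<n'} \<rightarrow> carrier A" "v' \<in> {..<n'} \<rightarrow> carrier K"
    and "b \<in> {..<m} \<rightarrow> carrier A" "w \<in> {..<m} \<rightarrow> carrier K" "b' \<in> {..<m'} \<rightarrow> carrier A" "w' \<in> {..<m'} \<rightarrow> carrier K"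
    and "T.tsum n a v = T.tsum n' a' v'" "T.tsum m b w = T.tsum m' b' w'"
  shows "form n a v m b w = form n' a' v' m' b' w'"
proof -
  have "form n a v m b w = form n a v m' b' w'"
    using assms by (intro form_right_cong)
  also have "\<dots> = cnj (form m' b' w' n a v)"
    using assms by (intro form_cnj)
  also have "form m' b' w' n a v = form m' b' w' n' a' v'"
    using assms by (intro form_right_cong)
  also have "cnj (form m' b' w' n' a' v') = form n' a' v' m' b' w'"
    using assms by (intro form_cnj[symmetric])
  finally show ?thesis .
qed

text \<open>A Gram factorisation of the matrix of all phi(a_i* a_j) rewrites the form as the sum
  over k of the squared norms of the vectors sum_i Z_ki v_i.\<close>

lemma form_nonneg:
  assumes a: "a \<in> {..<n} \<rightarrow> carrier A" and v: "v \<in> {..<n} \<rightarrow> carrier K"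
  shows "0 \<le> Re (form n a v n a v)"
proof -
  obtain Z where Z: "\<And>k i. k < n \<Longrightarrow> i < n \<Longrightarrow> Z k i \<in> bounded_ops K K"
    and G: "\<And>i j v w. \<lbrakk>i < n; j < n; v \<in> carrier K; w \<in> carrier K\<rbrakk> \<Longrightarrow>
      inprod K v (\<phi> (star A (a i) \<otimes>\<^bsub>A\<^esub> a j) w) = (\<Sum>k<n. inprod K (Z k i v) (Z k j w))"
    by (rule cp_map_Gram[OF cstar hilbert_K cp a]) blast
  have Zv: "(\<lambda>i. Z k i (v i)) \<in> {..<n} \<rightarrow> carrier K" if "k < n" for k
    using that v by (auto intro!: bounded_ops_closed[OF Z])
  let ?s = "\<lambda>k. \<Oplus>\<^bsub>K\<^esub>i\<in>{..<n}. Z k i (v i)"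
  have sc: "?s k \<in> carrier K" if "k < n" for k
    using Zv[OF that] by (rule K.finsum_closed)
  have "form n a v n a v = (\<Sum>i<n. \<Sum>j<n. \<Sum>k<n. inprod K (Z k i (v i)) (Z k j (v j)))"
    unfolding form_def using v by (intro sum.cong refl G) auto
  also have "\<dots> = (\<Sum>i<n. \<Sum>k<n. \<Sum>j<n. inprod K (Z k i (v i)) (Z k j (v j)))"
    by (intro sum.cong refl sum.swap)
  also have "\<dots> = (\<Sum>k<n. \<Sum>i<n. \<Sum>j<n. inprod K (Z k i (v i)) (Z k j (v j)))"
    by (rule sum.swap)
  also have "\<dots> = (\<Sum>k<n. inprod K (?s k) (?s k))"
  proof (intro sum.cong refl)
    fix k assume "k \<in> {..<n}"
    then have k: "k < n" by simp
    have "inprod K (?s k) (?s k) = (\<Sum>i<n. inprod K (Z k i (v i)) (?s k))"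
      by (intro K.inprod_finsum_left finite_lessThan sc Zv k)
    also have "\<dots> = (\<Sum>i<n. \<Sum>j<n. inprod K (Z k i (v i)) (Z k j (v j)))"
      using Zv[OF k] by (intro sum.cong refl K.inprod_finsum_right) auto
    finally show "(\<Sum>i<n. \<Sum>j<n. inprod K (Z k i (v i)) (Z k j (v j))) = inprod K (?s k) (?s k)" by simp
  qed
  finally show ?thesis using sc by (auto intro!: sum_nonneg K.inprod_nonneg)
qed

lemma stine_form_tsum:
  assumes "a \<in> {..<n} \<rightarrow> carrier A" "v \<in> {..<n} \<rightarrow> carrier K"
    and "b \<in> {..<m} \<rightarrow> carrier A" "w \<in> {..<m} \<rightarrow> carrier K"
  shows "stine_form A (K, \<phi>) (T.tsum n a v) (T.tsum m b w) = form n a v m b w"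
  unfolding stine_form_def prod.case tensor_sum_eq form_def[symmetric]
proof (rule the_equality)
  show "\<forall>n' m' a' v' b' w'. a' \<in> {..<n'} \<rightarrow> carrier A \<longrightarrow> v' \<in> {..<n'} \<rightarrow> carrier K \<longrightarrow>
    b' \<in> {..<m'} \<rightarrow> carrier A \<longrightarrow> w' \<in> {..<m'} \<rightarrow> carrier K \<longrightarrow>
    T.tsum n a v = T.tsum n' a' v' \<longrightarrow> T.tsum m b w = T.tsum m' b' w' \<longrightarrow> form n' a' v' m' b' w' = form n a v m b w"
    by (intro allI impI form_cong[symmetric] assms)
qed (use assms in blast)

section \<open>The pre-Hilbert space of tensors and its completion\<close>

lemma Pre_sel [simp]:
  "carrier Pre = carrier (tensor A K)" "\<zero>\<^bsub>Pre\<^esub> = \<zero>\<^bsub>tensor A K\<^esub>"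
  "add Pre = add (tensor A K)" "smult Pre = smult (tensor A K)"
  "inprod Pre = stine_form A (K, \<phi>)"
  by (simp_all add: stine_pre_def module.defs inner_space.defs)

lemma module_Pre: "Module.module complex_ring Pre"
  by (rule module_image[where M = "tensor A K" and q = "\<lambda>x. x", OF T.T.module_axioms]) simp_all

sublocale Pre: pre_hilbert Pre
proof (intro pre_hilbert.intro semi_inner_space.intro semi_inner_space_axioms.intro module_Pre)
  fix x y z c assume x: "x \<in> carrier Pre"
  then obtain n a v where x: "a \<in> {..<n} \<rightarrow> carrier A" "v \<in> {..<n} \<rightarrow> carrier K" "x = T.tsum n a v"
    by (auto elim: T.tensor_tsumE)
  show "0 \<le> Re (inprod Pre x x)"
    using x by (simp add: stine_form_tsum form_nonneg)
  assume y: "y \<in> carrier Pre"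
  then obtain m b w where y: "b \<in> {..<m} \<rightarrow> carrier A" "w \<in> {..<m} \<rightarrow> carrier K" "y = T.tsum m b w"
    by (auto elim: T.tensor_tsumE)
  show "inprod Pre y x = cnj (inprod Pre x y)"
    using x y by (simp add: stine_form_tsum form_cnj[of a n v])
  have cb: "(\<lambda>i. c \<odot>\<^bsub>A\<^esub> b i) \<in> {..<m} \<rightarrow> carrier A" using y(1) by auto
  have "form n a v m (\<lambda>i. c \<odot>\<^bsub>A\<^esub> b i) w = c * form n a v m b w"
    unfolding form_def sum_distrib_left using x y
    by (intro sum.cong refl) (auto simp: A.smult_mult_right phi_smult K.inprod_smult_right Pi_iff)
  then show "inprod Pre x (c \<odot>\<^bsub>Pre\<^esub> y) = c * inprod Pre x y"
    using x y cb by (simp add: stine_form_tsum flip: T.tsum_smult)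
  assume z: "z \<in> carrier Pre"
  then obtain l d u where z: "d \<in> {..<l} \<rightarrow> carrier A" "u \<in> {..<l} \<rightarrow> carrier K" "z = T.tsum l d u"
    by (auto elim: T.tensor_tsumE)
  have "form n a v (m + l) (cat m b d) (cat m w u) = form n a v m b w + form n a v l d u"
    by (simp add: form_def sum_lessThan_add sum.distrib)
  then show "inprod Pre x (y \<oplus>\<^bsub>Pre\<^esub> z) = inprod Pre x y + inprod Pre x z"
    using x y z cat_closed[OF y(1) z(1)] cat_closed[OF y(2) z(2)]
    by (simp add: stine_form_tsum flip: T.tsum_add)
qed

sublocale Comp: inner_space_completion "separation Pre"
  by (intro inner_space_completion.intro Pre.inner_product_space_separation)

lemma stine_space_eq: "Hs = completion (separation Pre)"
  by (simp add: stine_space_def)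

lemma hilbert_space_H: "hilbert_space Hs"
  unfolding stine_space_eq by (rule Comp.hilbert_space_completion)

sublocale H: hilbert_space Hs
  by (rule hilbert_space_H)

section \<open>Classes of tensors in the completion\<close>

abbreviation "cl \<equiv> stine_class A (K, \<phi>)"

lemma cl_eq: "cl z = Comp.const_class (Pre.sep_class z)"
  by (simp add: stine_class_def)

lemma sep_closed: "z \<in> carrier (tensor A K) \<Longrightarrow> Pre.sep_class z \<in> carrier (separation Pre)"
  by (simp add: Pre.sep_carrier)

lemma cl_closed [simp, intro]: "z \<in> carrier (tensor A K) \<Longrightarrow> cl z \<in> carrier Hs"
  unfolding cl_eq stine_space_eq by (intro Comp.const_class_closed sep_closed)

lemma cl_add: "z \<in> carrier (tensor A K) \<Longrightarrow> y \<in> carrier (tensor A K) \<Longrightarrow>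
    cl (z \<oplus>\<^bsub>tensor A K\<^esub> y) = cl z \<oplus>\<^bsub>Hs\<^esub> cl y"
  unfolding cl_eq stine_space_eq
  using Comp.const_class_add[OF sep_closed sep_closed, of z y] Pre.sep_add[of z y] by simp

lemma cl_smult: "z \<in> carrier (tensor A K) \<Longrightarrow> cl (c \<odot>\<^bsub>tensor A K\<^esub> z) = c \<odot>\<^bsub>Hs\<^esub> cl z"
  unfolding cl_eq stine_space_eq
  using Comp.const_class_smult[OF sep_closed, of z c] Pre.sep_smult[of z c] by simp

lemma cl_inprod: "z \<in> carrier (tensor A K) \<Longrightarrow> y \<in> carrier (tensor A K) \<Longrightarrow>
    inprod Hs (cl z) (cl y) = stine_form A (K, \<phi>) z y"
  unfolding cl_eq stine_space_eq
  using Comp.const_class_inprod[OF sep_closed sep_closed, of z y] Pre.inprod_sep_class[of z y] by simp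

text \<open>The index set of the dense family. Entries from position n on are arbitrary, so a tensor
  has many indices even for one choice of summands.\<close>

definition reps :: "(nat \<times> (nat \<Rightarrow> 'a) \<times> (nat \<Rightarrow> 'k)) set"
  where "reps = {(n, a, v). a \<in> {..<n} \<rightarrow> carrier A \<and> v \<in> {..<n} \<rightarrow> carrier K}"

definition E :: "nat \<times> (nat \<Rightarrow> 'a) \<times> (nat \<Rightarrow> 'k) \<Rightarrow> ('a, 'k) stine_vec"
  where "E = (\<lambda>(n, a, v). cl (T.tsum n a v))"

lemma reps_iff [simp]: "(n, a, v) \<in> reps \<longleftrightarrow> a \<in> {..<n} \<rightarrow> carrier A \<and> v \<in> {..<n} \<rightarrow> carrier K"
  by (simp add: reps_def)

lemma E_eq: "E (n, a, v) = cl (T.tsum n a v)"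
  by (simp add: E_def)

text \<open>Constant Cauchy sequences are dense in the completion, and each of them is the class of
  a finite sum of pure tensors.\<close>

sublocale E: dense_family Hs reps E
proof
  fix x assume "x \<in> reps"
  then show "E x \<in> carrier Hs" by (auto simp: reps_def E_eq T.tsum_closed)
next
  fix h and \<epsilon> :: real assume "h \<in> carrier Hs" "\<epsilon> > 0"
  then obtain s where "s \<in> carrier (separation Pre)" "hnorm Hs (h \<ominus>\<^bsub>Hs\<^esub> Comp.const_class s) < \<epsilon>"
    unfolding stine_space_eq using Comp.const_class_dense by blast
  moreover then obtain z where "z \<in> carrier (tensor A K)" "s = Pre.sep_class z"
    by (auto simp: Pre.sep_carrier)
  moreover then obtain n a v where "a \<in> {..<n} \<rightarrow> carrier A" "v \<in> {..<n} \<rightarrow> carrier K" "z = T.tsum n a v"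
    using T.tensor_tsumE by metis
  ultimately show "\<exists>x\<in>reps. hnorm Hs (h \<ominus>\<^bsub>Hs\<^esub> E x) < \<epsilon>"
    by (intro bexI[of _ "(n, a, v)"]) (simp_all add: E_eq cl_eq)
qed

lemma E_inprod: "(n, a, v) \<in> reps \<Longrightarrow> (m, b, w) \<in> reps \<Longrightarrow> inprod Hs (E (n, a, v)) (E (m, b, w)) = form n a v m b w"
  by (simp add: E_eq cl_inprod stine_form_tsum T.tsum_closed)

lemma E_add: "(n, a, v) \<in> reps \<Longrightarrow> (m, b, w) \<in> reps \<Longrightarrow>
    E (n + m, cat n a b, cat n v w) = E (n, a, v) \<oplus>\<^bsub>Hs\<^esub> E (m, b, w)"
  by (simp add: E_eq T.tsum_add cl_add T.tsum_closed)

lemma E_smult: "(n, a, v) \<in> reps \<Longrightarrow> E (n, \<lambda>i. c \<odot>\<^bsub>A\<^esub> a i, v) = c \<odot>\<^bsub>Hs\<^esub> E (n, a, v)"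
  by (simp add: E_eq T.tsum_smult cl_smult T.tsum_closed)

lemma E_cong: "(n, b, w) \<in> reps \<Longrightarrow> (\<And>i. i < n \<Longrightarrow> a i = b i) \<Longrightarrow> (\<And>i. i < n \<Longrightarrow> v i = w i) \<Longrightarrow> E (n, a, v) = E (n, b, w)"
  unfolding E_eq using T.tsum_cong[of n a b v w] by simp

lemma reps_mult: "a \<in> carrier A \<Longrightarrow> (n, b, v) \<in> reps \<Longrightarrow> (n, \<lambda>i. a \<otimes>\<^bsub>A\<^esub> b i, v) \<in> reps"
  by auto

text \<open>If \<open>1 - a\<^sup>* a = c\<^sup>* c\<close>, then \<open>\<parallel>a \<zeta>\<parallel>\<^sup>2 + \<parallel>c \<zeta>\<parallel>\<^sup>2 = \<parallel>\<zeta>\<parallel>\<^sup>2\<close>.\<close>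

lemma E_mult_contraction:
  assumes a: "a \<in> carrier A" "algnorm A a < 1" and x: "(n, b, v) \<in> reps"
  shows "hnorm Hs (E (n, \<lambda>i. a \<otimes>\<^bsub>A\<^esub> b i, v)) \<le> hnorm Hs (E (n, b, v))"
proof (rule power2_le_imp_le)
  obtain c where c: "c \<in> carrier A" "star A c \<otimes>\<^bsub>A\<^esub> c = \<one>\<^bsub>A\<^esub> \<ominus>\<^bsub>A\<^esub> star A a \<otimes>\<^bsub>A\<^esub> a"
    using A.one_minus_star_mult[OF a] by blast
  have b: "b i \<in> carrier A" "v i \<in> carrier K" if "i < n" for i using x that by auto
  have key: "star A (a \<otimes>\<^bsub>A\<^esub> b i) \<otimes>\<^bsub>A\<^esub> (a \<otimes>\<^bsub>A\<^esub> b j) \<oplus>\<^bsub>A\<^esub> star A (c \<otimes>\<^bsub>A\<^esub> b i) \<otimes>\<^bsub>A\<^esub> (c \<otimes>\<^bsub>A\<^esub> b j) = star A (b i) \<otimes>\<^bsub>A\<^esub> b j"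
    if ij: "i < n" "j < n" for i j
  proof -
    have ass: "star A (x \<otimes>\<^bsub>A\<^esub> b i) \<otimes>\<^bsub>A\<^esub> (x \<otimes>\<^bsub>A\<^esub> b j) = star A (b i) \<otimes>\<^bsub>A\<^esub> ((star A x \<otimes>\<^bsub>A\<^esub> x) \<otimes>\<^bsub>A\<^esub> b j)" if "x \<in> carrier A" for x
      using b[OF ij(1)] b[OF ij(2)] that by (simp add: A.star_mult A.A_simprules(11))
    have "star A a \<otimes>\<^bsub>A\<^esub> a \<oplus>\<^bsub>A\<^esub> star A c \<otimes>\<^bsub>A\<^esub> c = \<one>\<^bsub>A\<^esub>"
      unfolding c(2) using a(1) by (simp add: a_minus_def A.A_simprules)
    then have "(star A a \<otimes>\<^bsub>A\<^esub> a) \<otimes>\<^bsub>A\<^esub> b j \<oplus>\<^bsub>A\<^esub> (star A c \<otimes>\<^bsub>A\<^esub> c) \<otimes>\<^bsub>A\<^esub> b j = b j"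
      using a(1) c(1) b[OF ij(2)] by (simp add: A.A_simprules(12) flip: A.A_simprules(13))
    then show ?thesis
      using a(1) c(1) b[OF ij(1)] b[OF ij(2)] by (simp add: ass flip: A.A_simprules(23))
  qed
  have "form n b v n b v = form n (\<lambda>i. a \<otimes>\<^bsub>A\<^esub> b i) v n (\<lambda>i. a \<otimes>\<^bsub>A\<^esub> b i) v + form n (\<lambda>i. c \<otimes>\<^bsub>A\<^esub> b i) v n (\<lambda>i. c \<otimes>\<^bsub>A\<^esub> b i) v"
    unfolding form_def sum.distrib[symmetric]
  proof (intro sum.cong refl)
    fix i j assume "i \<in> {..<n}" "j \<in> {..<n}"
    then have ij: "i < n" "j < n" by auto
    show "inprod K (v i) (\<phi> (star A (b i) \<otimes>\<^bsub>A\<^esub> b j) (v j)) =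
      inprod K (v i) (\<phi> (star A (a \<otimes>\<^bsub>A\<^esub> b i) \<otimes>\<^bsub>A\<^esub> (a \<otimes>\<^bsub>A\<^esub> b j)) (v j)) +
      inprod K (v i) (\<phi> (star A (c \<otimes>\<^bsub>A\<^esub> b i) \<otimes>\<^bsub>A\<^esub> (c \<otimes>\<^bsub>A\<^esub> b j)) (v j))"
      unfolding key[OF ij, symmetric]
      using a(1) c(1) b[OF ij(1)] b[OF ij(2)] by (subst phi_add) (auto simp: K.inprod_add_right)
  qed
  moreover have "0 \<le> Re (form n (\<lambda>i. c \<otimes>\<^bsub>A\<^esub> b i) v n (\<lambda>i. c \<otimes>\<^bsub>A\<^esub> b i) v)"
    using x c(1) by (intro form_nonneg) auto
  ultimately show "(hnorm Hs (E (n, \<lambda>i. a \<otimes>\<^bsub>A\<^esub> b i, v)))\<^sup>2 \<le> (hnorm Hs (E (n, b, v)))\<^sup>2"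
    using E.e_closed[OF x] E.e_closed[OF reps_mult[OF a(1) x]]
    by (simp only: H.hnorm_power2 E_inprod[OF x x] E_inprod[OF reps_mult[OF a(1) x] reps_mult[OF a(1) x]]) simp
qed (use E.e_closed[OF x] in simp)

text \<open>Dividing a by its norm plus 1 moves it strictly inside the unit ball, also when a = 0,
  so that the contraction estimate applies; the factor returns by homogeneity.\<close>

lemma E_mult_bound:
  assumes a: "a \<in> carrier A" and x: "(n, b, v) \<in> reps"
  shows "hnorm Hs (E (n, \<lambda>i. a \<otimes>\<^bsub>A\<^esub> b i, v)) \<le> (algnorm A a + 1) * hnorm Hs (E (n, b, v))"
proof -
  define r where "r = algnorm A a + 1"
  have r: "r > 0" using a by (simp add: r_def add_nonneg_pos)
  define a' where "a' = complex_of_real (1 / r) \<odot>\<^bsub>A\<^esub> a"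
  have a': "a' \<in> carrier A" using a by (simp add: a'_def)
  have "algnorm A a' = (1 / r) * algnorm A a"
    using a r by (simp add: a'_def A.algnorm_smult norm_divide)
  also have "\<dots> < 1" using r by (simp add: r_def)
  finally have n': "algnorm A a' < 1" .
  have "E (n, \<lambda>i. a \<otimes>\<^bsub>A\<^esub> b i, v) = E (n, \<lambda>i. complex_of_real r \<odot>\<^bsub>A\<^esub> (a' \<otimes>\<^bsub>A\<^esub> b i), v)"
  proof (rule E_cong)
    show "(n, \<lambda>i. complex_of_real r \<odot>\<^bsub>A\<^esub> (a' \<otimes>\<^bsub>A\<^esub> b i), v) \<in> reps" using a' x by auto
    fix i assume "i < n"
    then have bi: "b i \<in> carrier A" using x by auto
    have "complex_of_real r \<odot>\<^bsub>A\<^esub> (a' \<otimes>\<^bsub>A\<^esub> b i) = (complex_of_real r * complex_of_real (1 / r)) \<odot>\<^bsub>A\<^esub> (a \<otimes>\<^bsub>A\<^esub> b i)"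
      using A.smult_assoc1[of "complex_of_real r" "complex_of_real (1 / r)" "a \<otimes>\<^bsub>A\<^esub> b i"] a bi
      by (simp add: a'_def A.smult_mult_left)
    also have "complex_of_real r * complex_of_real (1 / r) = 1" using r by simp
    finally show "a \<otimes>\<^bsub>A\<^esub> b i = complex_of_real r \<odot>\<^bsub>A\<^esub> (a' \<otimes>\<^bsub>A\<^esub> b i)" using a bi by simp
  qed simp
  also have "\<dots> = complex_of_real r \<odot>\<^bsub>Hs\<^esub> E (n, \<lambda>i. a' \<otimes>\<^bsub>A\<^esub> b i, v)"
    by (rule E_smult[OF reps_mult[OF a' x]])
  finally have "hnorm Hs (E (n, \<lambda>i. a \<otimes>\<^bsub>A\<^esub> b i, v)) = r * hnorm Hs (E (n, \<lambda>i. a' \<otimes>\<^bsub>A\<^esub> b i, v))"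
    using E.e_closed[OF reps_mult[OF a' x]] r by (simp add: H.hnorm_smult)
  also have "\<dots> \<le> r * hnorm Hs (E (n, b, v))"
    using E_mult_contraction[OF a' n' x] r by simp
  finally show ?thesis by (simp add: r_def)
qed

section \<open>The representation by left multiplication\<close>

abbreviation "rep \<equiv> stine_rep A (K, \<phi>)"

text \<open>\<open>stine_rep\<close> is a \<open>THE\<close> over bounded operators: the bound on
  left multiplication provides existence by extension from the dense family, and density provides
  uniqueness.\<close>

lemma rep:
  assumes a: "a \<in> carrier A"
  shows rep_bounded: "rep a \<in> bounded_ops Hs Hs"
    and rep_E: "(n, b, v) \<in> reps \<Longrightarrow> rep a (E (n, b, v)) = E (n, \<lambda>i. a \<otimes>\<^bsub>A\<^esub> b i, v)"
proof -
  define f where "f = (\<lambda>(n, b, v). E (n, \<lambda>i. a \<otimes>\<^bsub>A\<^esub> b i, v))"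
  have f: "f (n, b, v) = E (n, \<lambda>i. a \<otimes>\<^bsub>A\<^esub> b i, v)" for n b v by (simp add: f_def)
  obtain P where P: "P \<in> bounded_ops Hs Hs" "\<And>x. x \<in> reps \<Longrightarrow> P (E x) = f x"
  proof (rule E.extend_bounded_op[OF hilbert_space_H, of f "algnorm A a + 1"])
    fix x assume x: "x \<in> reps"
    obtain n b v where xe: "x = (n, b, v)" by (cases x)
    show "f x \<in> carrier Hs" "hnorm Hs (f x) \<le> (algnorm A a + 1) * hnorm Hs (E x)"
      using x E.e_closed[OF reps_mult[OF a]] E_mult_bound[OF a] unfolding xe f by blast+
    fix c
    have "E (n, \<lambda>i. a \<otimes>\<^bsub>A\<^esub> (c \<odot>\<^bsub>A\<^esub> b i), v) = E (n, \<lambda>i. c \<odot>\<^bsub>A\<^esub> (a \<otimes>\<^bsub>A\<^esub> b i), v)"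
      using x a unfolding xe by (intro E_cong) (auto simp: A.smult_mult_right Pi_iff)
    then show "\<exists>z\<in>reps. E z = c \<odot>\<^bsub>Hs\<^esub> E x \<and> f z = c \<odot>\<^bsub>Hs\<^esub> f x"
      using x reps_mult[OF a] unfolding xe
      by (intro bexI[of _ "(n, \<lambda>i. c \<odot>\<^bsub>A\<^esub> b i, v)"]) (auto simp: f E_smult simp del: reps_iff, auto)
    fix y assume y: "y \<in> reps"
    obtain m d w where ye: "y = (m, d, w)" by (cases y)
    have "(\<lambda>i. a \<otimes>\<^bsub>A\<^esub> cat n b d i) = cat n (\<lambda>i. a \<otimes>\<^bsub>A\<^esub> b i) (\<lambda>i. a \<otimes>\<^bsub>A\<^esub> d i)"
      by (auto simp: cat_def)
    then have "f (n + m, cat n b d, cat n v w) = f x \<oplus>\<^bsub>Hs\<^esub> f y"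
      using E_add[OF reps_mult[OF a] reps_mult[OF a], of n b v m d w] x y unfolding xe ye by (simp add: f)
    moreover have "E (n + m, cat n b d, cat n v w) = E x \<oplus>\<^bsub>Hs\<^esub> E y"
      using E_add x y unfolding xe ye by blast
    moreover have "(n + m, cat n b d, cat n v w) \<in> reps"
      using x y unfolding xe ye by (simp add: cat_closed)
    ultimately show "\<exists>z\<in>reps. E z = E x \<oplus>\<^bsub>Hs\<^esub> E y \<and> f z = f x \<oplus>\<^bsub>Hs\<^esub> f y" by blast
  qed (use a in auto)
  have "rep a = P"
    unfolding stine_rep_def fst_conv restrict_apply if_P[OF a] tensor_sum_eq E_eq[symmetric]
  proof (rule the_equality)
    show "P \<in> bounded_ops Hs Hs \<and> (\<forall>n b v. b \<in> {..<n} \<rightarrow> carrier A \<longrightarrow> v \<in> {..<n} \<rightarrow> carrier K \<longrightarrow>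
        P (E (n, b, v)) = E (n, \<lambda>i. a \<otimes>\<^bsub>A\<^esub> b i, v))"
      using P by (auto simp: f)
    fix Q assume Q: "Q \<in> bounded_ops Hs Hs \<and> (\<forall>n b v. b \<in> {..<n} \<rightarrow> carrier A \<longrightarrow> v \<in> {..<n} \<rightarrow> carrier K \<longrightarrow>
        Q (E (n, b, v)) = E (n, \<lambda>i. a \<otimes>\<^bsub>A\<^esub> b i, v))"
    show "Q = P"
      by (rule E.dense_bounded_ops_eqI[OF _ P(1) H.inner_product_space_axioms]) (use Q P(2) in \<open>auto simp: f reps_def\<close>)
  qed
  then show "rep a \<in> bounded_ops Hs Hs" "(n, b, v) \<in> reps \<Longrightarrow> rep a (E (n, b, v)) = E (n, \<lambda>i. a \<otimes>\<^bsub>A\<^esub> b i, v)"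
    using P f by auto
qed

end

text \<open>This replaces a square root of \<open>\<parallel>P\<parallel> - P\<close> in the commutant: for \<open>t k = \<langle>x, P\<^sup>k x\<rangle>\<close> the Cauchy-Schwarz
  inequality gives \<open>(t k)\<^sup>2 \<le> t 0 * t (2 * k)\<close>, and iterating it along powers of two gives \<open>P \<le> b\<close>.\<close>

lemma powers_dominated:
  fixes t :: "nat \<Rightarrow> real"
  assumes t0: "0 \<le> t 0" and sq: "\<And>k. (t k)\<^sup>2 \<le> t 0 * t (2 * k)" and bd: "\<And>k. \<bar>t k\<bar> \<le> C * b ^ k" and b: "b > 0"
  shows "t 1 \<le> b * t 0"
proof (cases "t 0 = 0")
  case True
  then show ?thesis using sq[of 1] by simp
next
  case False
  then have p: "t 0 > 0" using t0 by simp
  define r where "r = t 1 / t 0"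
  show ?thesis
  proof (rule ccontr)
    assume "\<not> t 1 \<le> b * t 0"
    then have r: "r > b" using p by (simp add: r_def field_simps)
    \<comment> \<open>Squaring the estimate at 2^n and dividing by t 0 gives the one at 2^(n+1).
      Against the upper bound C b^(2^n) this keeps all powers of r / b > 1 below C / t 0, which is
      impossible.\<close>
    have grow: "t (2 ^ n) \<ge> r ^ (2 ^ n) * t 0" for n
    proof (induction n)
      case 0
      then show ?case using p by (simp add: r_def)
    next
      case (Suc n)
      have "(r ^ (2 ^ n) * t 0)\<^sup>2 \<le> (t (2 ^ n))\<^sup>2"
        using Suc r b p by (intro power_mono) auto
      also have "\<dots> \<le> t 0 * t (2 ^ Suc n)" using sq[of "2 ^ n"] by simp
      finally have "t 0 * (r ^ (2 ^ Suc n) * t 0) \<le> t 0 * t (2 ^ Suc n)"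
        by (simp add: power_mult_distrib power2_eq_square power_mult mult_ac)
      then show ?case using p by (simp only: mult_le_cancel_left_pos)
    qed
    have "(r / b) ^ n * t 0 \<le> C" for n
    proof -
      have "n \<le> 2 ^ n" using less_exp[of n] by simp
      then have "(r / b) ^ n \<le> (r / b) ^ (2 ^ n)" using r b by (intro power_increasing) auto
      then have "(r / b) ^ n * t 0 \<le> (r / b) ^ (2 ^ n) * t 0" using p by simp
      also have "\<dots> = r ^ (2 ^ n) * t 0 / b ^ (2 ^ n)" by (simp add: power_divide)
      also have "\<dots> \<le> C * b ^ (2 ^ n) / b ^ (2 ^ n)"
        using grow[of n] bd[of "2 ^ n"] b by (intro divide_right_mono) auto
      also have "\<dots> = C" using b by simp
      finally show ?thesis .
    qed
    moreover obtain n where "C / t 0 < (r / b) ^ n"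
      using real_arch_pow[of "r / b" "C / t 0"] r b by auto
    ultimately show False using p by (simp add: field_simps not_less[symmetric])
  qed
qed

context stinespring_construction begin

lemma form_add_right:
  assumes "(m, y, w) \<in> reps" "(n, x, v) \<in> reps" "(n, x', v) \<in> reps"
  shows "form m y w n (\<lambda>i. x i \<oplus>\<^bsub>A\<^esub> x' i) v = form m y w n x v + form m y w n x' v"
  unfolding form_def sum.distrib[symmetric] using assms
  by (intro sum.cong refl) (auto simp: Pi_iff A.A_simprules(23) phi_add K.inprod_add_right)

text \<open>Termwise addition in the algebra entries, in contrast to concatenation in
  \<open>E_add\<close>; it is what additivity of \<open>rep\<close> needs. Testing against the dense
  family replaces a computation with tensor relations.\<close>

lemma E_add_left:
  assumes x: "(n, x, v) \<in> reps" and x': "(n, x', v) \<in> reps"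
  shows "E (n, \<lambda>i. x i \<oplus>\<^bsub>A\<^esub> x' i, v) = E (n, x, v) \<oplus>\<^bsub>Hs\<^esub> E (n, x', v)"
proof (rule E.dense_inprod_eqI)
  have xx: "(n, \<lambda>i. x i \<oplus>\<^bsub>A\<^esub> x' i, v) \<in> reps" using x x' by auto
  show "E (n, \<lambda>i. x i \<oplus>\<^bsub>A\<^esub> x' i, v) \<in> carrier Hs" "E (n, x, v) \<oplus>\<^bsub>Hs\<^esub> E (n, x', v) \<in> carrier Hs"
    using E.e_closed[OF x] E.e_closed[OF x'] E.e_closed[OF xx] by simp_all
  fix z assume z: "z \<in> reps"
  obtain m y w where z': "z = (m, y, w)" by (cases z)
  show "inprod Hs (E z) (E (n, \<lambda>i. x i \<oplus>\<^bsub>A\<^esub> x' i, v)) = inprod Hs (E z) (E (n, x, v) \<oplus>\<^bsub>Hs\<^esub> E (n, x', v))"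
    using z E.e_closed[OF z] E.e_closed[OF x] E.e_closed[OF x'] x x' xx unfolding z'
    by (simp only: H.inprod_add_right E_inprod form_add_right)
qed

text \<open>Every law equates bounded operators and is therefore checked on the dense family, where
  \<open>rep\<close> multiplies the algebra entries. For adjoints it comes down to (a y_i)* x_j =
  y_i* (a* x_j) inside the form.\<close>

lemma star_hom_rep: "star_hom A (op_algebra Hs) rep"
  unfolding star_hom_def
proof (intro conjI allI ballI)
  note dense = E.dense_bounded_ops_eqI[OF _ _ H.inner_product_space_axioms]
  show "rep \<in> extensional (carrier A)" by (simp add: stine_rep_def)
  show "rep \<in> ring_hom A (op_algebra Hs)"
  proof (rule ring_hom_memI)
    fix a assume "a \<in> carrier A"
    then show "rep a \<in> carrier (op_algebra Hs)" by (simp add: rep_bounded)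
  next
    fix a b assume a: "a \<in> carrier A" and b: "b \<in> carrier A"
    have "rep (a \<otimes>\<^bsub>A\<^esub> b) = compose (carrier Hs) (rep a) (rep b)"
    proof (rule dense)
      show "compose (carrier Hs) (rep a) (rep b) \<in> bounded_ops Hs Hs"
        by (rule bounded_ops_compose[OF rep_bounded[OF b] rep_bounded[OF a]
              H.semi_inner_space_axioms H.semi_inner_space_axioms])
      fix z assume z: "z \<in> reps"
      obtain n x v where z': "z = (n, x, v)" by (cases z)
      have "E (n, \<lambda>i. a \<otimes>\<^bsub>A\<^esub> b \<otimes>\<^bsub>A\<^esub> x i, v) = E (n, \<lambda>i. a \<otimes>\<^bsub>A\<^esub> (b \<otimes>\<^bsub>A\<^esub> x i), v)"
        using z a b unfolding z' by (intro E_cong) (auto simp: A.A_simprules(11) Pi_iff)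
      then show "rep (a \<otimes>\<^bsub>A\<^esub> b) (E z) = compose (carrier Hs) (rep a) (rep b) (E z)"
        using z E.e_closed[OF z] a b reps_mult[OF b] unfolding z'
        by (simp only: compose_eq rep_E mult_closed)
    qed (use a b in \<open>simp add: rep_bounded\<close>)
    then show "rep (a \<otimes>\<^bsub>A\<^esub> b) = rep a \<otimes>\<^bsub>op_algebra Hs\<^esub> rep b" by simp
    have ab: "a \<oplus>\<^bsub>A\<^esub> b \<in> carrier A" using a b by simp
    show "rep (a \<oplus>\<^bsub>A\<^esub> b) = rep a \<oplus>\<^bsub>op_algebra Hs\<^esub> rep b"
    proof (rule dense)
      show "rep a \<oplus>\<^bsub>op_algebra Hs\<^esub> rep b \<in> bounded_ops Hs Hs"
        using abelian_monoid.a_closed[OF abelian_monoid_op_algebra[OF H.inner_product_space_axioms], of "rep a" "rep b"] a b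
        by (simp only: op_algebra_sel(1) rep_bounded)
      fix z assume z: "z \<in> reps"
      obtain n x v where z': "z = (n, x, v)" by (cases z)
      have "E (n, \<lambda>i. (a \<oplus>\<^bsub>A\<^esub> b) \<otimes>\<^bsub>A\<^esub> x i, v) = E (n, \<lambda>i. a \<otimes>\<^bsub>A\<^esub> x i \<oplus>\<^bsub>A\<^esub> b \<otimes>\<^bsub>A\<^esub> x i, v)"
        using z a b unfolding z' by (intro E_cong) (auto simp: A.A_simprules(13) Pi_iff)
      also have "\<dots> = E (n, \<lambda>i. a \<otimes>\<^bsub>A\<^esub> x i, v) \<oplus>\<^bsub>Hs\<^esub> E (n, \<lambda>i. b \<otimes>\<^bsub>A\<^esub> x i, v)"
        using z reps_mult[OF a] reps_mult[OF b] unfolding z' by (intro E_add_left)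
      finally show "rep (a \<oplus>\<^bsub>A\<^esub> b) (E z) = (rep a \<oplus>\<^bsub>op_algebra Hs\<^esub> rep b) (E z)"
        using z E.e_closed[OF z] a b ab unfolding z'
        by (simp only: op_algebra_sel restrict_apply if_True rep_E)
    qed (use ab in \<open>simp add: rep_bounded\<close>)
  next
    show "rep \<one>\<^bsub>A\<^esub> = \<one>\<^bsub>op_algebra Hs\<^esub>"
      unfolding op_algebra_sel
    proof (rule dense)
      fix z assume z: "z \<in> reps"
      obtain n x v where z': "z = (n, x, v)" by (cases z)
      have "E (n, \<lambda>i. \<one>\<^bsub>A\<^esub> \<otimes>\<^bsub>A\<^esub> x i, v) = E (n, x, v)"
        using z unfolding z' by (intro E_cong) (auto simp: A.A_simprules(12) Pi_iff)
      then show "rep \<one>\<^bsub>A\<^esub> (E z) = (\<lambda>x\<in>carrier Hs. x) (E z)"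
        using z E.e_closed[OF z] unfolding z' by (simp only: restrict_apply if_True rep_E one_closed)
    qed (auto intro: rep_bounded bounded_ops_id H.semi_inner_space_axioms)
  qed
  fix a assume a: "a \<in> carrier A"
  have adj: "adjoint_op Hs Hs (rep a) \<in> bounded_ops Hs Hs"
    by (intro adjoint_op_bounded hilbert_space_H H.inner_product_space_axioms rep_bounded a)
  show "rep (star A a) = star (op_algebra Hs) (rep a)"
    unfolding op_algebra_sel
  proof (rule dense)
    fix z assume z: "z \<in> reps"
    obtain n x v where z': "z = (n, x, v)" by (cases z)
    have r: "(n, \<lambda>i. star A a \<otimes>\<^bsub>A\<^esub> x i, v) \<in> reps" using z reps_mult[OF star_closed[OF a]] z' by blast
    have "rep (star A a) (E z) = E (n, \<lambda>i. star A a \<otimes>\<^bsub>A\<^esub> x i, v)"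
      using z a unfolding z' by (simp only: rep_E star_closed)
    also have "\<dots> = adjoint_op Hs Hs (rep a) (E z)"
    proof (rule E.dense_inprod_eqI)
      show "E (n, \<lambda>i. star A a \<otimes>\<^bsub>A\<^esub> x i, v) \<in> carrier Hs" by (rule E.e_closed[OF r])
      show "adjoint_op Hs Hs (rep a) (E z) \<in> carrier Hs" by (rule bounded_ops_closed[OF adj E.e_closed[OF z]])
      fix k assume k: "k \<in> reps"
      obtain m y w where k': "k = (m, y, w)" by (cases k)
      have "inprod Hs (E k) (adjoint_op Hs Hs (rep a) (E z)) = inprod Hs (rep a (E k)) (E z)"
        by (rule adjoint_op_inprod[OF hilbert_space_H H.inner_product_space_axioms rep_bounded[OF a] E.e_closed[OF k] E.e_closed[OF z], symmetric])
      also have "\<dots> = form m (\<lambda>i. a \<otimes>\<^bsub>A\<^esub> y i) w n x v"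
        using k z a reps_mult[OF a] unfolding k' z' by (simp only: rep_E E_inprod)
      also have "\<dots> = form m y w n (\<lambda>i. star A a \<otimes>\<^bsub>A\<^esub> x i) v"
        unfolding form_def using k z a unfolding k' z'
        by (intro sum.cong refl) (auto simp: A.star_mult A.A_simprules(11) Pi_iff)
      also have "\<dots> = inprod Hs (E k) (E (n, \<lambda>i. star A a \<otimes>\<^bsub>A\<^esub> x i, v))"
        using k r unfolding k' by (simp only: E_inprod)
      finally show "inprod Hs (E k) (E (n, \<lambda>i. star A a \<otimes>\<^bsub>A\<^esub> x i, v)) = inprod Hs (E k) (adjoint_op Hs Hs (rep a) (E z))"
        by simp
    qed
    finally show "rep (star A a) (E z) = adjoint_op Hs Hs (rep a) (E z)" .
  qed (use a adj in \<open>auto intro: rep_bounded\<close>)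
  fix c
  have ca: "c \<odot>\<^bsub>A\<^esub> a \<in> carrier A" using a by simp
  show "rep (c \<odot>\<^bsub>A\<^esub> a) = c \<odot>\<^bsub>op_algebra Hs\<^esub> rep a"
    unfolding op_algebra_sel
  proof (rule dense)
    fix z assume z: "z \<in> reps"
    obtain n x v where z': "z = (n, x, v)" by (cases z)
    have "E (n, \<lambda>i. (c \<odot>\<^bsub>A\<^esub> a) \<otimes>\<^bsub>A\<^esub> x i, v) = E (n, \<lambda>i. c \<odot>\<^bsub>A\<^esub> (a \<otimes>\<^bsub>A\<^esub> x i), v)"
      using z a unfolding z' by (intro E_cong) (auto simp: A.smult_mult_left Pi_iff)
    also have "\<dots> = c \<odot>\<^bsub>Hs\<^esub> E (n, \<lambda>i. a \<otimes>\<^bsub>A\<^esub> x i, v)"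
      using z reps_mult[OF a] unfolding z' by (intro E_smult)
    finally show "rep (c \<odot>\<^bsub>A\<^esub> a) (E z) = (\<lambda>x\<in>carrier Hs. c \<odot>\<^bsub>Hs\<^esub> rep a x) (E z)"
      using z E.e_closed[OF z] a ca unfolding z' by (simp only: restrict_apply if_True rep_E)
  qed (use a ca in \<open>auto intro: rep_bounded bounded_ops_smult_closed H.inner_product_space_axioms\<close>)
qed

section \<open>The map V, its adjoint and minimality\<close>

abbreviation "V \<equiv> stine_map A (K, \<phi>)"

lemma V_E: "w \<in> carrier K \<Longrightarrow> V w = E (1, \<lambda>_. \<one>\<^bsub>A\<^esub>, \<lambda>_. w)"
  by (simp add: stine_map_def E_eq T.tsum_1[simplified])

lemma unit_reps: "a \<in> carrier A \<Longrightarrow> w \<in> carrier K \<Longrightarrow> (1, \<lambda>_. a, \<lambda>_. w) \<in> reps"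
  by simp

lemma V_closed: "w \<in> carrier K \<Longrightarrow> V w \<in> carrier Hs"
  unfolding V_E by (rule E.e_closed[OF unit_reps[OF one_closed]])

lemma V_inprod: "w \<in> carrier K \<Longrightarrow> (n, a, v) \<in> reps \<Longrightarrow>
    inprod Hs (V w) (E (n, a, v)) = (\<Sum>j<n. inprod K w (\<phi> (a j) (v j)))"
  unfolding V_E using E_inprod[OF unit_reps[OF one_closed]]
  by (simp only:) (auto simp: form_def A.A_simprules(12) Pi_iff intro!: sum.cong)

lemma V_V_inprod: "u \<in> carrier K \<Longrightarrow> w \<in> carrier K \<Longrightarrow> inprod Hs (V u) (V w) = inprod K u (\<phi> \<one>\<^bsub>A\<^esub> w)"
  using V_inprod[OF _ unit_reps[OF one_closed], of u w] by (simp add: V_E)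

lemma V_bounded: "V \<in> bounded_ops K Hs"
proof -
  obtain B where B: "B \<ge> 0" "\<And>w. w \<in> carrier K \<Longrightarrow> hnorm K (\<phi> \<one>\<^bsub>A\<^esub> w) \<le> B * hnorm K w"
    using bounded_ops_bound[OF phi_bounded[OF one_closed] K.semi_inner_space_axioms] by blast
  show ?thesis
  \<comment> \<open>The squared norm of V w is the inner product of w with phi(1) w, so the square
    root of a bound for phi(1) serves.\<close>
  proof (rule bounded_opsI[where B = "sqrt B"])
    show "V \<in> extensional (carrier K)" by (simp add: stine_map_def)
    fix w assume w: "w \<in> carrier K"
    show "V w \<in> carrier Hs" by (rule V_closed[OF w])
    have "Re (inprod K w (\<phi> \<one>\<^bsub>A\<^esub> w)) \<le> hnorm K w * hnorm K (\<phi> \<one>\<^bsub>A\<^esub> w)"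
      using w by (intro order_trans[OF complex_Re_le_cmod K.Cauchy_Schwarz]) auto
    also have "\<dots> \<le> hnorm K w * (B * hnorm K w)"
      using B(2)[OF w] w by (intro mult_left_mono) auto
    finally have "(hnorm Hs (V w))\<^sup>2 \<le> (sqrt B * hnorm K w)\<^sup>2"
      using V_closed[OF w] V_V_inprod[OF w w] B(1)
      by (simp add: H.hnorm_power2 power_mult_distrib power2_eq_square[of "hnorm K w"] mult_ac)
    then show "hnorm Hs (V w) \<le> sqrt B * hnorm K w"
      by (rule power2_le_imp_le) (use w B(1) in simp)
    fix c
    show "V (c \<odot>\<^bsub>K\<^esub> w) = c \<odot>\<^bsub>Hs\<^esub> V w"
      using w by (simp add: stine_map_def T.pure_tensor_smult_right cl_smult)
    fix w' assume w': "w' \<in> carrier K"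
    show "V (w \<oplus>\<^bsub>K\<^esub> w') = V w \<oplus>\<^bsub>Hs\<^esub> V w'"
      using w w' by (simp add: stine_map_def T.pure_tensor_add_right cl_add)
  qed
qed

abbreviation "V_adj \<equiv> adjoint_op K Hs V"

lemma V_adj_bounded: "V_adj \<in> bounded_ops Hs K"
  by (rule adjoint_op_bounded[OF hilbert_K H.inner_product_space_axioms V_bounded])

text \<open>An explicit adjoint on the dense family, read off from the inner products with V w. It
  turns the relation T V* = W* S into the intertwining property of T.\<close>

lemma V_adj_E:
  assumes x: "(n, a, v) \<in> reps"
  shows "V_adj (E (n, a, v)) = (\<Oplus>\<^bsub>K\<^esub>i\<in>{..<n}. \<phi> (a i) (v i))"
proof (rule K.inprod_eqI)
  have cl: "(\<lambda>i. \<phi> (a i) (v i)) \<in> {..<n} \<rightarrow> carrier K" using x by auto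
  show "V_adj (E (n, a, v)) \<in> carrier K" by (rule bounded_ops_closed[OF V_adj_bounded E.e_closed[OF x]])
  show "(\<Oplus>\<^bsub>K\<^esub>i\<in>{..<n}. \<phi> (a i) (v i)) \<in> carrier K" by (rule K.finsum_closed[OF cl])
  fix w assume w: "w \<in> carrier K"
  show "inprod K w (V_adj (E (n, a, v))) = inprod K w (\<Oplus>\<^bsub>K\<^esub>i\<in>{..<n}. \<phi> (a i) (v i))"
    using adjoint_op_inprod[OF hilbert_K H.inner_product_space_axioms V_bounded w E.e_closed[OF x]]
      V_inprod[OF w x] K.inprod_finsum_right[OF _ w cl] by simp
qed

lemma rep_V:
  assumes a: "a \<in> carrier A" and w: "w \<in> carrier K"
  shows "rep a (V w) = E (1, \<lambda>_. a, \<lambda>_. w)"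
proof -
  have "rep a (V w) = E (1, \<lambda>_. a \<otimes>\<^bsub>A\<^esub> \<one>\<^bsub>A\<^esub>, \<lambda>_. w)"
    unfolding V_E[OF w] by (rule rep_E[OF a unit_reps[OF one_closed w]])
  also have "\<dots> = E (1, \<lambda>_. a, \<lambda>_. w)"
    using Ring.ring.is_monoid[OF A.ring_A] a by (simp add: monoid.r_one)
  finally show ?thesis .
qed

lemma V_adj_rep_V:
  assumes a: "a \<in> carrier A" and w: "w \<in> carrier K"
  shows "V_adj (rep a (V w)) = \<phi> a w"
  unfolding rep_V[OF assms] V_adj_E[OF unit_reps[OF assms]] using assms by (simp add: lessThan_Suc)

text \<open>Minimality of the dilation: the vectors pi(a) V v span a dense subspace. This is why a
  morphism out of it is determined by its values on V.\<close>

lemma E_span: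
  assumes x: "(n, a, v) \<in> reps"
  shows "E (n, a, v) = (\<Oplus>\<^bsub>Hs\<^esub>i\<in>{..<n}. rep (a i) (V (v i)))"
proof (rule E.dense_inprod_eqI)
  have c: "a i \<in> carrier A" "v i \<in> carrier K" if "i < n" for i using x that by auto
  have cl: "(\<lambda>i. rep (a i) (V (v i))) \<in> {..<n} \<rightarrow> carrier Hs"
    using c by (auto intro!: bounded_ops_closed[OF rep_bounded] V_closed)
  show "E (n, a, v) \<in> carrier Hs" by (rule E.e_closed[OF x])
  show "(\<Oplus>\<^bsub>Hs\<^esub>i\<in>{..<n}. rep (a i) (V (v i))) \<in> carrier Hs" by (rule H.finsum_closed[OF cl])
  fix z assume z: "z \<in> reps"
  obtain m y w where z': "z = (m, y, w)" by (cases z)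
  have "inprod Hs (E z) (\<Oplus>\<^bsub>Hs\<^esub>i\<in>{..<n}. rep (a i) (V (v i))) = (\<Sum>i<n. inprod Hs (E z) (rep (a i) (V (v i))))"
    by (rule H.inprod_finsum_right[OF _ E.e_closed[OF z] cl]) simp
  also have "\<dots> = (\<Sum>i<n. form m y w 1 (\<lambda>_. a i) (\<lambda>_. v i))"
    using c z unfolding z' by (intro sum.cong refl) (simp only: rep_V lessThan_iff E_inprod unit_reps)
  also have "\<dots> = form m y w n a v"
    unfolding form_def by (simp, rule sum.swap)
  also have "\<dots> = inprod Hs (E z) (E (n, a, v))"
    using x z unfolding z' by (simp only: E_inprod)
  finally show "inprod Hs (E z) (E (n, a, v)) = inprod Hs (E z) (\<Oplus>\<^bsub>Hs\<^esub>i\<in>{..<n}. rep (a i) (V (v i)))"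
    by simp
qed

lemma Stine_eq: "Stine A (K, \<phi>) = (K, Hs, rep, V)"
  by (simp add: Stine_def)

lemma anchored_rep_Stine: "anchored_rep A (K, Hs, rep, V)"
  using hilbert_K hilbert_space_H star_hom_rep V_bounded by simp

text \<open>V* pi(a) V = phi(a) gives equality of values; equality as functions also uses that phi
  and each phi(a) are extensional.\<close>

lemma rest_obj_Stine: "rest_obj A (K, Hs, rep, V) = (K, \<phi>)"
proof -
  have "\<phi> a \<in> extensional (carrier K)" if "a \<in> carrier A" for a
    using bounded_ops_extensional[OF phi_bounded[OF that]] .
  moreover have "\<phi> \<in> extensional (carrier A)"
    using cp by (auto simp: cp_map_def PiE_def)
  ultimately have "(\<lambda>a\<in>carrier A. \<lambda>v\<in>carrier K. V_adj (rep a (V v))) = \<phi>"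
    by (auto simp: fun_eq_iff V_adj_rep_V extensional_def restrict_def)
  then show ?thesis by simp
qed

text \<open>States that 1 (x) P is bounded above on the pre-Hilbert space, for a self-adjoint P in
  the commutant of the range of phi. It is meant for P = T* T, whose form is the squared norm of the
  lifted vector.\<close>

lemma commuting_form_bound:
  assumes P: "P \<in> bounded_ops K K"
    and sa: "\<And>u w. \<lbrakk>u \<in> carrier K; w \<in> carrier K\<rbrakk> \<Longrightarrow> inprod K (P u) w = inprod K u (P w)"
    and comm: "\<And>x w. \<lbrakk>x \<in> carrier A; w \<in> carrier K\<rbrakk> \<Longrightarrow> P (\<phi> x w) = \<phi> x (P w)"
  obtains B where "B \<ge> 0" "\<And>n a v. (n, a, v) \<in> reps \<Longrightarrow>
    Re (form n a v n a (\<lambda>i. P (v i))) \<le> B * (hnorm Hs (E (n, a, v)))\<^sup>2"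
proof -
  obtain B0 where B0: "B0 \<ge> 0" "\<And>w. w \<in> carrier K \<Longrightarrow> hnorm K (P w) \<le> B0 * hnorm K w"
    using bounded_ops_bound[OF P K.semi_inner_space_axioms] by blast
  \<comment> \<open>The growth rate has to be strictly positive for \<open>powers_dominated\<close>,
    even if P = 0.\<close>
  define b where "b = B0 + 1"
  have b: "b > 0" using B0 by (simp add: b_def)
  have Pb: "hnorm K (P w) \<le> b * hnorm K w" if "w \<in> carrier K" for w
    using B0(2)[OF that] K.hnorm_nonneg[OF that] by (simp add: b_def distrib_right)
  have Pk [simp]: "(P ^^ k) w \<in> carrier K" if "w \<in> carrier K" for k w
    using that by (induction k) (auto intro: bounded_ops_closed[OF P])
  have Pkb: "hnorm K ((P ^^ k) w) \<le> b ^ k * hnorm K w" if "w \<in> carrier K" for k w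
  proof (induction k)
    case (Suc k)
    have "hnorm K (P ((P ^^ k) w)) \<le> b * hnorm K ((P ^^ k) w)" using that by (intro Pb Pk)
    also have "\<dots> \<le> b * (b ^ k * hnorm K w)" using Suc b by (intro mult_left_mono) auto
    finally show ?case by (simp add: mult.assoc)
  qed simp
  have Pksa: "inprod K ((P ^^ k) u) w = inprod K u ((P ^^ k) w)" if "u \<in> carrier K" "w \<in> carrier K" for k u w
    using that
  proof (induction k arbitrary: w)
    case (Suc k)
    then show ?case
      using sa[of "(P ^^ k) u" w] Suc.IH[of "P w"] bounded_ops_closed[OF P] by (simp add: funpow_swap1)
  qed simp
  have Pkcomm: "(P ^^ k) (\<phi> x w) = \<phi> x ((P ^^ k) w)" if "x \<in> carrier A" "w \<in> carrier K" for k x w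
    using that by (induction k) (auto simp: comm)
  have main: "Re (form n a v n a (\<lambda>i. P (v i))) \<le> b * (hnorm Hs (E (n, a, v)))\<^sup>2" if x: "(n, a, v) \<in> reps" for n a v
  proof -
    have c: "a i \<in> carrier A" "v i \<in> carrier K" if "i < n" for i using x that by auto
    have xk: "(n, a, \<lambda>i. (P ^^ k) (v i)) \<in> reps" for k using x Pk[OF c(2)] by auto
    define t where "t k = Re (form n a v n a (\<lambda>i. (P ^^ k) (v i)))" for k
    \<comment> \<open>This constant depends on the family (a, v) but not on k, which is all that
      \<open>powers_dominated\<close> asks; it leaves no trace in the resulting bound.\<close>
    define C where "C = (\<Sum>i<n. \<Sum>j<n. hnorm K (\<phi> (star A (star A (a i) \<otimes>\<^bsub>A\<^esub> a j)) (v i)) * hnorm K (v j))"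
    have t0: "t 0 = (hnorm Hs (E (n, a, v)))\<^sup>2"
      using E.e_closed[OF x] E_inprod[OF x x] by (simp add: t_def H.hnorm_power2)
    \<comment> \<open>Half of the 2 k factors P are moved to the left argument, past phi by
      commutation and across the inner product by self-adjointness; so even values of t are squared
      norms.\<close>
    have t2: "t (2 * k) = (hnorm Hs (E (n, a, \<lambda>i. (P ^^ k) (v i))))\<^sup>2" for k
    proof -
      have "form n a (\<lambda>i. (P ^^ k) (v i)) n a (\<lambda>i. (P ^^ k) (v i)) = form n a v n a (\<lambda>i. (P ^^ (2 * k)) (v i))"
        unfolding form_def
      proof (intro sum.cong refl)
        fix i j assume "i \<in> {..<n}" "j \<in> {..<n}"
        then have ij: "i < n" "j < n" by auto
        show "inprod K ((P ^^ k) (v i)) (\<phi> (star A (a i) \<otimes>\<^bsub>A\<^esub> a j) ((P ^^ k) (v j))) =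
            inprod K (v i) (\<phi> (star A (a i) \<otimes>\<^bsub>A\<^esub> a j) ((P ^^ (2 * k)) (v j)))"
          using c[OF ij(1)] c[OF ij(2)] by (simp add: Pksa Pkcomm mult_2 funpow_add)
      qed
      then show ?thesis
        using E.e_closed[OF xk] E_inprod[OF xk xk] by (simp add: t_def H.hnorm_power2)
    qed
    have "t 1 \<le> b * t 0"
    proof (rule powers_dominated[OF _ _ _ b, where C = C])
      show "0 \<le> t 0" by (simp add: t0)
      fix k
      have "\<bar>t k\<bar> \<le> cmod (inprod Hs (E (n, a, v)) (E (n, a, \<lambda>i. (P ^^ k) (v i))))"
        unfolding t_def E_inprod[OF x xk] by (rule abs_Re_le_cmod)
      also have "\<dots> \<le> hnorm Hs (E (n, a, v)) * hnorm Hs (E (n, a, \<lambda>i. (P ^^ k) (v i)))"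
        by (intro H.Cauchy_Schwarz E.e_closed x xk)
      finally have "\<bar>t k\<bar>\<^sup>2 \<le> (hnorm Hs (E (n, a, v)) * hnorm Hs (E (n, a, \<lambda>i. (P ^^ k) (v i))))\<^sup>2"
        by (intro power_mono) auto
      then show "(t k)\<^sup>2 \<le> t 0 * t (2 * k)"
        by (simp add: t0 t2 power_mult_distrib)
      have "\<bar>t k\<bar> \<le> cmod (form n a v n a (\<lambda>i. (P ^^ k) (v i)))"
        unfolding t_def by (rule abs_Re_le_cmod)
      also have "\<dots> \<le> (\<Sum>i<n. \<Sum>j<n. cmod (inprod K (v i) (\<phi> (star A (a i) \<otimes>\<^bsub>A\<^esub> a j) ((P ^^ k) (v j)))))"
        unfolding form_def by (intro order_trans[OF norm_sum] sum_mono norm_sum)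
      also have "\<dots> \<le> (\<Sum>i<n. \<Sum>j<n. hnorm K (\<phi> (star A (star A (a i) \<otimes>\<^bsub>A\<^esub> a j)) (v i)) * hnorm K (v j) * b ^ k)"
      proof (intro sum_mono)
        fix i j assume "i \<in> {..<n}" "j \<in> {..<n}"
        then have ij: "i < n" "j < n" by auto
        note cc = c[OF ij(1)] c[OF ij(2)]
        let ?x = "star A (a i) \<otimes>\<^bsub>A\<^esub> a j"
        \<comment> \<open>With phi moved to the left, the power of P stands alone on the right,
          where \<open>Pkb\<close> yields the factor b^k.\<close>
        have "inprod K (v i) (\<phi> ?x ((P ^^ k) (v j))) = inprod K (\<phi> (star A ?x) (v i)) ((P ^^ k) (v j))"
          using cc by (simp add: phi_selfadjoint)
        then have "cmod (inprod K (v i) (\<phi> ?x ((P ^^ k) (v j)))) \<le> hnorm K (\<phi> (star A ?x) (v i)) * hnorm K ((P ^^ k) (v j))"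
          using cc by (simp add: K.Cauchy_Schwarz)
        also have "\<dots> \<le> hnorm K (\<phi> (star A ?x) (v i)) * (b ^ k * hnorm K (v j))"
          using cc Pkb by (intro mult_left_mono) auto
        finally show "cmod (inprod K (v i) (\<phi> ?x ((P ^^ k) (v j)))) \<le> hnorm K (\<phi> (star A ?x) (v i)) * hnorm K (v j) * b ^ k"
          by (simp add: mult_ac)
      qed
      also have "\<dots> = C * b ^ k" by (simp add: C_def sum_distrib_right)
      finally show "\<bar>t k\<bar> \<le> C * b ^ k" .
    qed
    then show ?thesis by (simp add: t0, simp add: t_def)
  qed
  show ?thesis using that[of b] main b by auto
qed

end

section \<open>The lift of a morphism\<close>

locale stinespring_morphism =
  fixes A :: "'a normed_star_algebra"
    and K :: "'k inner_space" and L :: "'l inner_space" and I :: "'i inner_space"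
    and \<phi> :: "'a \<Rightarrow> 'k \<Rightarrow> 'k" and \<psi> :: "'a \<Rightarrow> 'l \<Rightarrow> 'l" and T :: "'k \<Rightarrow> 'l"
    and \<rho> :: "'a \<Rightarrow> 'i \<Rightarrow> 'i" and W :: "'l \<Rightarrow> 'i"
  assumes cstar_A: "cstar_algebra A"
    and morphism: "ocp_morphism A (K, \<phi>) (L, \<psi>) T"
    and stinespring: "stinespring_rep A (L, \<psi>) (L, I, \<rho>, W)"
begin

sublocale S: stinespring_construction A K \<phi>
  using cstar_A morphism by (intro stinespring_construction.intro) auto

sublocale L: hilbert_space L
  using morphism by simp

sublocale I: hilbert_space I
  using stinespring by simp

lemma T_bounded: "T \<in> bounded_ops K L"
  and T_intertwines: "\<lbrakk>a \<in> carrier A; v \<in> carrier K\<rbrakk> \<Longrightarrow> T (\<phi> a v) = \<psi> a (T v)"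
  using morphism by auto

lemma anchored_target: "anchored_rep A (L, I, \<rho>, W)"
  and W_bounded: "W \<in> bounded_ops L I"
  and star_hom_rho: "star_hom A (op_algebra I) \<rho>"
  and psi_eq: "\<lbrakk>a \<in> carrier A; v \<in> carrier L\<rbrakk> \<Longrightarrow> \<psi> a v = adjoint_op L I W (\<rho> a (W v))"
  using stinespring by auto

lemmas T_closed [simp, intro] = bounded_ops_closed[OF T_bounded]
lemmas W_closed [simp, intro] = bounded_ops_closed[OF W_bounded]

lemma rho_hom: "\<rho> \<in> ring_hom A (op_algebra I)"
  using star_hom_rho by (simp add: star_hom_def)

lemma rho_bounded: "a \<in> carrier A \<Longrightarrow> \<rho> a \<in> bounded_ops I I"
  using ring_hom_closed[OF rho_hom] by simp

lemma rho_closed [simp, intro]: "a \<in> carrier A \<Longrightarrow> x \<in> carrier I \<Longrightarrow> \<rho> a x \<in> carrier I"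
  by (rule bounded_ops_closed[OF rho_bounded])

lemma rho_mult: "\<lbrakk>a \<in> carrier A; b \<in> carrier A; x \<in> carrier I\<rbrakk> \<Longrightarrow> \<rho> (a \<otimes>\<^bsub>A\<^esub> b) x = \<rho> a (\<rho> b x)"
  using ring_hom_mult[OF rho_hom, of a b] by (simp add: compose_eq)

lemma rho_one: "x \<in> carrier I \<Longrightarrow> \<rho> \<one>\<^bsub>A\<^esub> x = x"
  using ring_hom_one[OF rho_hom] by simp

lemma rho_smult: "\<lbrakk>a \<in> carrier A; x \<in> carrier I\<rbrakk> \<Longrightarrow> \<rho> (c \<odot>\<^bsub>A\<^esub> a) x = c \<odot>\<^bsub>I\<^esub> \<rho> a x"
  using star_hom_rho by (simp add: star_hom_def)

lemma rho_adjoint: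
  assumes "a \<in> carrier A" "x \<in> carrier I" "y \<in> carrier I"
  shows "inprod I (\<rho> a x) y = inprod I x (\<rho> (star A a) y)"
proof -
  have "\<rho> (star A a) = adjoint_op I I (\<rho> a)"
    using star_hom_rho assms(1) by (simp add: star_hom_def)
  then show ?thesis
    using adjoint_op_inprod[OF I.hilbert_space_axioms I.inner_product_space_axioms rho_bounded] assms by simp
qed

lemma W_inprod: "\<lbrakk>y \<in> carrier L; z \<in> carrier L; a \<in> carrier A\<rbrakk> \<Longrightarrow>
    inprod I (W y) (\<rho> a (W z)) = inprod L y (\<psi> a z)"
  using adjoint_op_inprod[OF L.hilbert_space_axioms I.inner_product_space_axioms W_bounded, of y "\<rho> a (W z)"]
  by (simp add: psi_eq)

text \<open>The value forced upon the lift at \<open>S.E\<close>. It is defined on indices, since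
  independence of the representation follows only from \<open>F_bound\<close>.\<close>

definition F :: "nat \<times> (nat \<Rightarrow> 'a) \<times> (nat \<Rightarrow> 'k) \<Rightarrow> 'i"
  where "F = (\<lambda>(n, a, v). \<Oplus>\<^bsub>I\<^esub>i\<in>{..<n}. \<rho> (a i) (W (T (v i))))"

lemma F_eq: "F (n, a, v) = (\<Oplus>\<^bsub>I\<^esub>i\<in>{..<n}. \<rho> (a i) (W (T (v i))))"
  by (simp add: F_def)

lemma F_summand: "(n, a, v) \<in> S.reps \<Longrightarrow> (\<lambda>i. \<rho> (a i) (W (T (v i)))) \<in> {..<n} \<rightarrow> carrier I"
  by (auto simp: Pi_iff)

lemma F_closed: "x \<in> S.reps \<Longrightarrow> F x \<in> carrier I"
  by (cases x) (simp only: F_eq I.finsum_closed F_summand)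

lemma F_add:
  assumes x: "(n, a, v) \<in> S.reps" and y: "(m, b, w) \<in> S.reps"
  shows "F (n + m, cat n a b, cat n v w) = F (n, a, v) \<oplus>\<^bsub>I\<^esub> F (m, b, w)"
  using y
proof (induction m)
  case 0
  have "F (n, cat n a b, cat n v w) = F (n, a, v)"
    unfolding F_eq using F_summand[OF x] by (intro I.finsum_cong') auto
  then show ?case using F_closed[OF x] by (simp add: F_eq)
next
  case (Suc m)
  let ?g = "\<lambda>b w i. \<rho> (b i) (W (T (w i)))"
  have y: "(m, b, w) \<in> S.reps" using Suc.prems by auto
  have "(n + Suc m, cat n a b, cat n v w) \<in> S.reps"
    using x Suc.prems cat_closed[of a n "carrier A" b "Suc m"] cat_closed[of v n "carrier K" w "Suc m"] by simp
  then have cat: "?g (cat n a b) (cat n v w) \<in> {..<Suc (n + m)} \<rightarrow> carrier I"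
    using F_summand by fastforce
  have step: "(\<Oplus>\<^bsub>I\<^esub>i\<in>{..<Suc k}. f i) = f k \<oplus>\<^bsub>I\<^esub> (\<Oplus>\<^bsub>I\<^esub>i\<in>{..<k}. f i)" if "f \<in> {..<Suc k} \<rightarrow> carrier I" for k f
    unfolding lessThan_Suc using that by (intro I.finsum_insert) auto
  have gm: "?g b w m \<in> carrier I" using Suc.prems by (auto simp: Pi_iff)
  have "F (n + Suc m, cat n a b, cat n v w) = ?g b w m \<oplus>\<^bsub>I\<^esub> F (n + m, cat n a b, cat n v w)"
    unfolding F_eq add_Suc_right step[OF cat] by simp
  also have "\<dots> = ?g b w m \<oplus>\<^bsub>I\<^esub> (F (n, a, v) \<oplus>\<^bsub>I\<^esub> F (m, b, w))"
    by (simp only: Suc.IH[OF y])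
  also have "\<dots> = F (n, a, v) \<oplus>\<^bsub>I\<^esub> (?g b w m \<oplus>\<^bsub>I\<^esub> F (m, b, w))"
    using gm F_closed[OF x] F_closed[OF y] by (intro I.M.a_lcomm)
  also have "?g b w m \<oplus>\<^bsub>I\<^esub> F (m, b, w) = F (Suc m, b, w)"
    unfolding F_eq step[OF F_summand[OF Suc.prems]] by simp
  finally show ?case .
qed

lemma F_smult:
  assumes x: "(n, a, v) \<in> S.reps"
  shows "F (n, \<lambda>i. c \<odot>\<^bsub>A\<^esub> a i, v) = c \<odot>\<^bsub>I\<^esub> F (n, a, v)"
proof -
  have "F (n, \<lambda>i. c \<odot>\<^bsub>A\<^esub> a i, v) = (\<Oplus>\<^bsub>I\<^esub>i\<in>{..<n}. c \<odot>\<^bsub>I\<^esub> \<rho> (a i) (W (T (v i))))"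
    unfolding F_eq using x F_summand[OF x] by (intro I.finsum_cong') (auto simp: rho_smult Pi_iff)
  also have "\<dots> = c \<odot>\<^bsub>I\<^esub> F (n, a, v)"
    unfolding F_eq using F_summand[OF x] by (intro I.finsum_smult_ldistr[symmetric]) auto
  finally show ?thesis .
qed

text \<open>The product rho(a_i)* rho(a_j) is rho(a_i* a_j), its compression by W is psi(a_i* a_j),
  and T exchanges psi for phi. T stays on both sides, so it can either be gathered into T* T or
  cancelled when it is isometric.\<close>

lemma F_inprod:
  assumes x: "(n, a, v) \<in> S.reps"
  shows "inprod I (F (n, a, v)) (F (n, a, v)) =
    (\<Sum>i<n. \<Sum>j<n. inprod L (T (v i)) (T (\<phi> (star A (a i) \<otimes>\<^bsub>A\<^esub> a j) (v j))))"
proof -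
  have c: "a i \<in> carrier A" "v i \<in> carrier K" if "i < n" for i using x that by auto
  have "inprod I (F (n, a, v)) (F (n, a, v)) = (\<Sum>i<n. inprod I (\<rho> (a i) (W (T (v i)))) (F (n, a, v)))"
    using I.inprod_finsum_left[OF _ F_closed[OF x] F_summand[OF x]] by (simp add: F_eq)
  also have "\<dots> = (\<Sum>i<n. \<Sum>j<n. inprod I (\<rho> (a i) (W (T (v i)))) (\<rho> (a j) (W (T (v j)))))"
    unfolding F_eq using c F_summand[OF x] by (intro sum.cong refl I.inprod_finsum_right) auto
  also have "\<dots> = (\<Sum>i<n. \<Sum>j<n. inprod L (T (v i)) (T (\<phi> (star A (a i) \<otimes>\<^bsub>A\<^esub> a j) (v j))))"
  proof (intro sum.cong refl)
    fix i j assume "i \<in> {..<n}" "j \<in> {..<n}"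
    then have ij: "i < n" "j < n" by auto
    note cc = c[OF ij(1)] c[OF ij(2)]
    have "inprod I (\<rho> (a i) (W (T (v i)))) (\<rho> (a j) (W (T (v j)))) =
        inprod I (W (T (v i))) (\<rho> (star A (a i) \<otimes>\<^bsub>A\<^esub> a j) (W (T (v j))))"
      using cc by (simp add: rho_adjoint rho_mult)
    also have "\<dots> = inprod L (T (v i)) (T (\<phi> (star A (a i) \<otimes>\<^bsub>A\<^esub> a j) (v j)))"
      using cc by (simp add: W_inprod T_intertwines)
    finally show "inprod I (\<rho> (a i) (W (T (v i)))) (\<rho> (a j) (W (T (v j)))) =
        inprod L (T (v i)) (T (\<phi> (star A (a i) \<otimes>\<^bsub>A\<^esub> a j) (v j)))" .
  qed
  finally show ?thesis .
qed

lemma F_bound: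
  obtains B where "B \<ge> 0" "\<And>x. x \<in> S.reps \<Longrightarrow> hnorm I (F x) \<le> B * hnorm S.Hs (S.E x)"
proof -
  define P where "P = compose (carrier K) (adjoint_op K L T) T"
  note adjT = adjoint_op_inprod[OF S.hilbert_K L.inner_product_space_axioms T_bounded]
  note adjTb = adjoint_op_bounded[OF S.hilbert_K L.inner_product_space_axioms T_bounded]
  note [simp] = bounded_ops_closed[OF adjTb]
  have P_inprod: "inprod K u (P w) = inprod L (T u) (T w)" if "u \<in> carrier K" "w \<in> carrier K" for u w
    using that by (simp add: P_def compose_eq adjT)
  have P: "P \<in> bounded_ops K K"
    unfolding P_def by (rule bounded_ops_compose[OF T_bounded adjTb S.K.semi_inner_space_axioms L.semi_inner_space_axioms])
  note [simp] = bounded_ops_closed[OF P]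
  have sa: "inprod K (P u) w = inprod K u (P w)" if "u \<in> carrier K" "w \<in> carrier K" for u w
    using that S.K.inprod_cnj[of w "P u"] L.inprod_cnj[of "T w" "T u"] by (simp add: P_inprod)
  \<comment> \<open>The adjoint of phi(x) goes to the left, T intertwines it with the adjoint of
    psi(x), and psi(x) returns to the right to be intertwined once more. Both moves across the inner
    product use that phi and psi preserve adjoints.\<close>
  have comm: "P (\<phi> x w) = \<phi> x (P w)" if x: "x \<in> carrier A" and w: "w \<in> carrier K" for x w
  proof (rule S.K.inprod_eqI)
    fix u assume u: "u \<in> carrier K"
    interpret L': stinespring_construction A L \<psi>
      using cstar_A morphism by (intro stinespring_construction.intro) auto
    have "inprod K u (\<phi> x (P w)) = inprod K (\<phi> (star A x) u) (P w)"
      using u x w by (simp add: S.phi_selfadjoint)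
    also have "\<dots> = inprod L (\<psi> (star A x) (T u)) (T w)"
      using u x w by (simp add: P_inprod T_intertwines)
    also have "\<dots> = inprod L (T u) (T (\<phi> x w))"
      using u x w by (simp add: L'.phi_selfadjoint T_intertwines)
    also have "\<dots> = inprod K u (P (\<phi> x w))"
      using u x w by (simp add: P_inprod)
    finally show "inprod K u (P (\<phi> x w)) = inprod K u (\<phi> x (P w))" by simp
  qed (use x w in auto)
  obtain B where B: "B \<ge> 0" "\<And>n a v. (n, a, v) \<in> S.reps \<Longrightarrow>
      Re (S.form n a v n a (\<lambda>i. P (v i))) \<le> B * (hnorm S.Hs (S.E (n, a, v)))\<^sup>2"
    using S.commuting_form_bound[OF P sa comm] by blast
  have "hnorm I (F (n, a, v)) \<le> sqrt B * hnorm S.Hs (S.E (n, a, v))" if x: "(n, a, v) \<in> S.reps" for n a v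
  proof (rule power2_le_imp_le)
    have "inprod I (F (n, a, v)) (F (n, a, v)) = S.form n a v n a (\<lambda>i. P (v i))"
      unfolding F_inprod[OF x] S.form_def
    proof (intro sum.cong refl)
      fix i j assume "i \<in> {..<n}" "j \<in> {..<n}"
      then have "a i \<in> carrier A" "a j \<in> carrier A" "v i \<in> carrier K" "v j \<in> carrier K" using x by auto
      then show "inprod L (T (v i)) (T (\<phi> (star A (a i) \<otimes>\<^bsub>A\<^esub> a j) (v j))) =
          inprod K (v i) (\<phi> (star A (a i) \<otimes>\<^bsub>A\<^esub> a j) (P (v j)))"
        by (simp add: P_inprod flip: comm)
    qed
    then show "(hnorm I (F (n, a, v)))\<^sup>2 \<le> (sqrt B * hnorm S.Hs (S.E (n, a, v)))\<^sup>2"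
      using B(2)[OF x] B(1) F_closed[OF x] by (simp add: I.hnorm_power2 power_mult_distrib)
    show "0 \<le> sqrt B * hnorm S.Hs (S.E (n, a, v))"
      using B(1) S.E.e_closed[OF x] by simp
  qed
  then show ?thesis using that[of "sqrt B"] B(1) by auto
qed

lemma exists_lift:
  obtains S where "S \<in> bounded_ops S.Hs I" "\<And>x. x \<in> S.reps \<Longrightarrow> S (S.E x) = F x"
proof -
  obtain B where B: "B \<ge> 0" "\<And>x. x \<in> S.reps \<Longrightarrow> hnorm I (F x) \<le> B * hnorm S.Hs (S.E x)"
    using F_bound by blast
  show ?thesis
  proof (rule S.E.extend_bounded_op[OF I.hilbert_space_axioms, of F B])
    fix x assume x: "x \<in> S.reps"
    obtain n a v where xe: "x = (n, a, v)" by (cases x)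
    show "F x \<in> carrier I" by (rule F_closed[OF x])
    fix c
    have "(n, \<lambda>i. c \<odot>\<^bsub>A\<^esub> a i, v) \<in> S.reps" using x unfolding xe by auto
    then show "\<exists>z\<in>S.reps. S.E z = c \<odot>\<^bsub>S.Hs\<^esub> S.E x \<and> F z = c \<odot>\<^bsub>I\<^esub> F x"
      using S.E_smult F_smult x unfolding xe by blast
    fix y assume y: "y \<in> S.reps"
    obtain m b w where ye: "y = (m, b, w)" by (cases y)
    have "(n + m, cat n a b, cat n v w) \<in> S.reps"
      using x y unfolding xe ye by (simp add: cat_closed)
    then show "\<exists>z\<in>S.reps. S.E z = S.E x \<oplus>\<^bsub>S.Hs\<^esub> S.E y \<and> F z = F x \<oplus>\<^bsub>I\<^esub> F y"
      using S.E_add F_add x y unfolding xe ye by blast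
  qed (use that B in auto)
qed

lemma rest_target: "rest_obj A (L, I, \<rho>, W) = (L, \<psi>)"
proof -
  interpret L': stinespring_construction A L \<psi>
    using cstar_A morphism by (intro stinespring_construction.intro) auto
  have "\<psi> a \<in> extensional (carrier L)" if "a \<in> carrier A" for a
    using bounded_ops_extensional[OF L'.phi_bounded[OF that]] .
  moreover have "\<psi> \<in> extensional (carrier A)"
    using L'.cp by (auto simp: cp_map_def PiE_def)
  ultimately have "(\<lambda>a\<in>carrier A. \<lambda>v\<in>carrier L. adjoint_op L I W (\<rho> a (W v))) = \<psi>"
    by (auto simp: fun_eq_iff psi_eq extensional_def restrict_def)
  then show ?thesis by simp
qed

lemma F_unit: "a \<in> carrier A \<Longrightarrow> w \<in> carrier K \<Longrightarrow> F (1, \<lambda>_. a, \<lambda>_. w) = \<rho> a (W (T w))"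
  by (simp add: F_eq lessThan_Suc)

text \<open>The relation S V = W T is read off the one-term families 1 (x) v. The other two compare
  bounded operators on the dense family: \<open>V_adj_E\<close> and psi = W* rho W settle the
  adjoint relation, multiplicativity of rho the intertwining.\<close>

lemma lift_is_morphism:
  assumes S: "S \<in> bounded_ops S.Hs I" and SE: "\<And>x. x \<in> S.reps \<Longrightarrow> S (S.E x) = F x"
  shows "anchored_morphism A (K, S.Hs, S.rep, S.V) (L, I, \<rho>, W) (T, S)"
  unfolding anchored_morphism.simps
proof (intro conjI ballI S.anchored_rep_Stine anchored_target T_bounded S)
  note Wadj = adjoint_op_bounded[OF L.hilbert_space_axioms I.inner_product_space_axioms W_bounded]
  fix v assume v: "v \<in> carrier K"
  show "S (S.V v) = W (T v)"
    unfolding S.V_E[OF v] SE[OF S.unit_reps[OF S.one_closed v]] F_unit[OF S.one_closed v]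
    using v by (simp add: rho_one)
next
  note Wadj = adjoint_op_bounded[OF L.hilbert_space_axioms I.inner_product_space_axioms W_bounded]
  have "compose (carrier S.Hs) T S.V_adj = compose (carrier S.Hs) (adjoint_op L I W) S"
  proof (rule S.E.dense_bounded_ops_eqI[OF _ _ L.inner_product_space_axioms])
    show "compose (carrier S.Hs) T S.V_adj \<in> bounded_ops S.Hs L"
      by (rule bounded_ops_compose[OF S.V_adj_bounded T_bounded S.H.semi_inner_space_axioms S.K.semi_inner_space_axioms])
    show "compose (carrier S.Hs) (adjoint_op L I W) S \<in> bounded_ops S.Hs L"
      by (rule bounded_ops_compose[OF S Wadj S.H.semi_inner_space_axioms I.semi_inner_space_axioms])
    fix x assume x: "x \<in> S.reps"
    obtain n a v where xe: "x = (n, a, v)" by (cases x)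
    have c: "a i \<in> carrier A" "v i \<in> carrier K" if "i < n" for i using x that unfolding xe by auto
    have "T (S.V_adj (S.E x)) = T (\<Oplus>\<^bsub>K\<^esub>i\<in>{..<n}. \<phi> (a i) (v i))"
      using x unfolding xe by (simp only: S.V_adj_E)
    also have "\<dots> = (\<Oplus>\<^bsub>L\<^esub>i\<in>{..<n}. T (\<phi> (a i) (v i)))"
      using c by (intro S.K.bounded_ops_finsum T_bounded L.semi_inner_space_axioms) auto
    also have "\<dots> = (\<Oplus>\<^bsub>L\<^esub>i\<in>{..<n}. adjoint_op L I W (\<rho> (a i) (W (T (v i)))))"
      using c by (intro L.finsum_cong') (auto simp: T_intertwines psi_eq intro!: bounded_ops_closed[OF Wadj])
    also have "\<dots> = adjoint_op L I W (F x)"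
      unfolding xe F_eq using x
      by (intro I.bounded_ops_finsum[symmetric] Wadj L.semi_inner_space_axioms F_summand) (auto simp: xe)
    finally show "compose (carrier S.Hs) T S.V_adj (S.E x) = compose (carrier S.Hs) (adjoint_op L I W) S (S.E x)"
      using S.E.e_closed[OF x] SE[OF x] by (simp add: compose_eq)
  qed
  from fun_cong[OF this] show "T (S.V_adj x) = adjoint_op L I W (S x)" if "x \<in> carrier S.Hs" for x
    using compose_eq[OF that, of T S.V_adj] compose_eq[OF that, of "adjoint_op L I W" S] by (simp only:)
next
  fix a x assume a: "a \<in> carrier A" and x: "x \<in> carrier S.Hs"
  have "compose (carrier S.Hs) S (S.rep a) = compose (carrier S.Hs) (\<rho> a) S"
  proof (rule S.E.dense_bounded_ops_eqI[OF _ _ I.inner_product_space_axioms])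
    show "compose (carrier S.Hs) S (S.rep a) \<in> bounded_ops S.Hs I"
      by (rule bounded_ops_compose[OF S.rep_bounded[OF a] S S.H.semi_inner_space_axioms S.H.semi_inner_space_axioms])
    show "compose (carrier S.Hs) (\<rho> a) S \<in> bounded_ops S.Hs I"
      by (rule bounded_ops_compose[OF S rho_bounded[OF a] S.H.semi_inner_space_axioms I.semi_inner_space_axioms])
    fix x assume x: "x \<in> S.reps"
    obtain n b v where xe: "x = (n, b, v)" by (cases x)
    have c: "b i \<in> carrier A" "v i \<in> carrier K" if "i < n" for i using x that unfolding xe by auto
    have ax: "(n, \<lambda>i. a \<otimes>\<^bsub>A\<^esub> b i, v) \<in> S.reps" using S.reps_mult[OF a] x xe by blast
    have "S (S.rep a (S.E x)) = F (n, \<lambda>i. a \<otimes>\<^bsub>A\<^esub> b i, v)"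
      using x SE[OF ax] unfolding xe by (simp only: S.rep_E[OF a])
    also have "\<dots> = (\<Oplus>\<^bsub>I\<^esub>i\<in>{..<n}. \<rho> a (\<rho> (b i) (W (T (v i)))))"
      unfolding F_eq using c a by (intro I.finsum_cong') (auto simp: rho_mult)
    also have "\<dots> = \<rho> a (F x)"
      unfolding xe F_eq using x
      by (intro I.bounded_ops_finsum[symmetric] rho_bounded a I.semi_inner_space_axioms F_summand) (auto simp: xe)
    finally show "compose (carrier S.Hs) S (S.rep a) (S.E x) = compose (carrier S.Hs) (\<rho> a) S (S.E x)"
      using S.E.e_closed[OF x] SE[OF x] by (simp add: compose_eq)
  qed
  from fun_cong[OF this, of x] show "S (S.rep a x) = \<rho> a (S x)"
    by (simp only: compose_eq[OF x])
qed

text \<open>\<open>E_span\<close> writes the class through pi(a_i) V v_i, and the relations of a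
  morphism carry S past both maps. Uniqueness and the isometry claim both start from this
  formula.\<close>

lemma morphism_lift_E:
  assumes m: "anchored_morphism A (K, S.Hs, S.rep, S.V) (L, I, \<rho>, W) (T, S)" and x: "x \<in> S.reps"
  shows "S (S.E x) = F x"
proof -
  obtain n a v where xe: "x = (n, a, v)" by (cases x)
  have c: "a i \<in> carrier A" "v i \<in> carrier K" if "i < n" for i using x that unfolding xe by auto
  have S: "S \<in> bounded_ops S.Hs I" and inter: "\<And>a x. a \<in> carrier A \<Longrightarrow> x \<in> carrier S.Hs \<Longrightarrow> S (S.rep a x) = \<rho> a (S x)"
    and SV: "\<And>v. v \<in> carrier K \<Longrightarrow> S (S.V v) = W (T v)"
    using m by auto
  have "S (S.E x) = S (\<Oplus>\<^bsub>S.Hs\<^esub>i\<in>{..<n}. S.rep (a i) (S.V (v i)))"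
    using x unfolding xe by (simp only: S.E_span)
  also have "\<dots> = (\<Oplus>\<^bsub>I\<^esub>i\<in>{..<n}. S (S.rep (a i) (S.V (v i))))"
    using c by (intro S.H.bounded_ops_finsum S I.semi_inner_space_axioms)
      (auto intro!: bounded_ops_closed[OF S.rep_bounded] S.V_closed)
  also have "\<dots> = F x"
    unfolding xe F_eq using c by (intro I.finsum_cong') (auto simp: inter SV S.V_closed)
  finally show ?thesis .
qed

text \<open>V* V = phi(1) and W* W = psi(1) are identities for operator states. In
  \<open>F_inprod\<close> an isometric T cancels and leaves the form itself, so S preserves norms on
  the dense family.\<close>

lemma morphism_preserving:
  assumes m: "anchored_morphism A (K, S.Hs, S.rep, S.V) (L, I, \<rho>, W) (T, S)"
    and state: "operator_state_morphism A (K, \<phi>) (L, \<psi>) T"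
  shows "preserving_morphism A (K, S.Hs, S.rep, S.V) (L, I, \<rho>, W) (T, S)"
proof -
  have iso: "is_isometry K L T" and one: "\<And>v. v \<in> carrier K \<Longrightarrow> \<phi> \<one>\<^bsub>A\<^esub> v = v"
    "\<And>v. v \<in> carrier L \<Longrightarrow> \<psi> \<one>\<^bsub>A\<^esub> v = v"
    using state by auto
  have T_inprod: "inprod L (T u) (T w) = inprod K u w" if "u \<in> carrier K" "w \<in> carrier K" for u w
    using is_isometry_inprod[OF S.K.semi_inner_space_axioms L.semi_inner_space_axioms iso that] .
  have "is_isometry K S.Hs S.V"
    unfolding is_isometry_def
    by (auto simp: S.V_bounded hnorm_def S.V_V_inprod one)
  moreover have "is_isometry L I W"
    unfolding is_isometry_def
  proof (intro conjI ballI W_bounded)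
    fix y assume y: "y \<in> carrier L"
    then show "hnorm I (W y) = hnorm L y"
      using W_inprod[OF y y S.one_closed] by (simp add: hnorm_def rho_one one)
  qed
  moreover have "is_isometry S.Hs I S"
  proof (rule S.E.dense_isometryI[OF _ I.semi_inner_space_axioms])
    show "S \<in> bounded_ops S.Hs I" using m by simp
    fix x assume x: "x \<in> S.reps"
    obtain n a v where xe: "x = (n, a, v)" by (cases x)
    have "inprod I (F x) (F x) = S.form n a v n a v"
      using x unfolding xe F_inprod[OF x[unfolded xe]] S.form_def
      by (intro sum.cong refl T_inprod) auto
    also have "\<dots> = inprod S.Hs (S.E x) (S.E x)"
      using x unfolding xe by (simp only: S.E_inprod)
    finally show "hnorm I (S (S.E x)) = hnorm S.Hs (S.E x)"
      by (simp only: morphism_lift_E[OF m x] hnorm_def)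
  qed
  ultimately show ?thesis
    using m iso S.anchored_rep_Stine anchored_target by simp
qed

end

theorem corollary6p4:
  fixes A :: "'a normed_star_algebra"
    and K :: "'k inner_space" and L :: "'l inner_space" and I :: "'i inner_space"
    and \<phi> :: "'a \<Rightarrow> 'k \<Rightarrow> 'k" and \<psi> :: "'a \<Rightarrow> 'l \<Rightarrow> 'l" and T :: "'k \<Rightarrow> 'l"
    and \<rho> :: "'a \<Rightarrow> 'i \<Rightarrow> 'i" and W :: "'l \<Rightarrow> 'i"
  assumes "cstar_algebra A"
    and "ocp_morphism A (K, \<phi>) (L, \<psi>) T"
    and "stinespring_rep A (L, \<psi>) (L, I, \<rho>, W)"
  shows "(\<exists>!\<tau>. anchored_morphism A (Stine A (K, \<phi>)) (L, I, \<rho>, W) \<tau> \<and>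
               rest_arrow A (Stine A (K, \<phi>), \<tau>, (L, I, \<rho>, W)) = ((K, \<phi>), T, (L, \<psi>))) \<and>
         (operator_state_morphism A (K, \<phi>) (L, \<psi>) T \<longrightarrow>
           (\<forall>\<tau>. anchored_morphism A (Stine A (K, \<phi>)) (L, I, \<rho>, W) \<tau> \<and>
                rest_arrow A (Stine A (K, \<phi>), \<tau>, (L, I, \<rho>, W)) = ((K, \<phi>), T, (L, \<psi>)) \<longrightarrow>
                preserving_morphism A (Stine A (K, \<phi>)) (L, I, \<rho>, W) \<tau>))"
proof -
  interpret stinespring_morphism A K L I \<phi> \<psi> T \<rho> W
    using assms by (rule stinespring_morphism.intro)
  \<comment> \<open>Source and target of the restricted arrow are already the given pairs, so the
    condition concerns the first component only.\<close>
  have rest: "rest_arrow A (Stine A (K, \<phi>), \<tau>, (L, I, \<rho>, W)) = ((K, \<phi>), T, (L, \<psi>)) \<longleftrightarrow> fst \<tau> = T"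
    for \<tau> :: "('k \<Rightarrow> 'l) \<times> (('a, 'k) stine_vec \<Rightarrow> 'i)"
    by (cases \<tau>) (simp only: S.Stine_eq rest_arrow.simps S.rest_obj_Stine rest_target, simp)
  obtain S where S: "S \<in> bounded_ops S.Hs I" "\<And>x. x \<in> S.reps \<Longrightarrow> S (S.E x) = F x"
    by (rule exists_lift) blast
  have unique: "\<tau> = (T, S)"
    if *: "anchored_morphism A (Stine A (K, \<phi>)) (L, I, \<rho>, W) \<tau>" "fst \<tau> = T" for \<tau>
  proof -
    obtain S' where \<tau>: "\<tau> = (T, S')" using *(2) by (cases \<tau>) auto
    have m: "anchored_morphism A (K, S.Hs, S.rep, S.V) (L, I, \<rho>, W) (T, S')"
      using *(1) unfolding \<tau> S.Stine_eq .
    have "S' = S"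
      by (rule S.E.dense_bounded_ops_eqI[OF _ S(1) I.inner_product_space_axioms])
        (use m morphism_lift_E[OF m] S(2) in auto)
    then show ?thesis using \<tau> by simp
  qed
  have lift: "anchored_morphism A (Stine A (K, \<phi>)) (L, I, \<rho>, W) (T, S)"
    unfolding S.Stine_eq by (rule lift_is_morphism[OF S])
  have "\<exists>!\<tau>. anchored_morphism A (Stine A (K, \<phi>)) (L, I, \<rho>, W) \<tau> \<and> fst \<tau> = T"
  proof (rule ex1I[of _ "(T, S)"])
    show "anchored_morphism A (Stine A (K, \<phi>)) (L, I, \<rho>, W) (T, S) \<and> fst (T, S) = T"
      by (rule conjI[OF lift fst_conv])
  qed (use unique in blast)
  moreover have "preserving_morphism A (Stine A (K, \<phi>)) (L, I, \<rho>, W) \<tau>"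
    if "operator_state_morphism A (K, \<phi>) (L, \<psi>) T"
      "anchored_morphism A (Stine A (K, \<phi>)) (L, I, \<rho>, W) \<tau>" "fst \<tau> = T" for \<tau>
    unfolding unique[OF that(2,3)]
    using morphism_preserving[OF _ that(1), of S] lift unfolding S.Stine_eq by blast
  ultimately show ?thesis unfolding rest by blast
qed

end
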